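(* Assume the generalized Riemann hypothesis. For a given integer $N\ge 2$, one can find a modulus $p_N$ and a suitable root $q_N$ (a root of unity modulo $p_N$ suitable for the number theoretic transform) in $\mathcal{O}\left(N(\log N)^2(\log\log N)\right)$ time such that afterwards it is possible, for every $n\le N$, to calculate the acyclic convolution modulo $p_N$ of two sequences of length $n$ in $\mathcal{O}(n\log n)$ time.
   Context: The acyclic convolution modulo $p$ of integer sequences $(a_0,\dots,a_{n-1})$ and $(b_0,\dots,b_{n-1})$ is the sequence $(c_0,\dots,c_{2n-2})$ with $c_s\equiv\sum_{i+j=s}a_ib_j \pmod p$. "Suitable" root means: $p_N$ is prime and $q_N$ is a residue modulo $p_N$ whose multiplicative order is a power of two that is at least $2N$. Computational model: arithmetic operations (including division with remainder) on integers with $\mathcal{O}(\log N)$ bits take constant time. The run-time bounds are asymptotic (as $N\to\infty$, respectively $n\to\infty$). Known fact that may be assumed: under the generalized Riemann hypothesis, for each $n\ge 2$ and $r$ with $\gcd(n,r)=1$ there is a prime congruent to $r$ modulo $n$ that is less than $2(n\log n)^2$ (Bach–Sorenson), and the least quadratic nonresidue modulo a prime $p$ is $\mathcal{O}((\log p)^2)$ (Ankeny). *)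

theory Defs
  imports
    "HOL-Complex_Analysis.Complex_Analysis"
    "HOL-Number_Theory.Number_Theory"
    "HOL-Library.Landau_Symbols"
begin

section \<open>The generalized Riemann hypothesis\<close>

definition dirichlet_character :: "nat \<Rightarrow> (nat \<Rightarrow> complex) \<Rightarrow> bool" where
  "dirichlet_character m \<psi> \<longleftrightarrow>
     (\<forall>a b. \<psi> (a * b) = \<psi> a * \<psi> b) \<and>
     (\<forall>a. \<psi> (a + m) = \<psi> a) \<and>
     (\<forall>a. \<psi> a \<noteq> 0 \<longleftrightarrow> coprime a m)"

text \<open>
  The L-series converges absolutely for real part greater than 1; the L-function is its
  continuation to the plane without the point 1, where principal characters give a pole.
  The value at 1 is left open and plays no role below.
\<close>

definition is_dirichlet_L :: "(nat \<Rightarrow> complex) \<Rightarrow> (complex \<Rightarrow> complex) \<Rightarrow> bool" where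
  "is_dirichlet_L \<psi> L \<longleftrightarrow>
     L holomorphic_on (- {1}) \<and>
     (\<forall>s. Re s > 1 \<longrightarrow> (\<lambda>k. \<psi> (Suc k) * of_nat (Suc k) powr (- s)) sums L s)"

text \<open>
  The characters need not be primitive: the additional zeros of an imprimitive L-function
  lie on the imaginary axis, outside the open critical strip. The Riemann zeta function is
  the case \<open>m = 1\<close>.
\<close>

definition generalized_riemann_hypothesis :: bool where
  "generalized_riemann_hypothesis \<longleftrightarrow>
     (\<forall>m \<psi>. m > 0 \<and> dirichlet_character m \<psi> \<longrightarrow>
        (\<exists>L. is_dirichlet_L \<psi> L \<and>
             (\<forall>s. 0 < Re s \<and> Re s < 1 \<and> L s = 0 \<longrightarrow> Re s = 1 / 2)))"

text \<open>The conclusion of the theorem of Bach and Sorenson.\<close>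

definition bach_sorenson_bound :: bool where
  "bach_sorenson_bound \<longleftrightarrow>
     (\<forall>n r :: nat. n \<ge> 2 \<and> coprime n r \<longrightarrow>
        (\<exists>p :: nat. prime p \<and> [p = r] (mod n) \<and> real p < 2 * (real n * ln (real n))\<^sup>2))"

text \<open>The conclusion of the theorem of Ankeny; modulo 2 there are no quadratic nonresidues.\<close>

definition least_nonresidue :: "nat \<Rightarrow> nat" where
  "least_nonresidue p = (LEAST a. \<not> QuadRes (int p) (int a))"

definition ankeny_bound :: bool where
  "ankeny_bound \<longleftrightarrow>
     (\<exists>C :: real. \<forall>p. prime p \<and> p > 2 \<longrightarrow>
        real (least_nonresidue p) \<le> C * (ln (real p))\<^sup>2)"


section \<open>A word RAM with unit-cost arithmetic\<close>

text \<open>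
  Programs are uniform (one program text for all inputs) and run on integer variables and
  integer arrays. Every constant, every intermediate value and every array index has to fit
  into a word, i.e. be bounded in absolute value by the parameter \<open>W\<close>; a program that leaves
  this range, divides by 0 or uses a negative index gets stuck. Under this restriction every
  operation has cost 1. Bounding \<open>W\<close> by \<open>N ^ c\<close> for a constant \<open>c\<close> is the
  restriction to integers with \<open>O(log N)\<close> bits.
\<close>

datatype binop = AddOp | SubOp | MulOp | DivOp | ModOp

datatype aexp =
    Const int
  | Var string
  | Elem string aexp
  | Bin binop aexp aexp

datatype bexp =
    Less aexp aexp
  | Equal aexp aexp
  | Negate bexp
  | Both bexp bexp

datatype com =
    Skip
  | Assign string aexp
  | Store string aexp aexp
  | Seq com com
  | Cond bexp com com
  | While bexp com

record state =
  var :: "string \<Rightarrow> int"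
  arr :: "string \<Rightarrow> nat \<Rightarrow> int"

fun binop_val :: "binop \<Rightarrow> int \<Rightarrow> int \<Rightarrow> int" where
  "binop_val AddOp x y = x + y"
| "binop_val SubOp x y = x - y"
| "binop_val MulOp x y = x * y"
| "binop_val DivOp x y = x div y"
| "binop_val ModOp x y = x mod y"

fun aval :: "aexp \<Rightarrow> state \<Rightarrow> int" where
  "aval (Const k) s = k"
| "aval (Var x) s = var s x"
| "aval (Elem A i) s = arr s A (nat (aval i s))"
| "aval (Bin f e1 e2) s = binop_val f (aval e1 s) (aval e2 s)"

fun bval :: "bexp \<Rightarrow> state \<Rightarrow> bool" where
  "bval (Less e1 e2) s \<longleftrightarrow> aval e1 s < aval e2 s"
| "bval (Equal e1 e2) s \<longleftrightarrow> aval e1 s = aval e2 s"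
| "bval (Negate b) s \<longleftrightarrow> \<not> bval b s"
| "bval (Both b1 b2) s \<longleftrightarrow> bval b1 s \<and> bval b2 s"

fun asafe :: "int \<Rightarrow> aexp \<Rightarrow> state \<Rightarrow> bool" where
  "asafe W (Const k) s \<longleftrightarrow> \<bar>k\<bar> \<le> W"
| "asafe W (Var x) s \<longleftrightarrow> \<bar>var s x\<bar> \<le> W"
| "asafe W (Elem A i) s \<longleftrightarrow>
     asafe W i s \<and> aval i s \<ge> 0 \<and> \<bar>aval (Elem A i) s\<bar> \<le> W"
| "asafe W (Bin f e1 e2) s \<longleftrightarrow>
     asafe W e1 s \<and> asafe W e2 s \<and> (f \<in> {DivOp, ModOp} \<longrightarrow> aval e2 s \<noteq> 0) \<and>
     \<bar>aval (Bin f e1 e2) s\<bar> \<le> W"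

fun bsafe :: "int \<Rightarrow> bexp \<Rightarrow> state \<Rightarrow> bool" where
  "bsafe W (Less e1 e2) s \<longleftrightarrow> asafe W e1 s \<and> asafe W e2 s"
| "bsafe W (Equal e1 e2) s \<longleftrightarrow> asafe W e1 s \<and> asafe W e2 s"
| "bsafe W (Negate b) s \<longleftrightarrow> bsafe W b s"
| "bsafe W (Both b1 b2) s \<longleftrightarrow> bsafe W b1 s \<and> bsafe W b2 s"

fun acost :: "aexp \<Rightarrow> nat" where
  "acost (Const k) = 1"
| "acost (Var x) = 1"
| "acost (Elem A i) = 1 + acost i"
| "acost (Bin f e1 e2) = 1 + acost e1 + acost e2"

fun bcost :: "bexp \<Rightarrow> nat" where
  "bcost (Less e1 e2) = 1 + acost e1 + acost e2"
| "bcost (Equal e1 e2) = 1 + acost e1 + acost e2"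
| "bcost (Negate b) = 1 + bcost b"
| "bcost (Both b1 b2) = 1 + bcost b1 + bcost b2"

text \<open>
  \<open>exec W c s t s'\<close>: with word bound \<open>W\<close>, the program \<open>c\<close> started in state \<open>s\<close> terminates
  after exactly \<open>t\<close> steps in state \<open>s'\<close>.
\<close>

inductive exec :: "int \<Rightarrow> com \<Rightarrow> state \<Rightarrow> nat \<Rightarrow> state \<Rightarrow> bool" for W :: int where
  Skip: "exec W Skip s 1 s"
| Assign: "asafe W e s \<Longrightarrow>
    exec W (Assign x e) s (1 + acost e) (s\<lparr>var := (var s)(x := aval e s)\<rparr>)"
| Store: "asafe W i s \<Longrightarrow> aval i s \<ge> 0 \<Longrightarrow> asafe W e s \<Longrightarrow>
    exec W (Store A i e) s (1 + acost i + acost e)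
      (s\<lparr>arr := (arr s)(A := (arr s A)(nat (aval i s) := aval e s))\<rparr>)"
| Seq: "exec W c1 s t1 s1 \<Longrightarrow> exec W c2 s1 t2 s2 \<Longrightarrow> exec W (Seq c1 c2) s (t1 + t2) s2"
| CondTrue: "bsafe W b s \<Longrightarrow> bval b s \<Longrightarrow> exec W c1 s t s' \<Longrightarrow>
    exec W (Cond b c1 c2) s (1 + bcost b + t) s'"
| CondFalse: "bsafe W b s \<Longrightarrow> \<not> bval b s \<Longrightarrow> exec W c2 s t s' \<Longrightarrow>
    exec W (Cond b c1 c2) s (1 + bcost b + t) s'"
| WhileFalse: "bsafe W b s \<Longrightarrow> \<not> bval b s \<Longrightarrow> exec W (While b c) s (1 + bcost b) s"
| WhileTrue: "bsafe W b s \<Longrightarrow> bval b s \<Longrightarrow> exec W c s t1 s1 \<Longrightarrow>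
    exec W (While b c) s1 t2 s2 \<Longrightarrow> exec W (While b c) s (1 + bcost b + t1 + t2) s2"

lemma exec_deterministic:
  "exec W c s t s' \<Longrightarrow> exec W c s u s'' \<Longrightarrow> t = u \<and> s' = s''"
proof (induction arbitrary: u s'' rule: exec.induct)
  case Skip
  from Skip.prems show ?case by cases simp
next
  case Assign
  from Assign.prems show ?case by cases simp
next
  case Store
  from Store.prems show ?case by cases simp
next
  case Seq
  from Seq.prems show ?case
    by cases (use Seq.IH in blast)+
next
  case CondTrue
  from CondTrue.prems show ?case
    by cases (use CondTrue.IH CondTrue.hyps in blast)+
next
  case CondFalse
  from CondFalse.prems show ?case
    by cases (use CondFalse.IH CondFalse.hyps in blast)+
next
  case WhileFalse
  from WhileFalse.prems show ?case
    by cases (use WhileFalse.hyps in blast)+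
next
  case WhileTrue
  from WhileTrue.prems show ?case
    by cases (use WhileTrue.IH WhileTrue.hyps in blast)+
qed


section \<open>Convolutions and roots of unity\<close>

definition conv_coeff :: "nat \<Rightarrow> (nat \<Rightarrow> int) \<Rightarrow> (nat \<Rightarrow> int) \<Rightarrow> nat \<Rightarrow> int" where
  "conv_coeff n a b s = (\<Sum>(i, j) \<in> {(i, j). i < n \<and> j < n \<and> i + j = s}. a i * b j)"

definition is_acyclic_conv_mod ::
    "nat \<Rightarrow> nat \<Rightarrow> (nat \<Rightarrow> int) \<Rightarrow> (nat \<Rightarrow> int) \<Rightarrow> (nat \<Rightarrow> int) \<Rightarrow> bool" where
  "is_acyclic_conv_mod p n a b c \<longleftrightarrow>
     (\<forall>s \<le> 2 * n - 2. [c s = conv_coeff n a b s] (mod int p))"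

definition suitable_root :: "nat \<Rightarrow> nat \<Rightarrow> nat \<Rightarrow> bool" where
  "suitable_root N p q \<longleftrightarrow> prime p \<and> q < p \<and> (\<exists>k. ord p q = 2 ^ k \<and> 2 ^ k \<ge> 2 * N)"

definition init_state :: "nat \<Rightarrow> state" where
  "init_state N = \<lparr>var = (\<lambda>_. 0)(''N'' := int N), arr = (\<lambda>_ _. 0)\<rparr>"

text \<open>
  Writing the input of a convolution into a state: all other variables and arrays, in
  particular those holding precomputed data, are kept.
\<close>

definition load_input :: "nat \<Rightarrow> (nat \<Rightarrow> int) \<Rightarrow> (nat \<Rightarrow> int) \<Rightarrow> state \<Rightarrow> state" where
  "load_input n a b s =
     s\<lparr>var := (var s)(''n'' := int n),
       arr := (arr s)(''a'' := (\<lambda>i. if i < n then a i else arr s ''a'' i),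
                      ''b'' := (\<lambda>i. if i < n then b i else arr s ''b'' i))\<rparr>"

end

theory Submission
  imports Defs "HOL-Real_Asymp.Real_Asymp"
begin

text \<open>
  The modulus is the least prime \<open>p = k * M + 1\<close>, where \<open>M = 2 ^ m\<close> is the least power of two
  that is at least \<open>2 * N\<close>. The theorem of Bach and Sorenson for the residue class of 1 gives
  \<open>p < 2 * (M * ln M)\<^sup>2 < (M * m)\<^sup>2\<close>, because \<open>2 * (ln 2)\<^sup>2 < 1\<close>. Hence \<open>k < K = M * m\<^sup>2\<close>, and the
  candidates are decided by sieving with the odd primes \<open>l < L = M * m\<close>: such an \<open>l\<close> removes the
  residue class of \<open>- 1 / M\<close> modulo \<open>l\<close>, which is found by halving 1 modulo \<open>l\<close> \<open>m\<close> times. This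
  takes time \<open>(L + K) * (\<Sum>l. 1 / l) + L * m\<close>, and the sum over the primes is \<open>O(ln (ln L))\<close>
  since the product of the primes between \<open>2 ^ k\<close> and \<open>2 ^ (k + 1)\<close> divides a central binomial
  coefficient. If \<open>a\<close> is the least quadratic nonresidue, then \<open>a ^ ((p - 1) / 2) = - 1\<close>, so
  \<open>q = a ^ k\<close> has order exactly \<open>M\<close>; by Ankeny's bound, trying all smaller residues is cheap.

  The stored powers \<open>q ^ (2 ^ i)\<close> include a root of unity of every order \<open>2 ^ j\<close> with \<open>j \<le> m\<close>.
  A convolution of length \<open>n\<close> therefore needs only transforms of size less than \<open>4 * n\<close>, independently
  of \<open>N\<close>. The inverse transform is the transform itself, up to a reversal of the indices and
  a division by the size.
\<close>

section \<open>A program logic with time bounds\<close>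

text \<open>The time budget is, up to a constant, the number \<open>K\<close> of candidates times
  the sum of the reciprocals of the sieving primes, and this shapes the precomputation. Sieving with
  every \<open>l\<close> instead of the primes only would replace \<open>ln (ln N)\<close> by
  \<open>ln N\<close>. So a second sieve, interleaved with that of the candidates, has to tell in
  time which \<open>l\<close> are prime. The two number-theoretic bounds enter differently. That of
  Bach and Sorenson is needed for correctness: it guarantees a prime among the sieved candidates,
  and beyond them an unmarked entry would mean nothing. Ankeny's bound affects the running time
  only, and its constant never enters the program. All word bounds reduce to
  \<open>B = K * M\<close>: the modulus is below \<open>B\<close>, a product of two residues below
  \<open>B * B\<close>, and \<open>B\<close> is at most \<open>N ^ 12\<close>. Times are explicit
  natural numbers in terms of the exponents of two; Landau symbols appear only when these numbers
  are finally estimated.\<close>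

definition runs :: "int \<Rightarrow> com \<Rightarrow> state \<Rightarrow> nat \<Rightarrow> (state \<Rightarrow> bool) \<Rightarrow> bool" where
  "runs W c s t Q \<longleftrightarrow> (\<exists>t' s'. exec W c s t' s' \<and> t' \<le> t \<and> Q s')"

lemma runs_weaken:
  assumes "runs W c s t Q" "t \<le> u" "\<And>s'. Q s' \<Longrightarrow> R s'"
  shows "runs W c s u R"
  using assms unfolding runs_def by (meson order_trans)

lemma runs_Assign:
  assumes "asafe W e s" "1 + acost e \<le> t" "Q (s\<lparr>var := (var s)(x := aval e s)\<rparr>)"
  shows "runs W (Assign x e) s t Q"
  using assms exec.Assign unfolding runs_def by blast

lemma runs_Store:
  assumes "asafe W i s" "aval i s \<ge> 0" "asafe W e s" "1 + acost i + acost e \<le> t"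
    "Q (s\<lparr>arr := (arr s)(A := (arr s A)(nat (aval i s) := aval e s))\<rparr>)"
  shows "runs W (Store A i e) s t Q"
  using assms exec.Store unfolding runs_def by blast

lemma runs_Seq:
  assumes "runs W c1 s u (\<lambda>s1. runs W c2 s1 v Q)" "u + v \<le> t"
  shows "runs W (Seq c1 c2) s t Q"
proof -
  obtain u1 s1 u2 s2 where "exec W c1 s u1 s1" "u1 \<le> u" "exec W c2 s1 u2 s2" "u2 \<le> v" "Q s2"
    using assms(1) unfolding runs_def by blast
  moreover from this have "exec W (Seq c1 c2) s (u1 + u2) s2"
    by (intro exec.Seq)
  moreover have "u1 + u2 \<le> t"
    using calculation assms(2) by linarith
  ultimately show ?thesis
    unfolding runs_def by blast
qed

lemma runs_Assign_Seq:
  assumes "asafe W e s" "runs W c (s\<lparr>var := (var s)(x := aval e s)\<rparr>) u Q" "1 + acost e + u \<le> t"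
  shows "runs W (Seq (Assign x e) c) s t Q"
  by (rule runs_Seq[where u = "1 + acost e" and v = u])
    (use assms in \<open>auto intro: runs_Assign\<close>)

lemma runs_Store_Seq:
  assumes "asafe W i s" "aval i s \<ge> 0" "asafe W e s"
    "runs W c (s\<lparr>arr := (arr s)(A := (arr s A)(nat (aval i s) := aval e s))\<rparr>) u Q"
    "1 + acost i + acost e + u \<le> t"
  shows "runs W (Seq (Store A i e) c) s t Q"
  by (rule runs_Seq[where u = "1 + acost i + acost e" and v = u])
    (use assms in \<open>auto intro: runs_Store\<close>)

lemma runs_Cond:
  assumes "bsafe W b s" "bval b s \<Longrightarrow> runs W c1 s t1 Q" "\<not> bval b s \<Longrightarrow> runs W c2 s t2 Q"
    "1 + bcost b + (if bval b s then t1 else t2) \<le> t"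
  shows "runs W (Cond b c1 c2) s t Q"
proof (cases "bval b s")
  case True
  obtain u s' where "exec W c1 s u s'" "u \<le> t1" "Q s'"
    using assms(2)[OF True] unfolding runs_def by blast
  moreover from this have "exec W (Cond b c1 c2) s (1 + bcost b + u) s'"
    using assms(1) True by (intro exec.CondTrue)
  moreover have "1 + bcost b + u \<le> t"
    using calculation assms(4) True by simp
  ultimately show ?thesis
    unfolding runs_def by blast
next
  case False
  obtain u s' where "exec W c2 s u s'" "u \<le> t2" "Q s'"
    using assms(3)[OF False] unfolding runs_def by blast
  moreover from this have "exec W (Cond b c1 c2) s (1 + bcost b + u) s'"
    using assms(1) False by (intro exec.CondFalse)
  moreover have "1 + bcost b + u \<le> t"
    using calculation assms(4) False by simp
  ultimately show ?thesis
    unfolding runs_def by blast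
qed

lemma runs_Skip: "1 \<le> t \<Longrightarrow> Q s \<Longrightarrow> runs W Skip s t Q"
  using exec.Skip unfolding runs_def by blast

text \<open>The invariant is indexed by the time credit left for the remaining iterations.\<close>

lemma runs_While:
  fixes I :: "nat \<Rightarrow> state \<Rightarrow> bool"
  assumes I: "I u s"
    and safe: "\<And>u s. I u s \<Longrightarrow> bsafe W b s"
    and step: "\<And>u s. I u s \<Longrightarrow> bval b s \<Longrightarrow>
      \<exists>v. runs W c s v (\<lambda>s'. \<exists>u'. I u' s' \<and> u' + v + 1 + bcost b \<le> u)"
    and exit: "\<And>u s. I u s \<Longrightarrow> \<not> bval b s \<Longrightarrow> Q s"
    and t: "u + 1 + bcost b \<le> t"
  shows "runs W (While b c) s t Q"
  using I t
\<comment> \<open>The credit is also the termination measure: every iteration pays at least for its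
  test, so the credit strictly decreases.\<close>
proof (induction u arbitrary: s t rule: less_induct)
  case (less u)
  show ?case
  proof (cases "bval b s")
    case False
    have "exec W (While b c) s (1 + bcost b) s"
      using safe[OF less.prems(1)] False by (rule exec.WhileFalse)
    with exit[OF less.prems(1) False] less.prems(2) show ?thesis
      unfolding runs_def by fastforce
  next
    case True
    obtain v where "runs W c s v (\<lambda>s'. \<exists>u'. I u' s' \<and> u' + v + 1 + bcost b \<le> u)"
      using step[OF less.prems(1) True] by blast
    then obtain t1 s1 u' where e1: "exec W c s t1 s1" and t1: "t1 \<le> v" and I1: "I u' s1"
      and le: "u' + v + 1 + bcost b \<le> u"
      unfolding runs_def by blast
    have "runs W (While b c) s1 (u' + 1 + bcost b) Q"
      by (rule less.IH) (use le I1 in auto)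
    then obtain t2 s2 where e2: "exec W (While b c) s1 t2 s2"
      and t2: "t2 \<le> u' + 1 + bcost b" and Q: "Q s2"
      unfolding runs_def by blast
    have "exec W (While b c) s (1 + bcost b + t1 + t2) s2"
      using safe[OF less.prems(1)] True e1 e2 by (rule exec.WhileTrue)
    moreover have "1 + bcost b + t1 + t2 \<le> t"
      using t1 t2 le less.prems(2) by linarith
    ultimately show ?thesis
      unfolding runs_def using Q by blast
  qed
qed

section \<open>Frame conditions from the syntax of programs\<close>

fun wvars :: "com \<Rightarrow> string set" where
  "wvars Skip = {}"
| "wvars (Assign x e) = {x}"
| "wvars (Store A i e) = {}"
| "wvars (Seq c1 c2) = wvars c1 \<union> wvars c2"
| "wvars (Cond b c1 c2) = wvars c1 \<union> wvars c2"
| "wvars (While b c) = wvars c"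

fun warrs :: "com \<Rightarrow> string set" where
  "warrs Skip = {}"
| "warrs (Assign x e) = {}"
| "warrs (Store A i e) = {A}"
| "warrs (Seq c1 c2) = warrs c1 \<union> warrs c2"
| "warrs (Cond b c1 c2) = warrs c1 \<union> warrs c2"
| "warrs (While b c) = warrs c"

definition unchanged :: "com \<Rightarrow> state \<Rightarrow> state \<Rightarrow> bool" where
  "unchanged c s s' \<longleftrightarrow>
     (\<forall>x. x \<notin> wvars c \<longrightarrow> var s' x = var s x) \<and> (\<forall>A. A \<notin> warrs c \<longrightarrow> arr s' A = arr s A)"

lemma unchanged_var: "unchanged c s s' \<Longrightarrow> x \<notin> wvars c \<Longrightarrow> var s' x = var s x"
  and unchanged_arr: "unchanged c s s' \<Longrightarrow> A \<notin> warrs c \<Longrightarrow> arr s' A = arr s A"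
  by (auto simp: unchanged_def)

lemma exec_unchanged: "exec W c s t s' \<Longrightarrow> unchanged c s s'"
  unfolding unchanged_def by (induction rule: exec.induct) auto

text \<open>Specifications can be restricted to what a component computes; that everything else
  survives is read off from the variables and arrays it may write.\<close>

lemma runs_frame:
  assumes "runs W c s t Q" "\<And>s'. Q s' \<Longrightarrow> unchanged c s s' \<Longrightarrow> R s'"
  shows "runs W c s t R"
  using assms exec_unchanged unfolding runs_def by blast

abbreviation add_exp (infixl "+\<^sub>e" 65) where "a +\<^sub>e b \<equiv> Bin AddOp a b"
abbreviation sub_exp (infixl "-\<^sub>e" 65) where "a -\<^sub>e b \<equiv> Bin SubOp a b"
abbreviation mul_exp (infixl "*\<^sub>e" 70) where "a *\<^sub>e b \<equiv> Bin MulOp a b"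
abbreviation div_exp (infixl "div\<^sub>e" 70) where "a div\<^sub>e b \<equiv> Bin DivOp a b"
abbreviation mod_exp (infixl "mod\<^sub>e" 70) where "a mod\<^sub>e b \<equiv> Bin ModOp a b"
abbreviation seq_com (infixr ";;" 60) where "c1 ;; c2 \<equiv> Seq c1 c2"

section \<open>Filling an array in a counting loop\<close>

definition fill :: "string \<Rightarrow> aexp \<Rightarrow> string \<Rightarrow> aexp \<Rightarrow> com" where
  "fill A lo hi e =
     Assign ''i'' lo ;;
     While (Less (Var ''i'') (Var hi)) (Store A (Var ''i'') e ;; Assign ''i'' (Var ''i'' +\<^sub>e Const 1))"

lemma wvars_fill [simp]: "wvars (fill A lo hi e) = {''i''}"
  and warrs_fill [simp]: "warrs (fill A lo hi e) = {A}"
  by (auto simp: fill_def)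

text \<open>The state in which entry \<open>j\<close> is about to be computed. The entries before
  \<open>j\<close> are already the new ones, so expressions that refer back to them, such as the
  recurrence for a table of powers, are covered.\<close>

definition fill_state :: "state \<Rightarrow> string \<Rightarrow> nat \<Rightarrow> (nat \<Rightarrow> int) \<Rightarrow> nat \<Rightarrow> state" where
  "fill_state s A l g j =
     s\<lparr>var := (var s)(''i'' := int j),
       arr := (arr s)(A := (\<lambda>k. if l \<le> k \<and> k < j then g k else arr s A k))\<rparr>"

lemma fill_state_simps [simp]:
  "var (fill_state s A l g j) x = (if x = ''i'' then int j else var s x)"
  "arr (fill_state s A l g j) A k = (if l \<le> k \<and> k < j then g k else arr s A k)"
  "B \<noteq> A \<Longrightarrow> arr (fill_state s A l g j) B = arr s B"
  by (auto simp: fill_state_def)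

lemma runs_fill:
  assumes lo: "asafe W lo s" "aval lo s = int l"
    and hi: "var s hi = int h" "hi \<noteq> ''i''" "int h < W" and "l \<le> h"
    and e: "\<And>j. l \<le> j \<Longrightarrow> j < h \<Longrightarrow>
      asafe W e (fill_state s A l g j) \<and> aval e (fill_state s A l g j) = g j"
    and Q: "Q (fill_state s A l g h)"
    and t: "(h - l + 1) * (acost lo + acost e + 20) \<le> t"
  shows "runs W (fill A lo hi e) s t Q"
proof -
  let ?I = "\<lambda>u s'. \<exists>j. l \<le> j \<and> j \<le> h \<and> s' = fill_state s A l g j \<and> u = (h - j) * (acost e + 10)"
  let ?b = "Less (Var ''i'') (Var hi)"
  let ?c = "Store A (Var ''i'') e ;; Assign ''i'' (Var ''i'' +\<^sub>e Const 1)"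
  have W: "1 \<le> W" using hi(3) by linarith
  have start: "s\<lparr>var := (var s)(''i'' := aval lo s)\<rparr> = fill_state s A l g l"
    using lo(2) by (auto simp: fill_state_def fun_eq_iff intro!: state.equality)
  have loop: "runs W (While ?b ?c) (fill_state s A l g l) ((h - l + 1) * (acost e + 10)) Q"
  proof (rule runs_While[where I = ?I])
    show "?I ((h - l) * (acost e + 10)) (fill_state s A l g l)" using \<open>l \<le> h\<close> by auto
  next
    fix u s' assume "?I u s'"
    thus "bsafe W ?b s'" using hi by auto
  next
    fix u s' assume I: "?I u s'" and "bval ?b s'"
    then obtain j where j: "l \<le> j" "j < h" "s' = fill_state s A l g j" "u = (h - j) * (acost e + 10)"
      using hi by auto
    let ?s1 = "s'\<lparr>arr := (arr s')(A := (arr s' A)(nat (aval (Var ''i'') s') := aval e s'))\<rparr>"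
    have next_state: "?s1\<lparr>var := (var ?s1)(''i'' := aval (Var ''i'' +\<^sub>e Const 1) ?s1)\<rparr> =
        fill_state s A l g (Suc j)"
      using e[OF j(1,2)] j by (auto simp: fill_state_def fun_eq_iff intro!: state.equality)
    have "h - j = Suc (h - Suc j)" using j by simp
    hence u: "(h - Suc j) * (acost e + 10) + (acost e + 6) + 1 + bcost ?b \<le> u"
      unfolding j by simp
    have "runs W ?c s' (acost e + 6) (\<lambda>s''. \<exists>u'. ?I u' s'' \<and> u' + (acost e + 6) + 1 + bcost ?b \<le> u)"
    proof (intro runs_Store_Seq[where u = 4] runs_Assign, goal_cases)
      case 6
      have "?I ((h - Suc j) * (acost e + 10)) (fill_state s A l g (Suc j))"
        using j by (intro exI[of _ "Suc j"]) auto
      thus ?case unfolding next_state using u by blast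
    qed (use j e[OF j(1,2)] hi W in \<open>auto simp: j(3)\<close>)
    thus "\<exists>v. runs W ?c s' v (\<lambda>s''. \<exists>u'. ?I u' s'' \<and> u' + v + 1 + bcost ?b \<le> u)"
      by blast
  next
    fix u s' assume "?I u s'" "\<not> bval ?b s'"
    then obtain j where j: "l \<le> j" "j \<le> h" "s' = fill_state s A l g j" "\<not> j < h"
      using hi by auto
    thus "Q s'" using Q by (simp add: order_antisym_conv)
  qed (auto simp: algebra_simps)
  show ?thesis
    unfolding fill_def
    apply (rule runs_Assign_Seq[OF lo(1)])
     apply (subst start)
     apply (rule loop)
    apply (rule order_trans[OF _ t])
    apply (simp add: algebra_simps)
    done
qed

section \<open>The discrete Fourier transform modulo a prime\<close>

definition root_mod :: "int \<Rightarrow> nat \<Rightarrow> int \<Rightarrow> bool" where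
  "root_mod P M z \<longleftrightarrow> [z ^ M = 1] (mod P) \<and> (\<forall>d. 0 < d \<and> d < M \<longrightarrow> \<not> [z ^ d = 1] (mod P))"

lemma cong_power_mod_exponent:
  fixes z :: int
  assumes "[z ^ M = 1] (mod P)"
  shows "[z ^ k = z ^ (k mod M)] (mod P)"
proof -
  have "z ^ k = (z ^ M) ^ (k div M) * z ^ (k mod M)"
    by (simp flip: power_mult power_add)
  moreover have "[(z ^ M) ^ (k div M) * z ^ (k mod M) = 1 ^ (k div M) * z ^ (k mod M)] (mod P)"
    by (intro cong_mult cong_pow assms cong_refl)
  ultimately show ?thesis by simp
qed

text \<open>Orthogonality of the powers of a primitive root of unity. If \<open>M\<close> does not
  divide \<open>k\<close>, the sum is geometric with ratio different from 1, and multiplied by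
  \<open>z ^ k - 1\<close> it vanishes modulo \<open>P\<close>; the primality of \<open>P\<close>
  allows this factor to be cancelled.\<close>

lemma root_mod_sum:
  fixes P z :: int
  assumes P: "prime P" and root: "root_mod P M z" and "M > 0"
  shows "[(\<Sum>t<M. z ^ (k * t)) = (if M dvd k then int M else 0)] (mod P)"
proof (cases "M dvd k")
  case True
  have "[(\<Sum>t<M. z ^ (k * t)) = (\<Sum>t<M. 1)] (mod P)"
  proof (rule cong_sum)
    fix t
    have "(k * t) mod M = 0" using True by auto
    thus "[z ^ (k * t) = 1] (mod P)"
      using cong_power_mod_exponent[of z M P "k * t"] root by (simp add: root_mod_def)
  qed
  thus ?thesis using True by simp
next
  case False
  have "\<not> [z ^ (k mod M) = 1] (mod P)"
    using root False \<open>M > 0\<close> by (simp add: root_mod_def mod_greater_zero_iff_not_dvd)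
  hence "\<not> [z ^ k = 1] (mod P)"
    using cong_power_mod_exponent[of z M P k] root cong_trans cong_sym
    unfolding root_mod_def by blast
  hence nd: "\<not> P dvd z ^ k - 1" by (simp add: cong_iff_dvd_diff)
  have "(z ^ k) ^ M = (z ^ M) ^ k"
    by (simp add: mult.commute flip: power_mult)
  hence "(z ^ k - 1) * (\<Sum>t<M. z ^ (k * t)) = (z ^ M) ^ k - 1"
    using power_diff_1_eq[of "z ^ k" M] by (simp add: power_mult)
  moreover have "[(z ^ M) ^ k = 1 ^ k] (mod P)"
    using root by (intro cong_pow) (simp add: root_mod_def)
  ultimately have "P dvd (z ^ k - 1) * (\<Sum>t<M. z ^ (k * t))"
    by (simp add: cong_iff_dvd_diff)
  hence "P dvd (\<Sum>t<M. z ^ (k * t))"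
    using nd P by (simp add: prime_dvd_mult_iff)
  thus ?thesis using False by (simp add: cong_iff_dvd_diff)
qed

text \<open>
  Position \<open>u\<close> of the intermediate array of stride \<open>s\<close> holds the polynomial with the
  coefficients \<open>a\<^bsub>r\<^esub>, a\<^bsub>r+s\<^esub>, a\<^bsub>r+2s\<^esub>, \<dots>\<close> for \<open>r = u mod s\<close>, evaluated at \<open>z\<^bsup>u-r\<^esup>\<close>.
\<close>

definition strided_dft :: "int \<Rightarrow> nat \<Rightarrow> (nat \<Rightarrow> int) \<Rightarrow> nat \<Rightarrow> nat \<Rightarrow> int" where
  "strided_dft z M a s u = (\<Sum>i<M div s. a (u mod s + s * i) * z ^ ((u - u mod s) * i))"

lemma strided_dft_self: "0 < M \<Longrightarrow> u < M \<Longrightarrow> strided_dft z M a M u = a u"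
  by (simp add: strided_dft_def)

lemma sum_even_odd: "(\<Sum>i<2 * (k::nat). f i) = (\<Sum>i<k. f (2 * i)) + (\<Sum>i<k. f (2 * i + 1) :: int)"
  by (induction k) auto

text \<open>The Cooley-Tukey step. The even and odd coefficients of the progression \<open>r\<close>
  modulo \<open>s\<close> form the progressions \<open>r\<close> and \<open>r + s\<close> modulo
  \<open>2 * s\<close>, both evaluated at the square of \<open>z ^ e\<close>. Since
  \<open>2 * s\<close> divides \<open>2 * e mod M\<close>, the positions \<open>v\<close> and
  \<open>v + s\<close> belong to these two classes, and \<open>z ^ M = 1\<close> permits reducing
  the exponent modulo \<open>M\<close>. With this indexing the final result is in natural order,
  without bit reversal.\<close>

lemma strided_dft_halve:
  assumes M: "M = s * 2 * k" and "0 < s" "0 < k" and z: "[z ^ M = 1] (mod P)"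
    and r: "r = u mod s" and e: "e = u - r" and v: "v = r + (2 * e) mod M"
  shows "[strided_dft z M a s u =
    strided_dft z M a (2 * s) v + z ^ e * strided_dft z M a (2 * s) (v + s)] (mod P)"
proof -
  let ?f = "(2 * e) mod M"
  have "r < s" using \<open>0 < s\<close> r by simp
  have "s dvd e" unfolding e r by (rule dvd_minus_mod)
  hence "2 * s dvd 2 * e" by simp
  moreover have "2 * s dvd M" unfolding M by simp
  ultimately have dvd: "2 * s dvd ?f" by (simp add: dvd_mod_iff)
  have m1: "v mod (2 * s) = r" "(v + s) mod (2 * s) = r + s"
  proof -
    obtain f where f: "?f = 2 * s * f" using dvd by blast
    have "v mod (2 * s) = r mod (2 * s)" unfolding v f by simp
    thus "v mod (2 * s) = r" using \<open>r < s\<close> by simp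
    have "v + s = (r + s) + 2 * s * f" unfolding v f by simp
    hence "(v + s) mod (2 * s) = (r + s) mod (2 * s)" by (simp only: mod_mult_self2)
    thus "(v + s) mod (2 * s) = r + s" using \<open>r < s\<close> by simp
  qed
  have m2: "v - r = ?f" "v + s - (r + s) = ?f" unfolding v by auto
  have d: "M div s = 2 * k" "M div (2 * s) = k"
    using \<open>0 < s\<close> unfolding M by (simp_all add: mult.assoc mult.commute[of s 2])
  have zf: "[z ^ (?f * i) = z ^ (2 * e * i)] (mod P)" for i
  proof -
    have "[(z ^ ?f) ^ i = (z ^ (2 * e)) ^ i] (mod P)"
      by (intro cong_pow cong_sym[OF cong_power_mod_exponent[OF z]])
    thus ?thesis by (simp add: power_mult)
  qed
  have "strided_dft z M a s u = (\<Sum>i<2 * k. a (r + s * i) * z ^ (e * i))"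
    unfolding strided_dft_def d e r ..
  also have "\<dots> = (\<Sum>i<k. a (r + 2 * s * i) * z ^ (2 * e * i)) +
      z ^ e * (\<Sum>i<k. a (r + s + 2 * s * i) * z ^ (2 * e * i))"
    unfolding sum_even_odd sum_distrib_left
    by (intro arg_cong2[of _ _ _ _ "(+)"] sum.cong refl)
       (simp_all add: algebra_simps power_add)
  finally have 1: "strided_dft z M a s u = (\<Sum>i<k. a (r + 2 * s * i) * z ^ (2 * e * i)) +
      z ^ e * (\<Sum>i<k. a (r + s + 2 * s * i) * z ^ (2 * e * i))" .
  have 2: "strided_dft z M a (2 * s) v = (\<Sum>i<k. a (r + 2 * s * i) * z ^ (?f * i))"
    "strided_dft z M a (2 * s) (v + s) = (\<Sum>i<k. a (r + s + 2 * s * i) * z ^ (?f * i))"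
    by (simp_all only: strided_dft_def m1 m2 d)
  show ?thesis
    unfolding 1 2 by (intro cong_add cong_mult cong_sum cong_refl cong_sym[OF zf])
qed

definition dft :: "int \<Rightarrow> nat \<Rightarrow> (nat \<Rightarrow> int) \<Rightarrow> nat \<Rightarrow> int" where
  "dft z M a u = (\<Sum>i<M. a i * z ^ (u * i))"

lemma strided_dft_1: "strided_dft z M a 1 u = dft z M a u"
  by (simp add: strided_dft_def dft_def)

lemma dft_cong:
  assumes "\<And>i. i < M \<Longrightarrow> [a i = b i] (mod P)"
  shows "[dft z M a u = dft z M b u] (mod P)"
  unfolding dft_def by (intro cong_sum cong_mult cong_refl assms) auto

text \<open>The condition \<open>2 * n \<le> M\<close> keeps every index sum below \<open>M\<close>,
  so nothing wraps around: grouping the pairs by their sum loses none of them.\<close>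

lemma dft_mult:
  assumes a: "\<And>i. n \<le> i \<Longrightarrow> a i = 0" and b: "\<And>i. n \<le> i \<Longrightarrow> b i = 0" and n: "0 < n" "2 * n \<le> M"
  shows "dft z M a u * dft z M b u = dft z M (conv_coeff n a b) u"
proof -
  let ?S = "{..<n} \<times> {..<n}"
  have short: "dft z M c u = (\<Sum>i<n. c i * z ^ (u * i))" if "\<And>i. n \<le> i \<Longrightarrow> c i = 0" for c
    unfolding dft_def by (rule sum.mono_neutral_right) (use that n in auto)
  have "dft z M (conv_coeff n a b) u =
      (\<Sum>s<M. \<Sum>ij | ij \<in> ?S \<and> fst ij + snd ij = s. a (fst ij) * b (snd ij) * z ^ (u * (fst ij + snd ij)))"
    unfolding dft_def conv_coeff_def sum_distrib_right
    by (intro sum.cong refl) (auto simp: case_prod_beta)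
  also have "\<dots> = (\<Sum>ij \<in> ?S. a (fst ij) * b (snd ij) * z ^ (u * (fst ij + snd ij)))"
    by (rule sum.group) (use n in auto)
  also have "\<dots> = (\<Sum>i<n. \<Sum>j<n. a i * b j * z ^ (u * (i + j)))"
    by (simp add: sum.cartesian_product case_prod_beta)
  also have "\<dots> = (\<Sum>i<n. a i * z ^ (u * i)) * (\<Sum>j<n. b j * z ^ (u * j))"
    unfolding sum_product by (intro sum.cong refl) (simp add: algebra_simps power_add)
  also have "\<dots> = dft z M a u * dft z M b u"
    using short[OF a] short[OF b] by simp
  finally show ?thesis ..
qed

text \<open>After exchanging the sums, the coefficient of \<open>c k\<close> is a sum of powers of
  \<open>z\<close> with exponents \<open>(k + (M - s) mod M) * i\<close>, and orthogonality leaves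
  only \<open>k = s\<close>. The outer \<open>mod M\<close> keeps the index in range when
  \<open>s = 0\<close>.\<close>

lemma dft_inverse:
  assumes P: "prime P" and root: "root_mod P M z" and "s < M"
  shows "[dft z M (dft z M c) ((M - s) mod M) = int M * c s] (mod P)"
proof -
  let ?t = "(M - s) mod M"
  have "dft z M (dft z M c) ?t = (\<Sum>i<M. \<Sum>k<M. c k * z ^ (i * k) * z ^ (?t * i))"
    unfolding dft_def sum_distrib_right ..
  also have "\<dots> = (\<Sum>k<M. \<Sum>i<M. c k * z ^ (i * k) * z ^ (?t * i))"
    by (rule sum.swap)
  also have "\<dots> = (\<Sum>k<M. c k * (\<Sum>i<M. z ^ ((k + ?t) * i)))"
    unfolding sum_distrib_left by (intro sum.cong refl) (simp add: algebra_simps power_add)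
  also have "[\<dots> = (\<Sum>k<M. c k * (if M dvd k + ?t then int M else 0))] (mod P)"
    using \<open>s < M\<close> by (intro cong_sum cong_mult cong_refl root_mod_sum P root) auto
  also have "(\<Sum>k<M. c k * (if M dvd k + ?t then int M else 0)) = (\<Sum>k<M. if k = s then c k * int M else 0)"
  proof (intro sum.cong refl)
    fix k assume k: "k \<in> {..<M}"
    have "M dvd k + ?t \<longleftrightarrow> M dvd k + (M - s)"
      by (simp add: dvd_eq_mod_eq_0 mod_simps)
    also have "\<dots> \<longleftrightarrow> k = s"
    proof
      assume "M dvd k + (M - s)"
      then obtain c where c: "k + (M - s) = M * c" by blast
      \<comment> \<open>A multiple of \<open>M\<close> strictly between 0 and \<open>2 * M\<close>
        can only be \<open>M\<close> itself.\<close>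
      have "0 < M * c" "M * c < M * 2" unfolding c[symmetric] using k \<open>s < M\<close> by auto
      hence "c = 1" by (simp del: mult_less_cancel1 add: mult_less_cancel1[of M c 2])
      thus "k = s" using c \<open>s < M\<close> by simp
    qed (use \<open>s < M\<close> in simp)
    finally show "c k * (if M dvd k + ?t then int M else 0) = (if k = s then c k * int M else 0)"
      by simp
  qed
  also have "\<dots> = int M * c s" using \<open>s < M\<close> by simp
  finally show ?thesis .
qed

text \<open>The arrays are described by congruences only, because the program may reduce modulo
  \<open>P\<close> after each phase. \<open>A\<close> and \<open>B\<close> are the padded inputs,
  \<open>C\<close> the pointwise product of their transforms, \<open>D\<close> its transform, and
  \<open>y\<close> divides by the length.\<close>

lemma convolution_theorem:
  assumes P: "prime P" and root: "root_mod P M z" and n: "0 < n" "2 * n \<le> M"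
    and A: "\<And>i. i < M \<Longrightarrow> [A i = (if i < n then a i else 0)] (mod P)"
    and B: "\<And>i. i < M \<Longrightarrow> [B i = (if i < n then b i else 0)] (mod P)"
    and C: "\<And>i. i < M \<Longrightarrow> [C i = dft z M A i * dft z M B i] (mod P)"
    and D: "\<And>i. i < M \<Longrightarrow> [D i = dft z M C i] (mod P)"
    and y: "[int M * y = 1] (mod P)"
    and "s < M"
  shows "[D ((M - s) mod M) * y = conv_coeff n a b s] (mod P)"
proof -
  let ?a = "\<lambda>i. if i < n then a i else 0" and ?b = "\<lambda>i. if i < n then b i else 0"
  let ?c = "conv_coeff n ?a ?b"
  have "[C i = dft z M ?c i] (mod P)" if "i < M" for i
  proof -
    have "[C i = dft z M ?a i * dft z M ?b i] (mod P)"
      by (rule cong_trans[OF C[OF that]]) (intro cong_mult dft_cong A B)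
    thus ?thesis using dft_mult[of n ?a ?b M z i] n by simp
  qed
  hence "[dft z M C i = dft z M (dft z M ?c) i] (mod P)" for i
    by (rule dft_cong)
  moreover have "[D ((M - s) mod M) = dft z M C ((M - s) mod M)] (mod P)"
    using \<open>s < M\<close> by (intro D) simp
  ultimately have "[D ((M - s) mod M) = int M * ?c s] (mod P)"
    using dft_inverse[OF P root \<open>s < M\<close>, of ?c] cong_trans by blast
  hence "[D ((M - s) mod M) * y = int M * ?c s * y] (mod P)"
    by (rule cong_scalar_right)
  also have "int M * ?c s * y = ?c s * (int M * y)" by simp
  also have "[\<dots> = ?c s * 1] (mod P)"
    by (rule cong_scalar_left[OF y])
  also have "?c s * 1 = conv_coeff n a b s"
    unfolding conv_coeff_def by (auto intro: sum.cong)
  finally show ?thesis .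
qed

section \<open>The convolution program\<close>

text \<open>The right-hand side of \<open>strided_dft_halve\<close> for the stride \<open>s\<close>
  to be reached, reading values of stride \<open>2 * s\<close>. The \<open>let\<close> only
  abbreviates: the subexpressions are copied into the term, and each copy is paid for.\<close>

definition butterfly_exp :: "string \<Rightarrow> aexp" where
  "butterfly_exp X =
     (let i = Var ''i''; r = i mod\<^sub>e Var ''s''; e = i -\<^sub>e r;
          v = r +\<^sub>e (Const 2 *\<^sub>e e) mod\<^sub>e Var ''M''
      in (Elem X v +\<^sub>e Elem ''w'' e *\<^sub>e Elem X (v +\<^sub>e Var ''s'')) mod\<^sub>e Var ''p'')"

text \<open>The buffer \<open>Y\<close> is needed because a position reads two others that may come
  before it; in place they would already be overwritten.\<close>

definition dft_com :: "string \<Rightarrow> com" where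
  "dft_com X =
     Assign ''s'' (Var ''M'') ;;
     While (Less (Const 1) (Var ''s''))
      (Assign ''s'' (Var ''s'' div\<^sub>e Const 2) ;;
       fill ''Y'' (Const 0) ''M'' (butterfly_exp X) ;;
       fill X (Const 0) ''M'' (Elem ''Y'' (Var ''i'')))"

lemma wvars_dft_com [simp]: "wvars (dft_com X) = {''s'', ''i''}"
  and warrs_dft_com [simp]: "warrs (dft_com X) = {''Y'', X}"
  by (auto simp: dft_com_def)

text \<open>As \<open>2 * \<sigma>\<close> divides both \<open>M\<close> and the reduced exponent,
  the latter is at most \<open>M - 2 * \<sigma>\<close>. This leaves room for a remainder below
  \<open>\<sigma>\<close> and for the offset \<open>\<sigma>\<close>.\<close>

lemma butterfly_index:
  fixes \<sigma> M u :: nat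
  assumes "2 * \<sigma> dvd M" "0 < \<sigma>" "0 < M"
  shows "u mod \<sigma> + (2 * (u - u mod \<sigma>)) mod M + \<sigma> < M"
proof -
  have "\<sigma> dvd u - u mod \<sigma>" by (rule dvd_minus_mod)
  hence "2 * \<sigma> dvd 2 * (u - u mod \<sigma>)" by simp
  hence "2 * \<sigma> dvd (2 * (u - u mod \<sigma>)) mod M"
    using assms(1) by (simp add: dvd_mod_iff)
  then obtain f where f: "(2 * (u - u mod \<sigma>)) mod M = 2 * \<sigma> * f" by blast
  obtain k where k: "M = 2 * \<sigma> * k" using assms(1) by blast
  have "2 * \<sigma> * f < 2 * \<sigma> * k" using f k assms(3) by (metis mod_less_divisor)
  hence "f + 1 \<le> k" using assms(2) by simp
  hence "2 * \<sigma> * (f + 1) \<le> M" unfolding k by (rule mult_left_mono) simp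
  moreover have "u mod \<sigma> < \<sigma>" using assms(2) by simp
  ultimately show ?thesis unfolding f by simp
qed

lemma butterfly_exp_correct:
  fixes \<sigma> M u :: nat and P W :: int
  assumes vars: "var s ''i'' = int u" "var s ''s'' = int \<sigma>" "var s ''M'' = int M" "var s ''p'' = P"
    and M: "2 * \<sigma> dvd M" "0 < \<sigma>" "u < M" and P: "1 < P"
    and W: "2 * int M + 2 \<le> W" "P * P + P \<le> W"
    and w: "\<And>k. k < M \<Longrightarrow> arr s ''w'' k = z ^ k mod P"
    and X: "\<And>k. k < M \<Longrightarrow> arr s X k = strided_dft z M a (2 * \<sigma>) k mod P"
    and z: "[z ^ M = 1] (mod P)"
  shows "asafe W (butterfly_exp X) s \<and> aval (butterfly_exp X) s = strided_dft z M a \<sigma> u mod P"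
proof -
  define r where "r = u mod \<sigma>"
  define e where "e = u - r"
  define f where "f = (2 * e) mod M"
  have le: "r \<le> u" unfolding r_def by simp
  have v: "r + f + \<sigma> < M"
    unfolding r_def f_def e_def using butterfly_index[OF M(1,2)] M by simp
  have r: "int u mod int \<sigma> = int r" unfolding r_def by (simp add: zmod_int)
  have e: "int u - int r = int e" unfolding e_def using le by simp
  have f: "(2 * int e) mod int M = int f" unfolding f_def by (simp add: zmod_int)
  have eM: "e < M" unfolding e_def using \<open>u < M\<close> by simp
  let ?x = "arr s X (r + f)" and ?y = "arr s X (r + f + \<sigma>)" and ?w = "arr s ''w'' e"
  have b: "0 \<le> ?x" "?x < P" "0 \<le> ?y" "?y < P" "0 \<le> ?w" "?w < P"
    using v eM P by (simp_all add: w X)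
  \<comment> \<open>A residue plus a product of two residues is the largest value formed from array
    entries, hence the word bound \<open>P * P + P\<close>.\<close>
  have "?w * ?y \<le> P * P" using b P by (intro mult_mono) auto
  hence b2: "0 \<le> ?w * ?y" "?w * ?y \<le> P * P" "0 \<le> ?x + ?w * ?y" "?x + ?w * ?y \<le> W"
    using b W by auto
  have PW: "P \<le> W" using W P by (smt (verit) mult_pos_pos)
  have b3: "0 \<le> (?x + ?w * ?y) mod P" "(?x + ?w * ?y) mod P < P" using P by simp_all
  have PP: "0 \<le> P * P" using P by simp
  have PW': "\<bar>P\<bar> \<le> W" using PW P by simp
  have gen: "asafe W ((Elem X V +\<^sub>e Elem ''w'' E *\<^sub>e Elem X V') mod\<^sub>e Var ''p'') s \<and>
      aval ((Elem X V +\<^sub>e Elem ''w'' E *\<^sub>e Elem X V') mod\<^sub>e Var ''p'') s = (?x + ?w * ?y) mod P"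
    if "asafe W V s \<and> aval V s = int (r + f)" "asafe W E s \<and> aval E s = int e"
      "asafe W V' s \<and> aval V' s = int (r + f + \<sigma>)" for V E V'
  proof -
    have "nat (aval V s) = r + f" "nat (aval E s) = e" "nat (aval V' s) = r + f + \<sigma>"
      using that by simp_all
    moreover have "\<bar>?x\<bar> \<le> W" "\<bar>?y\<bar> \<le> W" "\<bar>?w\<bar> \<le> W" "\<bar>?w * ?y\<bar> \<le> W" "\<bar>?x + ?w * ?y\<bar> \<le> W"
      "\<bar>(?x + ?w * ?y) mod P\<bar> \<le> W" using b b2 b3 PW W P by linarith+
    ultimately show ?thesis using that PW' P by (simp add: vars)
  qed
  let ?R = "Var ''i'' mod\<^sub>e Var ''s''"
  have R: "asafe W ?R s \<and> aval ?R s = int r"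
    using W(1) M(2,3) v le by (simp add: vars r)
  have E: "asafe W (Var ''i'' -\<^sub>e ?R) s \<and> aval (Var ''i'' -\<^sub>e ?R) s = int e"
    using R W(1) M(2,3) v le eM by (simp add: vars r e)
  have F: "asafe W ((Const 2 *\<^sub>e (Var ''i'' -\<^sub>e ?R)) mod\<^sub>e Var ''M'') s \<and>
      aval ((Const 2 *\<^sub>e (Var ''i'' -\<^sub>e ?R)) mod\<^sub>e Var ''M'') s = int f"
    using E W(1) M(2,3) v le eM by (simp add: vars r e f)
  have V: "asafe W (?R +\<^sub>e (Const 2 *\<^sub>e (Var ''i'' -\<^sub>e ?R)) mod\<^sub>e Var ''M'') s \<and>
      aval (?R +\<^sub>e (Const 2 *\<^sub>e (Var ''i'' -\<^sub>e ?R)) mod\<^sub>e Var ''M'') s = int (r + f)"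
    using R F W(1) v by (simp add: vars r e f)
  have "asafe W (?R +\<^sub>e (Const 2 *\<^sub>e (Var ''i'' -\<^sub>e ?R)) mod\<^sub>e Var ''M'' +\<^sub>e Var ''s'') s \<and>
      aval (?R +\<^sub>e (Const 2 *\<^sub>e (Var ''i'' -\<^sub>e ?R)) mod\<^sub>e Var ''M'' +\<^sub>e Var ''s'') s = int (r + f + \<sigma>)"
    using V W(1) v by (simp add: vars r e f)
  from gen[OF V E this]
  have "asafe W (butterfly_exp X) s" "aval (butterfly_exp X) s = (?x + ?w * ?y) mod P"
    unfolding butterfly_exp_def Let_def by blast+
  moreover have "[?x + ?w * ?y = strided_dft z M a \<sigma> u] (mod P)"
  proof -
    obtain k where k: "M = \<sigma> * 2 * k" using M(1) by (auto simp: mult.commute[of 2] elim!: dvdE)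
    have "[?x + ?w * ?y = strided_dft z M a (2 * \<sigma>) (r + f) +
        z ^ e * strided_dft z M a (2 * \<sigma>) (r + f + \<sigma>)] (mod P)"
      using v eM by (simp add: w X) (intro cong_add cong_mult; simp)
    moreover have "0 < k" using \<open>u < M\<close> k by (cases k) auto
    hence "[strided_dft z M a \<sigma> u = strided_dft z M a (2 * \<sigma>) (r + f) +
        z ^ e * strided_dft z M a (2 * \<sigma>) (r + f + \<sigma>)] (mod P)"
      by (rule strided_dft_halve[OF k M(2) _ z r_def e_def]) (simp add: f_def)
    ultimately show ?thesis using cong_sym cong_trans by blast
  qed
  ultimately show ?thesis by (simp add: cong_def)
qed

lemma runs_dft_com:
  fixes P W :: int
  assumes vars: "var s ''M'' = int (2 ^ k)" "var s ''p'' = P" and P: "1 < P"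
    and X: "X \<noteq> ''Y''" "X \<noteq> ''w''"
    and W: "2 * 2 ^ k + 2 \<le> W" "P * P + P \<le> W"
    and w: "\<And>i. i < 2 ^ k \<Longrightarrow> arr s ''w'' i = z ^ i mod P"
    and a: "\<And>i. i < 2 ^ k \<Longrightarrow> 0 \<le> arr s X i \<and> arr s X i < P"
    and z: "[z ^ (2 ^ k) = 1] (mod P)"
    and Q: "\<And>s'. unchanged (dft_com X) s s' \<Longrightarrow>
      (\<And>i. i < 2 ^ k \<Longrightarrow> arr s' X i = dft z (2 ^ k) (arr s X) i mod P) \<Longrightarrow> Q s'"
    and t: "100 * (k + 1) * (2 ^ k + 1) \<le> t"
  shows "runs W (dft_com X) s t Q"
proof -
  let ?M = "2 ^ k :: nat" and ?a = "arr s X"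
  let ?b = "Less (Const 1) (Var ''s'')"
  let ?c = "Assign ''s'' (Var ''s'' div\<^sub>e Const 2) ;;
       fill ''Y'' (Const 0) ''M'' (butterfly_exp X) ;;
       fill X (Const 0) ''M'' (Elem ''Y'' (Var ''i''))"
  \<comment> \<open>One level costs 61 and 30 units per entry for the two \<open>fill\<close> loops;
    the remaining 7 cover the halving of the stride and the loop test.\<close>
  let ?C = "98 * (?M + 1)"
  define I where "I u s' \<longleftrightarrow> (\<exists>l. l \<le> k \<and> u = l * ?C \<and> var s' ''s'' = 2 ^ l \<and>
      var s' ''M'' = int ?M \<and> var s' ''p'' = P \<and>
      (\<forall>i < ?M. arr s' ''w'' i = z ^ i mod P) \<and>
      (\<forall>i < ?M. arr s' X i = strided_dft z ?M ?a (2 ^ l) i mod P))" for u and s' :: state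
  have c: "acost (butterfly_exp X) = 40" by (simp add: butterfly_exp_def Let_def)
  have W3: "3 \<le> W" using W(1) by (smt (verit) one_le_power)
  have PW: "P < W" using W P by (smt (verit) mult_pos_pos)
  have loop: "runs W (While ?b ?c) (s\<lparr>var := (var s)(''s'' := aval (Var ''M'') s)\<rparr>) (k * ?C + 5)
    (\<lambda>s'. \<forall>i < ?M. arr s' X i = dft z ?M ?a i mod P)"
  proof (rule runs_While[where I = I])
    \<comment> \<open>At stride \<open>2 ^ k\<close> each position holds a single coefficient, and
      the reduction modulo \<open>P\<close> changes nothing since the entries are residues
      already.\<close>
    show "I (k * ?C) (s\<lparr>var := (var s)(''s'' := aval (Var ''M'') s)\<rparr>)"
      unfolding I_def using vars w a by (intro exI[of _ k]) (auto simp: strided_dft_self)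
  next
    fix u s' assume "I u s'"
    then obtain l where l: "l \<le> k" "var s' ''s'' = 2 ^ l" unfolding I_def by blast
    hence "(2::int) ^ l \<le> 2 ^ k" by simp
    moreover have "(0::int) \<le> 2 ^ l" by simp
    ultimately have "\<bar>(2::int) ^ l\<bar> \<le> W" using W(1) by linarith
    thus "bsafe W ?b s'" using l W3 by simp
  next
    fix u s' assume "I u s'" "bval ?b s'"
    then obtain l' where l': "l' \<le> k" "u = l' * ?C" "var s' ''s'' = 2 ^ l'" "1 < (2::int) ^ l'"
      and M': "var s' ''M'' = int ?M" and P': "var s' ''p'' = P"
      and w': "\<And>i. i < ?M \<Longrightarrow> arr s' ''w'' i = z ^ i mod P"
      and X': "\<And>i. i < ?M \<Longrightarrow> arr s' X i = strided_dft z ?M ?a (2 ^ l') i mod P"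
      unfolding I_def by auto
    from l' obtain l where l: "l' = Suc l" by (cases l') auto
    have le: "(2::int) ^ l \<le> 2 ^ k" "(0::int) \<le> 2 ^ l" using l l' by simp_all
    have le': "2 * (2::int) ^ l \<le> W" "(2::int) ^ l \<le> W" using le W by linarith+
    let ?s1 = "s'\<lparr>var := (var s')(''s'' := aval (Var ''s'' div\<^sub>e Const 2) s')\<rparr>"
    define s1 where "s1 = ?s1"
    have s1: "var s1 ''s'' = 2 ^ l" "var s1 ''M'' = int ?M" "var s1 ''p'' = P" "arr s1 = arr s'"
      unfolding s1_def using l'(3) M' P' l by simp_all
    let ?g = "\<lambda>u. strided_dft z ?M ?a (2 ^ l) u mod P"
    have dv: "2 * 2 ^ l dvd ?M" using l l'(1) by (simp flip: power_Suc add: le_imp_power_dvd)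
    have "runs W ?c s' (91 * (?M + 1) + 4) (\<lambda>s''. I (l * ?C) s'')"
    proof (rule runs_Assign_Seq)
      show "asafe W (Var ''s'' div\<^sub>e Const 2) s'"
        using l' l le' W3 by simp
    next
      show "runs W (fill ''Y'' (Const 0) ''M'' (butterfly_exp X) ;;
          fill X (Const 0) ''M'' (Elem ''Y'' (Var ''i''))) ?s1 (91 * (?M + 1)) (\<lambda>s''. I (l * ?C) s'')"
        unfolding s1_def[symmetric]
      proof (rule runs_Seq)
        show "runs W (fill ''Y'' (Const 0) ''M'' (butterfly_exp X)) s1 (61 * (?M + 1))
          (\<lambda>s2. runs W (fill X (Const 0) ''M'' (Elem ''Y'' (Var ''i''))) s2 (30 * (?M + 1)) (\<lambda>s''. I (l * ?C) s''))"
        proof (rule runs_fill[where l = 0 and h = ?M and g = ?g])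
          fix j assume j: "0 \<le> j" "j < ?M"
          show "asafe W (butterfly_exp X) (fill_state s1 ''Y'' 0 ?g j) \<and>
            aval (butterfly_exp X) (fill_state s1 ''Y'' 0 ?g j) = ?g j"
            by (rule butterfly_exp_correct[where M = ?M])
               (use j s1 dv P W w' X' X z l in auto)
        next
          let ?s2 = "fill_state s1 ''Y'' 0 ?g ?M"
          show "runs W (fill X (Const 0) ''M'' (Elem ''Y'' (Var ''i''))) ?s2 (30 * (?M + 1)) (\<lambda>s''. I (l * ?C) s'')"
          proof (rule runs_fill[where l = 0 and h = ?M and g = ?g])
            fix j assume j: "0 \<le> j" "j < ?M"
            hence "int j < 2 ^ k" by (metis of_nat_less_iff of_nat_numeral of_nat_power)
            hence "int j \<le> W" using W(1) by linarith
            moreover have "0 \<le> ?g j" "?g j < P" using P by simp_all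
            ultimately show "asafe W (Elem ''Y'' (Var ''i'')) (fill_state ?s2 X 0 ?g j) \<and>
              aval (Elem ''Y'' (Var ''i'')) (fill_state ?s2 X 0 ?g j) = ?g j"
              using j X W PW by simp
          next
            show "I (l * ?C) (fill_state ?s2 X 0 ?g ?M)"
              unfolding I_def using l l' s1 w' X by (intro exI[of _ l]) auto
          qed (use s1 W W3 in auto)
        qed (use s1 W W3 c in auto)
      qed simp
    qed simp
    hence "runs W ?c s' (91 * (?M + 1) + 4) (\<lambda>s''. \<exists>u'. I u' s'' \<and> u' + (91 * (?M + 1) + 4) + 1 + bcost ?b \<le> u)"
      by (rule runs_weaken) (auto intro!: exI[of _ "l * ?C"] simp: l l')
    thus "\<exists>v. runs W ?c s' v (\<lambda>s''. \<exists>u'. I u' s'' \<and> u' + v + 1 + bcost ?b \<le> u)" by blast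
  next
    fix u s' assume "I u s'" "\<not> bval ?b s'"
    then obtain l where "\<not> 1 < (2::int) ^ l"
      and X': "\<forall>i < ?M. arr s' X i = strided_dft z ?M ?a (2 ^ l) i mod P"
      unfolding I_def by auto
    hence "l = 0" by (metis one_less_numeral_iff one_less_power gr0I semiring_norm(76))
    with X' show "\<forall>i < ?M. arr s' X i = dft z ?M ?a i mod P"
      using strided_dft_1 by simp
  qed simp
  have "runs W (dft_com X) s t (\<lambda>s'. \<forall>i < ?M. arr s' X i = dft z ?M ?a i mod P)"
    unfolding dft_com_def
  proof (rule runs_Assign_Seq[OF _ loop])
    have "0 \<le> (2::int) ^ k" by simp
    hence "\<bar>(2::int) ^ k\<bar> \<le> W" using W(1) by linarith
    thus "asafe W (Var ''M'') s" using vars by simp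
    have "1 \<le> ?M" by simp
    hence "k * ?C + 7 \<le> 100 * (k + 1) * (?M + 1)" by (simp add: algebra_simps)
    thus "1 + acost (Var ''M'') + (k * ?C + 5) \<le> t" using t by simp
  qed
  thus ?thesis by (rule runs_frame) (use Q in auto)
qed

lemma runs_SeqI:
  assumes "runs W c1 s u R" "\<And>s'. R s' \<Longrightarrow> unchanged c1 s s' \<Longrightarrow> runs W c2 s' v Q" "u + v \<le> t"
  shows "runs W (Seq c1 c2) s t Q"
  by (rule runs_Seq[OF runs_frame[OF assms(1,2)] assms(3)])

section \<open>Powers of two and their inverses modulo odd numbers\<close>

definition pow2_com :: "string \<Rightarrow> string \<Rightarrow> com" where
  "pow2_com x j =
     Assign ''M'' (Const 1) ;; Assign j (Const 0) ;;
     While (Less (Var ''M'') (Const 2 *\<^sub>e Var x))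
       (Assign ''M'' (Var ''M'' *\<^sub>e Const 2) ;; Assign j (Var j +\<^sub>e Const 1))"

text \<open>Used for \<open>N\<close>, where it is the exponent \<open>m\<close> of the modulus, and
  for each \<open>n\<close>, where it determines the transform length. The factor 2 is the room that
  an acyclic convolution needs.\<close>

definition level :: "nat \<Rightarrow> nat" where
  "level n = (LEAST j. 2 * n \<le> 2 ^ j)"

lemma level_ge: "2 * n \<le> 2 ^ level n"
  unfolding level_def by (rule LeastI[of _ "2 * n"]) (simp add: less_imp_le)

lemma less_level: "j < level n \<Longrightarrow> 2 ^ j < 2 * n"
  unfolding level_def using not_less_Least by fastforce

lemma level_le: "2 * n \<le> 2 ^ m \<Longrightarrow> level n \<le> m"
  unfolding level_def by (rule Least_le)

lemma two_power_level_less: "0 < n \<Longrightarrow> 2 ^ level n < 4 * n"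
  using less_level[of "level n - 1" n] by (cases "level n") auto

lemma wvars_pow2_com [simp]: "wvars (pow2_com x j) = {''M'', j}"
  and warrs_pow2_com [simp]: "warrs (pow2_com x j) = {}"
  by (auto simp: pow2_com_def)

lemma runs_pow2_com:
  assumes x: "var s x = int n" and ne: "x \<noteq> ''M''" "x \<noteq> j" "j \<noteq> ''M''" and n: "0 < n"
    and W: "4 * int n \<le> W"
    and Q: "\<And>s'. var s' ''M'' = 2 ^ level n \<Longrightarrow> var s' j = int (level n) \<Longrightarrow> Q s'"
    and t: "20 * (level n + 1) \<le> t"
  shows "runs W (pow2_com x j) s t Q"
proof -
  define I where "I u s' \<longleftrightarrow> (\<exists>i. i \<le> level n \<and> u = (level n - i) * 14 \<and> var s' x = int n \<and>
     var s' ''M'' = 2 ^ i \<and> var s' j = int i)" for u and s' :: state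
  let ?b = "Less (Var ''M'') (Const 2 *\<^sub>e Var x)"
  let ?c = "Assign ''M'' (Var ''M'' *\<^sub>e Const 2) ;; Assign j (Var j +\<^sub>e Const 1)"
  let ?s = "s\<lparr>var := (var s)(''M'' := 1, j := 0)\<rparr>"
  have W4: "4 \<le> W" using n W by linarith
  have le: "(2::int) ^ i \<le> W" "int i < W" if "i \<le> level n" for i
  proof -
    have "(2::int) ^ i \<le> 2 ^ level n" using that by simp
    also have "(2::int) ^ level n < 4 * int n"
      using two_power_level_less[OF n] by (metis of_nat_less_iff of_nat_mult of_nat_numeral of_nat_power)
    finally show *: "(2::int) ^ i \<le> W" using W by simp
    have "int i < 2 ^ i" by (rule of_nat_less_two_power)
    with * show "int i < W" by linarith
  qed
  have "runs W (While ?b ?c) ?s (level n * 14 + 6) Q"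
  proof (rule runs_While[where I = I])
    show "I (level n * 14) ?s"
      unfolding I_def using x ne by (intro exI[of _ 0]) auto
  next
    fix u s' assume "I u s'"
    then obtain i where i: "i \<le> level n" "var s' x = int n" "var s' ''M'' = 2 ^ i"
      unfolding I_def by blast
    thus "bsafe W ?b s'" using le[OF i(1)] W W4 by simp
  next
    fix u s' assume "I u s'" "bval ?b s'"
    then obtain i where i: "i \<le> level n" "u = (level n - i) * 14" "var s' x = int n"
       "var s' ''M'' = 2 ^ i" "var s' j = int i" "(2::int) ^ i < 2 * int n"
      unfolding I_def by auto
    have "(2::nat) ^ i < 2 * n"
      using i(6) by (metis of_nat_less_iff of_nat_mult of_nat_numeral of_nat_power)
    hence "i < level n" using level_ge[of n] i(1) by (metis le_neq_implies_less leD)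
    hence "level n - i = Suc (level n - Suc i)" by simp
    hence u: "(level n - Suc i) * 14 + 8 + 1 + bcost ?b \<le> u" using i by simp
    have "runs W ?c s' 8 (\<lambda>s''. I ((level n - Suc i) * 14) s'')"
    proof (intro runs_Assign_Seq[where u = 4] runs_Assign, goal_cases)
      case 4
      show ?case unfolding I_def using i ne \<open>i < level n\<close> by (intro exI[of _ "Suc i"]) auto
    qed (use i ne le[of i] le[of "Suc i"] \<open>i < level n\<close> W4 in auto)
    hence "runs W ?c s' 8 (\<lambda>s''. \<exists>u'. I u' s'' \<and> u' + 8 + 1 + bcost ?b \<le> u)"
      by (rule runs_weaken) (use u in auto)
    thus "\<exists>v. runs W ?c s' v (\<lambda>s''. \<exists>u'. I u' s'' \<and> u' + v + 1 + bcost ?b \<le> u)" by blast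
  next
    fix u s' assume "I u s'" "\<not> bval ?b s'"
    then obtain i where i: "i \<le> level n" "var s' ''M'' = 2 ^ i" "var s' j = int i" "2 * int n \<le> 2 ^ i"
      unfolding I_def by auto
    have "2 * n \<le> 2 ^ i"
      using i(4) by (metis of_nat_le_iff of_nat_mult of_nat_numeral of_nat_power)
    hence "i = level n" using i(1) level_le le_antisym by blast
    with i show "Q s'" using Q by simp
  qed simp
  thus ?thesis
    unfolding pow2_com_def
    by (intro runs_Assign_Seq[where u = "level n * 14 + 8"] runs_Assign_Seq[where u = "level n * 14 + 6"])
       (use ne W4 t in \<open>auto simp: fun_upd_twist\<close>)
qed

text \<open>Inverts a power of two by repeated halving, without the Euclidean algorithm: for odd
  \<open>p\<close>, one of \<open>z\<close> and \<open>z + p\<close> is even, and the summand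
  \<open>(z mod 2) * p\<close> selects it without a branch. It serves twice, for the transform
  length modulo the prime and for \<open>M\<close> modulo each sieving prime.\<close>

definition inv2_com :: "string \<Rightarrow> string \<Rightarrow> com" where
  "inv2_com p m =
     Assign ''z'' (Const 1) ;; Assign ''i'' (Const 0) ;;
     While (Less (Var ''i'') (Var m))
       (Assign ''z'' ((Var ''z'' +\<^sub>e (Var ''z'' mod\<^sub>e Const 2) *\<^sub>e Var p) div\<^sub>e Const 2) ;;
        Assign ''i'' (Var ''i'' +\<^sub>e Const 1))"

lemma wvars_inv2_com [simp]: "wvars (inv2_com p m) = {''z'', ''i''}"
  and warrs_inv2_com [simp]: "warrs (inv2_com p m) = {}"
  by (auto simp: inv2_com_def)

lemma runs_inv2_com:
  assumes p: "var s p = P" "odd P" "1 < P" and m: "var s m = int k"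
    and ne: "p \<notin> {''z'', ''i''}" "m \<notin> {''z'', ''i''}"
    and W: "2 * P \<le> W" "int k < W"
    and Q: "\<And>s'. [2 ^ k * var s' ''z'' = 1] (mod P) \<Longrightarrow> 0 \<le> var s' ''z'' \<Longrightarrow> var s' ''z'' < P \<Longrightarrow> Q s'"
    and t: "20 * (k + 1) \<le> t"
  shows "runs W (inv2_com p m) s t Q"
proof -
  define I where "I u s' \<longleftrightarrow> (\<exists>i. i \<le> k \<and> u = (k - i) * 18 \<and> var s' p = P \<and> var s' m = int k \<and>
     var s' ''i'' = int i \<and> [2 ^ i * var s' ''z'' = 1] (mod P) \<and> 0 \<le> var s' ''z'' \<and> var s' ''z'' < P)"
    for u and s' :: state
  let ?b = "Less (Var ''i'') (Var m)"
  let ?e = "(Var ''z'' +\<^sub>e (Var ''z'' mod\<^sub>e Const 2) *\<^sub>e Var p) div\<^sub>e Const 2"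
  let ?c = "Assign ''z'' ?e ;; Assign ''i'' (Var ''i'' +\<^sub>e Const 1)"
  let ?s = "s\<lparr>var := (var s)(''z'' := 1, ''i'' := 0)\<rparr>"
  have "runs W (While ?b ?c) ?s (k * 18 + 4) Q"
  proof (rule runs_While[where I = I])
    show "I (k * 18) ?s"
      unfolding I_def using p m ne by (intro exI[of _ 0]) auto
  next
    fix u s' assume "I u s'"
    thus "bsafe W ?b s'" unfolding I_def using W by auto
  next
    fix u s' assume "I u s'" "bval ?b s'"
    then obtain i where i: "i < k" "u = (k - i) * 18" "var s' p = P" "var s' m = int k"
      "var s' ''i'' = int i" and z: "[2 ^ i * var s' ''z'' = 1] (mod P)" "0 \<le> var s' ''z''" "var s' ''z'' < P"
      unfolding I_def by auto
    let ?z = "var s' ''z''"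
    define z' where "z' = (?z + (?z mod 2) * P) div 2"
    have even: "2 * z' = ?z + (?z mod 2) * P"
      unfolding z'_def using p(2) by (intro dvd_mult_div_cancel) (simp add: mod_2_eq_odd)
    have zm: "?z mod 2 = 0 \<or> ?z mod 2 = 1" by auto
    have z': "0 \<le> z'" "z' < P" using zm even z p(3) by auto
    have "2 ^ Suc i * z' = 2 ^ i * (2 * z')" by simp
    also have "\<dots> = 2 ^ i * ?z + P * (2 ^ i * (?z mod 2))"
      unfolding even by (simp add: algebra_simps)
    finally have "[2 ^ Suc i * z' = 1] (mod P)"
      using z(1) by (simp add: cong_def)
    moreover have "k - i = Suc (k - Suc i)" using i by simp
    hence u: "(k - Suc i) * 18 + 14 + 1 + bcost ?b \<le> u" using i by simp
    ultimately have "runs W ?c s' 14 (\<lambda>s''. I ((k - Suc i) * 18) s'')"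
    proof (intro runs_Assign_Seq[where u = 4] runs_Assign, goal_cases)
      case 1
      have "\<bar>(?z mod 2) * P\<bar> \<le> W" "\<bar>?z + (?z mod 2) * P\<bar> \<le> W" "\<bar>?z mod 2\<bar> \<le> W"
        using zm z p(3) W by auto
      thus ?case using i z z' W p(3) by (simp add: z'_def)
    next
      case 4
      thus ?case unfolding I_def using i ne z' by (intro exI[of _ "Suc i"]) (auto simp: z'_def)
    qed (use i ne W p(3) in auto)
    hence "runs W ?c s' 14 (\<lambda>s''. \<exists>u'. I u' s'' \<and> u' + 14 + 1 + bcost ?b \<le> u)"
      by (rule runs_weaken) (use u in auto)
    thus "\<exists>v. runs W ?c s' v (\<lambda>s''. \<exists>u'. I u' s'' \<and> u' + v + 1 + bcost ?b \<le> u)" by blast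
  next
    fix u s' assume "I u s'" "\<not> bval ?b s'"
    thus "Q s'" unfolding I_def using Q by auto
  qed simp
  thus ?thesis
    unfolding inv2_com_def
    by (intro runs_Assign_Seq[where u = "k * 18 + 6"] runs_Assign_Seq[where u = "k * 18 + 4"])
       (use W p t in auto)
qed

text \<open>For \<open>0 < d < 2 ^ j\<close> the exponent \<open>2 ^ (m - j) * d\<close> lies
  strictly between 0 and \<open>2 ^ m\<close>, so exactness of the order is inherited. This is why a
  table of repeated squares serves every length.\<close>

lemma root_mod_power:
  assumes "root_mod P (2 ^ m) q" "j \<le> m"
  shows "root_mod P (2 ^ j) (q ^ (2 ^ (m - j)))"
proof -
  have e: "(q ^ (2 ^ (m - j))) ^ d = q ^ (2 ^ (m - j) * d)" for d
    by (simp add: power_mult)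
  have m: "(2::nat) ^ (m - j) * 2 ^ j = 2 ^ m"
    using assms(2) by (simp flip: power_add)
  have "0 < 2 ^ (m - j) * d \<and> 2 ^ (m - j) * d < 2 ^ m" if "0 < d" "d < 2 ^ j" for d :: nat
    using that unfolding m[symmetric] by simp
  thus ?thesis using assms(1) unfolding root_mod_def e m by blast
qed

lemma root_mod_cong:
  assumes "root_mod P M z" "[z = z'] (mod P)"
  shows "root_mod P M z'"
  using assms cong_pow[OF assms(2)] cong_sym cong_trans unfolding root_mod_def by meson

section \<open>Convolution by three transforms\<close>

definition multiply_com :: com where
  "multiply_com =
     fill ''w'' (Const 1) ''M'' ((Elem ''w'' (Var ''i'' -\<^sub>e Const 1) *\<^sub>e Var ''o'') mod\<^sub>e Var ''p'') ;;
     dft_com ''A'' ;;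
     dft_com ''B'' ;;
     fill ''A'' (Const 0) ''M'' ((Elem ''A'' (Var ''i'') *\<^sub>e Elem ''B'' (Var ''i'')) mod\<^sub>e Var ''p'') ;;
     dft_com ''A'' ;;
     inv2_com ''p'' ''j'' ;;
     fill ''c'' (Const 0) ''M''
       ((Elem ''A'' ((Var ''M'' -\<^sub>e Var ''i'') mod\<^sub>e Var ''M'') *\<^sub>e Var ''z'') mod\<^sub>e Var ''p'')"

text \<open>The inputs are arbitrary words, so they are reduced modulo \<open>p\<close> when copied.
  The zero padding is written explicitly because \<open>A\<close> and \<open>B\<close> may contain
  data of an earlier, longer convolution. Entry \<open>m - j\<close> of the table \<open>r\<close>
  is the root whose order is the transform length \<open>2 ^ j\<close>.\<close>

definition conv_com :: com where
  "conv_com =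
     pow2_com ''n'' ''j'' ;;
     fill ''A'' (Const 0) ''n'' (Elem ''a'' (Var ''i'') mod\<^sub>e Var ''p'') ;;
     fill ''A'' (Var ''n'') ''M'' (Const 0) ;;
     fill ''B'' (Const 0) ''n'' (Elem ''b'' (Var ''i'') mod\<^sub>e Var ''p'') ;;
     fill ''B'' (Var ''n'') ''M'' (Const 0) ;;
     Assign ''o'' (Elem ''r'' (Var ''m'' -\<^sub>e Var ''j'')) ;;
     Store ''w'' (Const 0) (Const 1) ;;
     multiply_com"

definition conv_time :: "nat \<Rightarrow> nat" where
  "conv_time n = 1000 * (level n + 1) * (2 ^ level n + 1)"

lemma wvars_conv_com: "wvars conv_com = {''M'', ''j'', ''i'', ''o'', ''s'', ''z''}"
  and warrs_conv_com: "warrs conv_com = {''A'', ''B'', ''w'', ''Y'', ''c''}"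
  by (auto simp: conv_com_def multiply_com_def)

lemma residue_mult_bounds:
  fixes x y P :: int
  assumes "0 \<le> x" "x < P" "0 \<le> y" "y < P"
  shows "0 \<le> x * y" "x * y \<le> P * P"
  using assms by (auto intro: mult_mono)

lemma runs_fill_reduced:
  assumes ne: "A \<noteq> X" and "var s ''n'' = int n" "var s ''p'' = P" "1 < P" "P < W" "int n < W"
    and X: "\<And>i. i < n \<Longrightarrow> \<bar>arr s X i\<bar> \<le> W"
    and t: "26 * (n + 1) \<le> t"
  shows "runs W (fill A (Const 0) ''n'' (Elem X (Var ''i'') mod\<^sub>e Var ''p'')) s t
    (\<lambda>s'. \<forall>k < n. arr s' A k = arr s X k mod P)"
proof (rule runs_fill[where l = 0 and h = n and g = "\<lambda>k. arr s X k mod P"])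
  fix j assume j: "0 \<le> j" "j < n"
  have "0 \<le> arr s X j mod P" "arr s X j mod P < P" using assms(4) by simp_all
  hence "\<bar>arr s X j mod P\<bar> \<le> W" using assms(5) by linarith
  thus "asafe W (Elem X (Var ''i'') mod\<^sub>e Var ''p'') (fill_state s A 0 (\<lambda>k. arr s X k mod P) j) \<and>
    aval (Elem X (Var ''i'') mod\<^sub>e Var ''p'') (fill_state s A 0 (\<lambda>k. arr s X k mod P) j) = arr s X j mod P"
    using j assms X[of j] by simp
qed (use assms in auto)

lemma runs_fill_zero:
  assumes "var s ''n'' = int n" "var s ''M'' = int M" "n \<le> M" "0 < M" "int M < W"
    and t: "22 * (M + 1) \<le> t"
  shows "runs W (fill A (Var ''n'') ''M'' (Const 0)) s t
    (\<lambda>s'. \<forall>k. arr s' A k = (if n \<le> k \<and> k < M then 0 else arr s A k))"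
proof (rule runs_fill[where l = n and h = M and g = "\<lambda>_. 0"])
  have "(M - n + 1) * 22 \<le> (M + 1) * 22" by (intro mult_right_mono) simp_all
  thus "(M - n + 1) * (acost (Var ''n'') + acost (Const 0) + 20) \<le> t" using t by simp
qed (use assms in auto)

lemma runs_fill_powers:
  assumes "var s ''o'' = x" "var s ''p'' = P" "var s ''M'' = int M" "0 < M"
    and w: "arr s ''w'' 0 = 1" and x: "0 \<le> x" "x < P" "1 < P"
    and W: "int M < W" "P * P + P \<le> W"
    and t: "30 * (M + 1) \<le> t"
  shows "runs W (fill ''w'' (Const 1) ''M'' ((Elem ''w'' (Var ''i'' -\<^sub>e Const 1) *\<^sub>e Var ''o'') mod\<^sub>e Var ''p'')) s t
    (\<lambda>s'. \<forall>k < M. arr s' ''w'' k = x ^ k mod P)"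
proof (rule runs_fill[where l = 1 and h = M and g = "\<lambda>k. x ^ k mod P"])
  fix j assume j: "1 \<le> j" "j < M"
  let ?s = "fill_state s ''w'' 1 (\<lambda>k. x ^ k mod P) j"
  have w': "arr ?s ''w'' (j - 1) = x ^ (j - 1) mod P"
    using j w x by (cases "j = 1") auto
  let ?y = "x ^ (j - 1) mod P"
  have y: "0 \<le> ?y" "?y < P" using x by simp_all
  have "0 \<le> ?y * x" "?y * x \<le> P * P" by (rule residue_mult_bounds[OF y x(1,2)])+
  moreover have "0 \<le> (?y * x) mod P" "(?y * x) mod P < P" using x by simp_all
  ultimately have b: "\<bar>?y\<bar> \<le> W" "\<bar>?y * x\<bar> \<le> W" "\<bar>(?y * x) mod P\<bar> \<le> W" "P \<le> W" "x \<le> W"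
    using W x y by linarith+
  have "?y * x mod P = x ^ j mod P"
    using j by (cases j) (auto simp: mod_simps mult.commute)
  moreover have "nat (int j - 1) = j - 1" using j by simp
  ultimately show "asafe W ((Elem ''w'' (Var ''i'' -\<^sub>e Const 1) *\<^sub>e Var ''o'') mod\<^sub>e Var ''p'') ?s \<and>
      aval ((Elem ''w'' (Var ''i'' -\<^sub>e Const 1) *\<^sub>e Var ''o'') mod\<^sub>e Var ''p'') ?s = x ^ j mod P"
    using b j w' assms(1-3) W(1) x by (simp del: fill_state_simps(2))
next
  show "\<forall>k<M. arr (fill_state s ''w'' 1 (\<lambda>k. x ^ k mod P) M) ''w'' k = x ^ k mod P"
    using w x by (auto simp: not_le)
next
  have "(M - 1 + 1) * 30 \<le> (M + 1) * 30" by (intro mult_right_mono) simp_all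
  thus "(M - 1 + 1) * (acost (Const 1) + acost ((Elem ''w'' (Var ''i'' -\<^sub>e Const 1) *\<^sub>e Var ''o'') mod\<^sub>e Var ''p'') + 20) \<le> t"
    using t by simp
qed (use assms in auto)

lemma runs_fill_product:
  assumes "var s ''p'' = P" "var s ''M'' = int M" "1 < P" "int M < W" "P * P + P \<le> W"
    and A: "\<And>i. i < M \<Longrightarrow> 0 \<le> arr s ''A'' i \<and> arr s ''A'' i < P"
    and B: "\<And>i. i < M \<Longrightarrow> 0 \<le> arr s ''B'' i \<and> arr s ''B'' i < P"
    and t: "30 * (M + 1) \<le> t"
  shows "runs W (fill ''A'' (Const 0) ''M'' ((Elem ''A'' (Var ''i'') *\<^sub>e Elem ''B'' (Var ''i'')) mod\<^sub>e Var ''p'')) s t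
    (\<lambda>s'. \<forall>k < M. arr s' ''A'' k = (arr s ''A'' k * arr s ''B'' k) mod P)"
proof (rule runs_fill[where l = 0 and h = M and g = "\<lambda>k. (arr s ''A'' k * arr s ''B'' k) mod P"])
  fix j assume j: "0 \<le> j" "j < M"
  let ?x = "arr s ''A'' j" and ?y = "arr s ''B'' j"
  have "0 \<le> ?x * ?y" "?x * ?y \<le> P * P" using A[OF j(2)] B[OF j(2)] by (auto intro: mult_mono)
  moreover have "0 \<le> (?x * ?y) mod P" "(?x * ?y) mod P < P" using assms(3) by simp_all
  moreover have "0 \<le> P * P" by simp
  ultimately have "\<bar>?x\<bar> \<le> W" "\<bar>?y\<bar> \<le> W" "\<bar>?x * ?y\<bar> \<le> W" "\<bar>(?x * ?y) mod P\<bar> \<le> W" "P \<le> W"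
    using A[OF j(2)] B[OF j(2)] assms(3,5) by linarith+
  thus "asafe W ((Elem ''A'' (Var ''i'') *\<^sub>e Elem ''B'' (Var ''i'')) mod\<^sub>e Var ''p'')
        (fill_state s ''A'' 0 (\<lambda>k. arr s ''A'' k * arr s ''B'' k mod P) j) \<and>
      aval ((Elem ''A'' (Var ''i'') *\<^sub>e Elem ''B'' (Var ''i'')) mod\<^sub>e Var ''p'')
        (fill_state s ''A'' 0 (\<lambda>k. arr s ''A'' k * arr s ''B'' k mod P) j) =
      arr s ''A'' j * arr s ''B'' j mod P"
    using j assms(1-4) by simp
qed (use assms in auto)

lemma runs_fill_scaled_reversal:
  assumes "var s ''p'' = P" "var s ''M'' = int M" "var s ''z'' = y" "1 < P" "int M < W" "P * P + P \<le> W"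
    and A: "\<And>i. i < M \<Longrightarrow> 0 \<le> arr s ''A'' i \<and> arr s ''A'' i < P" and y: "0 \<le> y" "y < P"
    and t: "40 * (M + 1) \<le> t"
  shows "runs W (fill ''c'' (Const 0) ''M''
      ((Elem ''A'' ((Var ''M'' -\<^sub>e Var ''i'') mod\<^sub>e Var ''M'') *\<^sub>e Var ''z'') mod\<^sub>e Var ''p'')) s t
    (\<lambda>s'. \<forall>k < M. arr s' ''c'' k = (arr s ''A'' ((M - k) mod M) * y) mod P)"
proof (rule runs_fill[where l = 0 and h = M and g = "\<lambda>k. (arr s ''A'' ((M - k) mod M) * y) mod P"])
  fix j assume j: "0 \<le> j" "j < M"
  define k where "k = (M - j) mod M"
  have k: "(int M - int j) mod int M = int k" "- int j mod int M = int k" "k < M"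
    using j by (simp_all add: k_def zmod_int of_nat_diff)
  let ?k = k
  let ?x = "arr s ''A'' ?k"
  have x: "0 \<le> ?x" "?x < P" using A[OF k(3)] by simp_all
  have "0 \<le> ?x * y" "?x * y \<le> P * P" using x y by (auto intro: mult_mono)
  moreover have "0 \<le> (?x * y) mod P" "(?x * y) mod P < P" using assms(4) by simp_all
  moreover have "0 \<le> P * P" by simp
  ultimately have "\<bar>?x\<bar> \<le> W" "\<bar>y\<bar> \<le> W" "\<bar>?x * y\<bar> \<le> W" "\<bar>(?x * y) mod P\<bar> \<le> W" "P \<le> W"
    using x y assms(4,6) by linarith+
  thus "asafe W ((Elem ''A'' ((Var ''M'' -\<^sub>e Var ''i'') mod\<^sub>e Var ''M'') *\<^sub>e Var ''z'') mod\<^sub>e Var ''p'')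
        (fill_state s ''c'' 0 (\<lambda>k. (arr s ''A'' ((M - k) mod M) * y) mod P) j) \<and>
      aval ((Elem ''A'' ((Var ''M'' -\<^sub>e Var ''i'') mod\<^sub>e Var ''M'') *\<^sub>e Var ''z'') mod\<^sub>e Var ''p'')
        (fill_state s ''c'' 0 (\<lambda>k. (arr s ''A'' ((M - k) mod M) * y) mod P) j) =
      arr s ''A'' ((M - j) mod M) * y mod P"
    using j k assms(1-5) by (simp flip: k_def)
qed (use assms in auto)

text \<open>The three transforms, at 100 units of \<open>(j + 1) * (M + 1)\<close> each, dominate;
  the other phases are linear in \<open>M\<close>, or logarithmic for the inverse of the length. The
  powers in \<open>w\<close> depend on the length and are rebuilt on every call, starting from the
  entry 1 at index 0.\<close>

lemma runs_multiply_com: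
  fixes P :: int
  assumes vars: "var s ''M'' = int M" "var s ''p'' = P" "var s ''j'' = int j" "var s ''o'' = z"
    and w: "arr s ''w'' 0 = 1" and M: "M = 2 ^ j" and P: "prime P" "odd P"
    and n: "0 < n" "2 * n \<le> M"
    and root: "root_mod P M z" and z: "0 \<le> z" "z < P"
    and W: "P * P + P \<le> W" "2 * int M + 2 \<le> W"
    and a: "\<And>i. i < M \<Longrightarrow> arr s ''A'' i = (if i < n then a i mod P else 0)"
    and b: "\<And>i. i < M \<Longrightarrow> arr s ''B'' i = (if i < n then b i mod P else 0)"
    and t: "440 * (j + 1) * (M + 1) \<le> t"
  shows "runs W multiply_com s t (\<lambda>s'. \<forall>k < M. [arr s' ''c'' k = conv_coeff n a b k] (mod P))"
proof -
  have p1: "1 < P" using P(1) by (rule prime_gt_1_int)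
  have PW: "2 * P \<le> P * P" using p1 by (intro mult_right_mono) auto
  have PW': "2 * P \<le> W" "P < W" using PW W(1) p1 by linarith+
  have M0: "0 < M" unfolding M by simp
  have "j < M" unfolding M by (rule less_exp)
  hence jW: "int j < W" "int M < W" using W(2) by linarith+
  have z1: "[z ^ 2 ^ j = 1] (mod P)" using root unfolding M root_mod_def by blast
  let ?A = "arr s ''A''" and ?B = "arr s ''B''"
  have range: "0 \<le> ?A i \<and> ?A i < P" "0 \<le> ?B i \<and> ?B i < P" if "i < M" for i
    using a[OF that] b[OF that] p1 by simp_all
  define C where "C i = (dft z M ?A i mod P) * (dft z M ?B i mod P) mod P" for i
  define F where "F = (j + 1) * (M + 1)"
  have F: "M + 1 \<le> F" "100 * (j + 1) * (2 ^ j + 1) \<le> 100 * F" "20 * (j + 1) \<le> 20 * F"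
    unfolding F_def M by (simp_all add: algebra_simps)
  show ?thesis
    unfolding multiply_com_def
  proof (rule runs_SeqI[where u = "30 * F" and v = "410 * F" and
        R = "\<lambda>s'. \<forall>k < M. arr s' ''w'' k = z ^ k mod P"], goal_cases)
    case 1
    show ?case by (rule runs_fill_powers[where M = M and P = P])
      (use vars w z p1 W M0 F in auto)
  next
    case (2 s1)
    note u1 = unchanged_var[OF 2(2)] unchanged_arr[OF 2(2)]
    have v1: "var s1 ''M'' = int M" "var s1 ''p'' = P" "var s1 ''j'' = int j" "\<forall>k < M. arr s1 ''w'' k = z ^ k mod P"
      "arr s1 ''A'' = ?A" "arr s1 ''B'' = ?B"
      using 2(1) u1 vars by simp_all
    show ?case
    proof (rule runs_SeqI[where u = "100 * F" and v = "310 * F" and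
          R = "\<lambda>s'. \<forall>i < M. arr s' ''A'' i = dft z M ?A i mod P"], goal_cases)
      case 1
      show ?case
        by (rule runs_dft_com[where k = j and P = P and z = z])
           (use v1 p1 W range z1 F in \<open>auto simp: M\<close>)
    next
      case (2 s2)
      note u2 = unchanged_var[OF 2(2)] unchanged_arr[OF 2(2)]
      have v2: "var s2 ''M'' = int M" "var s2 ''p'' = P" "var s2 ''j'' = int j" "\<forall>k < M. arr s2 ''w'' k = z ^ k mod P"
        "\<forall>i < M. arr s2 ''A'' i = dft z M ?A i mod P" "arr s2 ''B'' = ?B"
        using 2(1) u2 v1 by simp_all
      show ?case
      proof (rule runs_SeqI[where u = "100 * F" and v = "210 * F" and
            R = "\<lambda>s'. \<forall>i < M. arr s' ''B'' i = dft z M ?B i mod P"], goal_cases)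
        case 1
        show ?case
          by (rule runs_dft_com[where k = j and P = P and z = z])
             (use v2 p1 W range z1 F in \<open>auto simp: M\<close>)
      next
        case (2 s3)
        note u3 = unchanged_var[OF 2(2)] unchanged_arr[OF 2(2)]
        have v3: "var s3 ''M'' = int M" "var s3 ''p'' = P" "var s3 ''j'' = int j" "\<forall>k < M. arr s3 ''w'' k = z ^ k mod P"
          "\<forall>i < M. arr s3 ''A'' i = dft z M ?A i mod P" "\<forall>i < M. arr s3 ''B'' i = dft z M ?B i mod P"
          using 2(1) u3 v2 by simp_all
        show ?case
        proof (rule runs_SeqI[where u = "30 * F" and v = "180 * F" and
              R = "\<lambda>s'. \<forall>k < M. arr s' ''A'' k = C k"], goal_cases)
          case 1
          show ?case
            by (rule runs_weaken[OF runs_fill_product[where M = M and P = P and t = "30 * (M + 1)"]])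
               (use v3 p1 W jW F in \<open>auto simp: C_def\<close>)
        next
          case (2 s4)
          note u4 = unchanged_var[OF 2(2)] unchanged_arr[OF 2(2)]
          have v4: "var s4 ''M'' = int M" "var s4 ''p'' = P" "var s4 ''j'' = int j" "\<forall>k < M. arr s4 ''w'' k = z ^ k mod P"
            "\<forall>i < M. arr s4 ''A'' i = C i"
            using 2(1) u4 v3 by simp_all
          show ?case
          proof (rule runs_SeqI[where u = "100 * F" and v = "80 * F" and
                R = "\<lambda>s'. \<forall>i < M. arr s' ''A'' i = dft z M (arr s4 ''A'') i mod P"], goal_cases)
            case 1
            show ?case
              by (rule runs_dft_com[where k = j and P = P and z = z])
                 (use v4 p1 W z1 F in \<open>auto simp: M C_def\<close>)
          next
            case (2 s5)
            note u5 = unchanged_var[OF 2(2)] unchanged_arr[OF 2(2)]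
            have "dft z M (arr s4 ''A'') i = dft z M C i" for i
              unfolding dft_def using v4(5) by (intro sum.cong) auto
            hence v5: "var s5 ''M'' = int M" "var s5 ''p'' = P" "var s5 ''j'' = int j" "\<forall>i < M. arr s5 ''A'' i = dft z M C i mod P"
              using 2(1) u5 v4 by simp_all
            show ?case
            proof (rule runs_SeqI[where u = "20 * F" and v = "50 * F" and
                  R = "\<lambda>s'. [2 ^ j * var s' ''z'' = 1] (mod P) \<and> 0 \<le> var s' ''z'' \<and> var s' ''z'' < P"], goal_cases)
              case 1
              show ?case
                by (rule runs_inv2_com[where k = j and P = P])
                   (use v5 p1 P PW' jW F in auto)
            next
              case (2 s6)
              note u6 = unchanged_var[OF 2(2)] unchanged_arr[OF 2(2)]
              define y where "y = var s6 ''z''"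
              have y: "[int M * y = 1] (mod P)" "0 \<le> y" "y < P" using 2(1) by (auto simp: M y_def)
              have v6: "var s6 ''M'' = int M" "var s6 ''p'' = P" "var s6 ''j'' = int j" "\<forall>i < M. arr s6 ''A'' i = dft z M C i mod P" "var s6 ''z'' = y"
                using u6 v5 by (simp_all add: y_def)
              have conv: "[arr s6 ''A'' ((M - k) mod M) * y mod P = conv_coeff n a b k] (mod P)" if "k < M" for k
              proof -
                have "[arr s6 ''A'' ((M - k) mod M) * y = conv_coeff n a b k] (mod P)"
                proof (rule convolution_theorem[OF P(1) root n _ _ _ _ y(1) that])
                  fix i assume "i < M"
                  thus "[?A i = (if i < n then a i else 0)] (mod P)"
                    "[?B i = (if i < n then b i else 0)] (mod P)"
                    "[arr s6 ''A'' i = dft z M C i] (mod P)"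
                    using a b v6(4) by simp_all
                  show "[C i = dft z M ?A i * dft z M ?B i] (mod P)"
                    by (simp add: C_def cong_def mod_simps)
                qed
                thus ?thesis by simp
              qed
              show ?case
                by (rule runs_weaken[OF runs_fill_scaled_reversal[where M = M and P = P and y = y and t = "40 * (M + 1)"]])
                   (use v6 p1 W jW y F conv in auto)
            qed simp
          qed simp
        qed simp
      qed simp
    qed simp
  qed (use t in \<open>simp add: F_def algebra_simps\<close>)
qed

lemma runs_conv_com:
  fixes P :: int
  assumes vars: "var s ''n'' = int n" "var s ''p'' = P" "var s ''m'' = int m"
    and r: "\<And>i. i \<le> m \<Longrightarrow> arr s ''r'' i = q ^ (2 ^ i) mod P"
    and n: "0 < n" "2 * n \<le> 2 ^ m" and P: "prime P" "odd P" and root: "root_mod P (2 ^ m) q"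
    and W: "P * P + P \<le> W" "8 * int n + 2 \<le> W" "int m < W"
    and a: "\<And>i. i < n \<Longrightarrow> \<bar>arr s ''a'' i\<bar> \<le> W" and b: "\<And>i. i < n \<Longrightarrow> \<bar>arr s ''b'' i\<bar> \<le> W"
  shows "runs W conv_com s (conv_time n) (\<lambda>s'. unchanged conv_com s s' \<and>
    (\<forall>k < 2 * n. [arr s' ''c'' k = conv_coeff n (arr s ''a'') (arr s ''b'') k] (mod P)))"
proof (rule runs_frame)
  define j where "j = level n"
  define M where "M = (2::nat) ^ j"
  have jm: "j \<le> m" unfolding j_def using n level_le by blast
  have M: "2 * n \<le> M" "M < 4 * n" "0 < M"
    unfolding M_def j_def using level_ge two_power_level_less n by auto
  have MW: "2 * int M + 2 \<le> W" using M(2) W(2) by linarith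
  have p1: "1 < P" using P(1) by (rule prime_gt_1_int)
  have PW: "2 * P \<le> P * P" using p1 by (intro mult_right_mono) auto
  have PW': "P < W" using PW W(1) p1 by linarith
  have nW: "int n < W" "int M < W" using MW M by linarith+
  \<comment> \<open>The table entry for this length. It is only congruent to the power of
    \<open>q\<close>, but being a primitive root depends on the residue class alone.\<close>
  define x where "x = q ^ (2 ^ (m - j)) mod P"
  have x: "0 \<le> x" "x < P" unfolding x_def using p1 by simp_all
  have rx: "root_mod P M x"
    unfolding M_def by (rule root_mod_cong[OF root_mod_power[OF root jm]]) (simp add: x_def cong_def)
  let ?a = "arr s ''a''" and ?b = "arr s ''b''"
  define F where "F = (j + 1) * (M + 1)"
  have F: "M + 1 \<le> F" "n + 1 \<le> F" "20 * (j + 1) \<le> 20 * F" "1 \<le> F"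
    unfolding F_def using M by (auto simp: algebra_simps)
  show "runs W conv_com s (conv_time n)
    (\<lambda>s'. \<forall>k<2 * n. [arr s' ''c'' k = conv_coeff n ?a ?b k] (mod P))"
    unfolding conv_com_def
  proof (rule runs_SeqI[where u = "20 * F" and v = "900 * F" and
        R = "\<lambda>s'. var s' ''M'' = int M \<and> var s' ''j'' = int j"], goal_cases)
    case 1
    show ?case
      by (rule runs_pow2_com[OF vars(1)])
         (use n W F in \<open>auto simp: M_def j_def\<close>)
  next
    case (2 s1)
    note u1 = unchanged_var[OF 2(2)] unchanged_arr[OF 2(2)]
    have v1: "var s1 ''M'' = int M" "var s1 ''p'' = P" "var s1 ''j'' = int j" "var s1 ''m'' = int m" "var s1 ''n'' = int n"
      "arr s1 ''r'' = arr s ''r''" "arr s1 ''a'' = ?a" "arr s1 ''b'' = ?b"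
      using 2(1) u1 vars by simp_all
    show ?case
    proof (rule runs_SeqI[where u = "26 * F" and v = "800 * F" and
          R = "\<lambda>s'. \<forall>k < n. arr s' ''A'' k = arr s1 ''a'' k mod P"], goal_cases)
      case 1
      show ?case by (rule runs_fill_reduced[where n = n])
        (use v1 a PW' nW p1 F in auto)
    next
      case (2 s2)
      note u2 = unchanged_var[OF 2(2)] unchanged_arr[OF 2(2)]
      have v2: "var s2 ''M'' = int M" "var s2 ''p'' = P" "var s2 ''j'' = int j" "var s2 ''m'' = int m" "var s2 ''n'' = int n"
        "arr s2 ''r'' = arr s ''r''" "arr s2 ''a'' = ?a" "arr s2 ''b'' = ?b" "\<forall>k < n. arr s2 ''A'' k = ?a k mod P"
        using 2(1) u2 v1 by simp_all
      show ?case
      proof (rule runs_SeqI[where u = "26 * F" and v = "700 * F" and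
            R = "\<lambda>s'. \<forall>k. arr s' ''A'' k = (if n \<le> k \<and> k < M then 0 else arr s2 ''A'' k)"], goal_cases)
        case 1
        show ?case by (rule runs_fill_zero[where n = n and M = M])
          (use v2 M nW F in auto)
      next
        case (2 s3)
        note u3 = unchanged_var[OF 2(2)] unchanged_arr[OF 2(2)]
        have v3: "var s3 ''M'' = int M" "var s3 ''p'' = P" "var s3 ''j'' = int j" "var s3 ''m'' = int m" "var s3 ''n'' = int n"
          "arr s3 ''r'' = arr s ''r''" "arr s3 ''a'' = ?a" "arr s3 ''b'' = ?b"
          "\<forall>i < M. arr s3 ''A'' i = (if i < n then ?a i mod P else 0)"
          using 2(1) u3 v2 by simp_all
        show ?case
        proof (rule runs_SeqI[where u = "26 * F" and v = "600 * F" and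
              R = "\<lambda>s'. \<forall>k < n. arr s' ''B'' k = arr s3 ''b'' k mod P"], goal_cases)
          case 1
          show ?case
            by (rule runs_weaken[OF runs_fill_reduced[where n = n and P = P and t = "26 * (n + 1)"]])
               (use v3 b PW' nW p1 F in auto)
        next
          case (2 s4)
          note u4 = unchanged_var[OF 2(2)] unchanged_arr[OF 2(2)]
          have v4: "var s4 ''M'' = int M" "var s4 ''p'' = P" "var s4 ''j'' = int j" "var s4 ''m'' = int m" "var s4 ''n'' = int n"
            "arr s4 ''r'' = arr s ''r''" "arr s4 ''a'' = ?a" "arr s4 ''b'' = ?b"
            "\<forall>i < M. arr s4 ''A'' i = (if i < n then ?a i mod P else 0)" "\<forall>k < n. arr s4 ''B'' k = ?b k mod P"
            using 2(1) u4 v3 by simp_all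
          show ?case
          proof (rule runs_SeqI[where u = "26 * F" and v = "500 * F" and
                R = "\<lambda>s'. \<forall>k. arr s' ''B'' k = (if n \<le> k \<and> k < M then 0 else arr s4 ''B'' k)"], goal_cases)
            case 1
            show ?case
              by (rule runs_weaken[OF runs_fill_zero[where n = n and M = M and t = "22 * (M + 1)"]])
                 (use v4 M nW F in auto)
          next
            case (2 s5)
            note u5 = unchanged_var[OF 2(2)] unchanged_arr[OF 2(2)]
            have v5: "var s5 ''M'' = int M" "var s5 ''p'' = P" "var s5 ''j'' = int j" "var s5 ''m'' = int m" "var s5 ''n'' = int n"
              "arr s5 ''r'' = arr s ''r''" "arr s5 ''a'' = ?a" "arr s5 ''b'' = ?b"
              "\<forall>i < M. arr s5 ''A'' i = (if i < n then ?a i mod P else 0)"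
              "\<forall>i < M. arr s5 ''B'' i = (if i < n then ?b i mod P else 0)"
              using 2(1) u5 v4 by simp_all
            have o: "aval (Elem ''r'' (Var ''m'' -\<^sub>e Var ''j'')) s5 = x"
              using v5 r[of "m - j"] jm by (simp add: x_def nat_diff_distrib')
            show ?case
            proof (rule runs_Assign_Seq[where u = "490 * F"], goal_cases)
              case 1
              have "asafe W (Var ''m'' -\<^sub>e Var ''j'') s5 \<and> 0 \<le> aval (Var ''m'' -\<^sub>e Var ''j'') s5"
                using v5 jm W(3) by simp
              moreover have "\<bar>aval (Elem ''r'' (Var ''m'' -\<^sub>e Var ''j'')) s5\<bar> \<le> W"
                unfolding o using x PW W(1) by linarith
              ultimately show ?case unfolding asafe.simps(3) by blast
            next
              case 2
              show ?case unfolding o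
              proof (rule runs_Store_Seq[where u = "440 * F"], goal_cases)
                case 4
                show ?case
                  by (rule runs_weaken[OF runs_multiply_com[where n = n and M = M and j = j and P = P and z = x and
                        a = ?a and b = ?b and t = "440 * F"]])
                     (use v5 M n P rx x W MW in \<open>auto simp: M_def F_def algebra_simps\<close>)
              qed (use MW F in auto)
            qed (use F in auto)
          qed simp
        qed simp
      qed simp
    qed simp
  qed (simp add: conv_time_def j_def M_def F_def algebra_simps)
qed simp

section \<open>Number theory of the precomputation\<close>

lemma prod_primes_dvd:
  fixes n :: nat
  assumes "finite S" "\<And>l. l \<in> S \<Longrightarrow> prime l \<and> l dvd n"
  shows "\<Prod>S dvd n"
  using assms
proof (induction S rule: finite_induct)
  case (insert l S)
  have "coprime l (\<Prod>S)"
    using insert by (intro prod_coprime_right) (metis insertCI primes_coprime)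
  thus ?case using insert by (simp add: divides_mult)
qed simp

text \<open>Chebyshev's argument with \<open>n = 2 ^ k\<close>: a prime in the block divides
  \<open>(2 * n)!\<close> but not \<open>n!\<close>. The product of these primes exceeds neither the
  binomial coefficient nor \<open>2 ^ (2 * n)\<close>; as each of them is at least
  \<open>2 ^ k\<close>, comparing exponents counts them.\<close>

lemma card_dyadic_primes: "k * card {l::nat. prime l \<and> 2 ^ k < l \<and> l \<le> 2 ^ Suc k} \<le> 2 ^ Suc k"
proof -
  define n where "n = (2::nat) ^ k"
  let ?S = "{l::nat. prime l \<and> n < l \<and> l \<le> 2 * n}"
  have fin: "finite ?S" by (rule finite_subset[of _ "{..2 * n}"]) auto
  have "l dvd (2 * n choose n)" if "l \<in> ?S" for l
  proof -
    have l: "prime l" "n < l" "l \<le> 2 * n" using that by auto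
    have "fact n * fact (2 * n - n) * (2 * n choose n) = (fact (2 * n) :: nat)"
      by (rule binomial_fact_lemma) simp
    moreover have "l dvd fact (2 * n)" "\<not> l dvd fact n"
      using l by (simp_all add: prime_dvd_fact_iff)
    ultimately show ?thesis
      using l(1) by (metis add_diff_cancel_left' mult_2 prime_dvd_mult_iff)
  qed
  hence "\<Prod>?S dvd (2 * n choose n)" using fin by (intro prod_primes_dvd) auto
  hence "\<Prod>?S \<le> (2 * n choose n)" by (rule dvd_imp_le) (simp add: zero_less_binomial)
  also have "\<dots> \<le> 2 ^ (2 * n)" by (rule binomial_le_pow2)
  finally have "\<Prod>?S \<le> 2 ^ (2 * n)" .
  moreover have "(\<Prod>l\<in>?S. 2 ^ k) \<le> \<Prod>?S" by (rule prod_mono) (auto simp: n_def)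
  hence "2 ^ (k * card ?S) \<le> \<Prod>?S" by (simp add: power_mult)
  ultimately have "(2::nat) ^ (k * card ?S) \<le> 2 ^ (2 * n)" by (rule order_trans[rotated])
  thus ?thesis by (simp add: n_def)
qed

text \<open>The primes between \<open>2 ^ k\<close> and \<open>2 ^ (k + 1)\<close> number at most
  \<open>2 ^ (k + 1) / k\<close>, and each contributes at most \<open>1 / 2 ^ k\<close>, so a block
  adds at most \<open>2 / k\<close>. The summand \<open>1 / 2\<close> is the prime 2.\<close>

lemma sum_inverse_primes_harm:
  "(\<Sum>l | prime l \<and> l \<le> 2 ^ Suc J. 1 / real l) \<le> 1 / 2 + 2 * harm J"
proof (induction J)
  case 0
  have "{l::nat. prime l \<and> l \<le> 2 ^ Suc 0} = {2}"
    using prime_ge_2_nat by (auto simp: le_antisym)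
  thus ?case by (simp add: harm_def)
next
  case (Suc J)
  define A where "A = {l::nat. prime l \<and> l \<le> 2 ^ Suc J}"
  define S where "S = {l::nat. prime l \<and> 2 ^ Suc J < l \<and> l \<le> 2 ^ Suc (Suc J)}"
  have "{l::nat. prime l \<and> l \<le> 2 ^ Suc (Suc J)} = A \<union> S" by (auto simp: A_def S_def)
  moreover have "finite A" "finite S" unfolding A_def S_def
    by (rule finite_subset[of _ "{..2 ^ Suc (Suc J)}"]; auto)+
  moreover have "A \<inter> S = {}" by (auto simp: A_def S_def)
  ultimately have "(\<Sum>l | prime l \<and> l \<le> 2 ^ Suc (Suc J). 1 / real l) =
      (\<Sum>l\<in>A. 1 / real l) + (\<Sum>l\<in>S. 1 / real l)"
    by (simp add: sum.union_disjoint)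
  moreover have "(\<Sum>l\<in>S. 1 / real l) \<le> 2 * inverse (real (Suc J))"
  proof -
    have "(\<Sum>l\<in>S. 1 / real l) \<le> (\<Sum>l\<in>S. 1 / 2 ^ Suc J)"
    proof (rule sum_mono)
      fix l assume "l \<in> S"
      hence "(2::nat) ^ Suc J \<le> l" by (simp add: S_def)
      hence "(2::real) ^ Suc J \<le> real l" by (metis of_nat_le_iff of_nat_numeral of_nat_power)
      thus "1 / real l \<le> 1 / 2 ^ Suc J" by (rule divide_left_mono) (use \<open>l \<in> S\<close> in \<open>auto simp: S_def\<close>)
    qed
    also have "\<dots> = real (card S) / 2 ^ Suc J" by simp
    also have "\<dots> \<le> 2 * inverse (real (Suc J))"
    proof -
      have "Suc J * card S \<le> 2 ^ Suc (Suc J)"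
        using card_dyadic_primes[of "Suc J"] by (simp only: S_def)
      hence "real (Suc J * card S) \<le> real (2 ^ Suc (Suc J))"
        by (simp only: of_nat_le_iff)
      hence "real (card S) * real (Suc J) \<le> 2 * 2 ^ Suc J" by (simp add: algebra_simps)
      moreover have "c / x \<le> 2 * inverse y" if "c * y \<le> 2 * x" "0 < x" "0 < y" for c x y :: real
        using that by (simp add: field_simps)
      ultimately show ?thesis by simp
    qed
    finally show ?thesis .
  qed
  ultimately show ?case using Suc by (simp add: harm_Suc A_def)
qed

lemma sum_inverse_primes:
  assumes "0 < J" "L \<le> 2 ^ Suc J"
  shows "(\<Sum>l | prime l \<and> l < L. 1 / real l) \<le> 3 + 2 * ln (real J)"
proof -
  have "(\<Sum>l | prime l \<and> l < L. 1 / real l) \<le> (\<Sum>l | prime l \<and> l \<le> 2 ^ Suc J. 1 / real l)"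
  proof (rule sum_mono2)
    show "finite {l::nat. prime l \<and> l \<le> 2 ^ Suc J}" by (rule finite_subset[of _ "{..2 ^ Suc J}"]) auto
  qed (use assms(2) in auto)
  also have "\<dots> \<le> 1 / 2 + 2 * harm J" by (rule sum_inverse_primes_harm)
  \<comment> \<open>The difference of \<open>harm J\<close> and \<open>ln J\<close> decreases and
    has the value 1 at \<open>J = 1\<close>.\<close>
  also have "harm J \<le> 1 + ln (real J)"
    using euler_mascheroni_sequence_decreasing[of 1 J] assms(1) by (simp add: harm_expand)
  finally show ?thesis by simp
qed

text \<open>The smaller of two proper factors is below \<open>L\<close>, and so is its prime factor.
  The exception \<open>r = n\<close> is essential for the sieve: a prime candidate may itself be
  smaller than \<open>L\<close>.\<close>

lemma prime_if_no_small_factor: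
  fixes n L :: nat
  assumes "1 < n" "n < L * L" "\<And>r. prime r \<Longrightarrow> r < L \<Longrightarrow> r dvd n \<Longrightarrow> r = n"
  shows "prime n"
proof (rule ccontr)
  assume "\<not> prime n"
  then obtain a where a: "a dvd n" "a \<noteq> 1" "a \<noteq> n"
    using assms(1) by (auto simp: prime_nat_iff)
  then obtain b where b: "n = a * b" by blast
  have ab: "n = a * b" "1 < a" "1 < b"
    using a(2,3) assms(1) b by (cases a; cases b; auto)+
  define c where "c = min a b"
  have c: "c dvd n" "1 < c" using ab by (auto simp: c_def min_def)
  have "c * c \<le> a * b" unfolding c_def by (intro mult_mono) auto
  hence "c * c < L * L" using ab assms(2) by simp
  hence "c < L" by (metis leD leI mult_le_mono)
  obtain r where r: "prime r" "r dvd c" using c(2) prime_factor_nat[of c] by auto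
  have "r \<le> c" using r(2) c(2) by (intro dvd_imp_le) auto
  moreover have "r dvd n" using r(2) c(1) by (rule dvd_trans)
  ultimately have "r = n" using assms(3)[OF r(1)] \<open>c < L\<close> by simp
  thus False using r(1) \<open>\<not> prime n\<close> by simp
qed

text \<open>Euler's criterion in the form that the program tests, with \<open>p - 1\<close> as the
  representative of -1. As \<open>p\<close> exceeds 2, this differs from the values 0 and 1 that
  belong to squares.\<close>

lemma nonresidue_power:
  fixes p a :: nat
  assumes "prime p" "2 < p"
  shows "a ^ ((p - 1) div 2) mod p = p - 1 \<longleftrightarrow> \<not> QuadRes (int p) (int a)"
proof -
  have euler: "[Legendre (int a) (int p) = int (a ^ ((p - 1) div 2))] (mod int p)"
    using euler_criterion[OF assms, of "int a"] by simp
  have iff: "a ^ ((p - 1) div 2) mod p = p - 1 \<longleftrightarrow> [int (a ^ ((p - 1) div 2)) = - 1] (mod int p)"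
  proof -
    have "[- 1 = int (p - 1)] (mod int p)"
      using assms by (simp add: cong_iff_dvd_diff of_nat_diff)
    hence "[int (a ^ ((p - 1) div 2)) = - 1] (mod int p) \<longleftrightarrow>
        [int (a ^ ((p - 1) div 2)) = int (p - 1)] (mod int p)"
      using cong_trans cong_sym by blast
    also have "\<dots> \<longleftrightarrow> [a ^ ((p - 1) div 2) = p - 1] (mod p)" by (rule cong_int_iff)
    finally show ?thesis using assms by (simp add: cong_def)
  qed
  show ?thesis
  proof
    assume "\<not> QuadRes (int p) (int a)"
    moreover from this have "\<not> [int a = 0] (mod int p)"
      unfolding QuadRes_def by (metis cong_sym power_zero_numeral)
    ultimately have "Legendre (int a) (int p) = - 1" by (simp add: Legendre_def)
    thus "a ^ ((p - 1) div 2) mod p = p - 1" unfolding iff using euler cong_sym by metis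
  next
    assume "a ^ ((p - 1) div 2) mod p = p - 1"
    hence *: "[Legendre (int a) (int p) = - 1] (mod int p)"
      unfolding iff using euler cong_trans by blast
    show "\<not> QuadRes (int p) (int a)"
    proof
      assume "QuadRes (int p) (int a)"
      hence "Legendre (int a) (int p) \<in> {0, 1}" by (simp add: Legendre_def)
      with * have "int p dvd 1 \<or> int p dvd 2" by (auto simp: cong_iff_dvd_diff)
      thus False using assms zdvd_imp_le[of "int p" 2] zdvd_imp_le[of "int p" 1] by auto
    qed
  qed
qed

text \<open>A primitive root is a nonresidue: otherwise, by Euler's criterion, its order
  \<open>p - 1\<close> would divide \<open>(p - 1) div 2\<close>.\<close>

lemma nonresidue_exists:
  assumes "prime p" "2 < p"
  shows "\<exists>a<p. \<not> QuadRes (int p) (int a)"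
proof -
  obtain a where a: "a \<in> totatives p" "ord p a = p - 1"
    using residue_prime_has_primroot[OF assms(1)] by blast
  have "a < p" by (rule totatives_less[OF a(1)]) (use assms in simp)
  moreover have "\<not> QuadRes (int p) (int a)"
  proof
    assume Q: "QuadRes (int p) (int a)"
    have "coprime a p" using a(1) by (simp add: totatives_def)
    hence "\<not> p dvd a" using coprime_common_divisor[of a p p] assms by auto
    hence "\<not> [int a = 0] (mod int p)" by (simp add: cong_0_iff)
    hence "Legendre (int a) (int p) = 1" using Q by (simp add: Legendre_def)
    hence "[int (a ^ ((p - 1) div 2)) = int 1] (mod int p)"
      using euler_criterion[OF assms, of "int a"] cong_sym by simp
    hence "[a ^ ((p - 1) div 2) = 1] (mod p)" by (simp only: cong_int_iff)
    hence "p - 1 dvd (p - 1) div 2" using a(2) by (simp only: ord_divides)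
    moreover have "0 < (p - 1) div 2" "(p - 1) div 2 < p - 1" using assms by auto
    ultimately show False by (simp add: nat_dvd_not_less)
  qed
  ultimately show ?thesis by blast
qed

lemma least_nonresidue:
  assumes "prime p" "2 < p"
  shows "\<not> QuadRes (int p) (int (least_nonresidue p))" "least_nonresidue p < p" "1 < least_nonresidue p"
    "a < least_nonresidue p \<Longrightarrow> QuadRes (int p) (int a)"
proof -
  obtain b where b: "b < p" "\<not> QuadRes (int p) (int b)" using nonresidue_exists[OF assms] by blast
  show *: "\<not> QuadRes (int p) (int (least_nonresidue p))"
    unfolding least_nonresidue_def using b(2) by (rule LeastI)
  have "least_nonresidue p \<le> b"
    unfolding least_nonresidue_def using b(2) by (rule Least_le)
  thus "least_nonresidue p < p" using b(1) by simp
  show "QuadRes (int p) (int a)" if "a < least_nonresidue p" for a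
    using that not_less_Least unfolding least_nonresidue_def by blast
  have "QuadRes (int p) (int 0)" "QuadRes (int p) (int 1)"
    unfolding QuadRes_def by (rule exI[of _ 0], simp) (rule exI[of _ 1], simp)
  hence "least_nonresidue p \<noteq> 0" "least_nonresidue p \<noteq> 1" using * by metis+
  thus "1 < least_nonresidue p" by simp
qed

text \<open>With \<open>q = a ^ k\<close>, the power \<open>q ^ (2 ^ (m - 1))\<close> is
  \<open>a ^ ((p - 1) div 2)\<close>, that is -1. Squaring shows that the order of \<open>q\<close>
  divides \<open>2 ^ m\<close>, and a smaller power of two would divide \<open>2 ^ (m - 1)\<close>
  and give 1 instead of -1.\<close>

lemma ord_nonresidue_power:
  assumes p: "prime p" "2 < p" "p = k * 2 ^ m + 1" and "0 < m" and a: "\<not> QuadRes (int p) (int a)"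
  shows "ord p (a ^ k mod p) = 2 ^ m"
proof -
  have half: "(p - 1) div 2 = k * 2 ^ (m - 1)" using p(3) \<open>0 < m\<close> by (cases m) auto
  have h: "(a ^ k) ^ (2 ^ (m - 1)) mod p = p - 1"
    using nonresidue_power[OF p(1,2), of a] a unfolding half power_mult by simp
  have "[((a ^ k) ^ (2 ^ (m - 1)))\<^sup>2 = (p - 1)\<^sup>2] (mod p)"
    by (intro cong_pow) (use h p(2) in \<open>simp add: cong_def\<close>)
  also have "[(p - 1)\<^sup>2 = 1] (mod p)"
  proof -
    obtain c where "p = c + 2" using p(2) by (metis add.commute less_imp_add_positive)
    hence "(p - 1)\<^sup>2 = p * (p - 2) + 1" by (simp add: power2_eq_square)
    thus ?thesis by (simp add: cong_0_iff cong_add_rcancel_0_nat del: One_nat_def)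
  qed
  also have "((a ^ k) ^ (2 ^ (m - 1)))\<^sup>2 = (a ^ k) ^ (2 ^ m)"
    using \<open>0 < m\<close> by (cases m) (simp_all add: power_mult[symmetric] mult.commute mult.left_commute)
  finally have "ord p (a ^ k) dvd 2 ^ m" by (simp only: ord_divides)
  then obtain i where i: "i \<le> m" "ord p (a ^ k) = 2 ^ i"
    using divides_primepow_nat two_is_prime_nat by blast
  have "i = m"
  proof (rule ccontr)
    assume "i \<noteq> m"
    hence "(2::nat) ^ i dvd 2 ^ (m - 1)" using i(1) by (intro le_imp_power_dvd) simp
    hence "[(a ^ k) ^ (2 ^ (m - 1)) = 1] (mod p)" by (simp only: ord_divides i(2))
    thus False using h p(2) by (simp add: cong_def)
  qed
  thus ?thesis using i by simp
qed

lemma root_mod_ord: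
  assumes "ord p q = M" "0 < M"
  shows "root_mod (int p) M (int q)"
proof -
  have "[int q ^ d = 1] (mod int p) \<longleftrightarrow> [q ^ d = 1] (mod p)" for d
    using cong_int_iff[of "q ^ d" 1 p] by simp
  thus ?thesis
    using ord_works[of q p] assms unfolding root_mod_def by simp
qed

section \<open>The size of the modulus\<close>

definition dyadic_multiplier :: "nat \<Rightarrow> nat" where
  "dyadic_multiplier m = (LEAST k. 1 \<le> k \<and> prime (k * 2 ^ m + 1))"

lemma dyadic_prime_exists:
  assumes bach_sorenson_bound "2 \<le> m"
  shows "\<exists>k. 1 \<le> k \<and> k < 2 ^ m * m * m \<and> prime (k * 2 ^ m + 1)"
proof -
  define M where "M = (2::nat) ^ m"
  have "4 \<le> M" unfolding M_def using power_increasing[OF assms(2), of "2::nat"] by simp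
  then obtain p where p: "prime p" "[p = 1] (mod M)" "real p < 2 * (real M * ln (real M))\<^sup>2"
    using assms(1) unfolding bach_sorenson_bound_def by (metis coprime_1_right le_trans numeral_le_iff semiring_norm(68) semiring_norm(71))
  have "p > 1" using p(1) by (rule prime_gt_1_nat)
  have "M dvd p - 1" using p(2) by (rule cong_to_1_nat)
  then obtain k where k: "p - 1 = M * k" by blast
  hence pk: "p = k * M + 1" using \<open>p > 1\<close> by (simp add: mult.commute)
  have "1 \<le> k" using pk \<open>p > 1\<close> by (cases k) auto
  \<comment> \<open>The estimate \<open>ln 2 \<le> 25 / 36\<close> suffices: twice its square is
    \<open>1250 / 1296\<close>. This lets \<open>ln M = m * ln 2\<close> absorb the factor 2 of the
    Bach-Sorenson bound.\<close>
  have "2 * (ln 2)\<^sup>2 \<le> (1::real)"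
  proof -
    have "(ln 2)\<^sup>2 \<le> (25 / 36 :: real)\<^sup>2" by (intro power_mono ln2_le_25_over_36) simp
    thus ?thesis by (simp add: power2_eq_square)
  qed
  hence "2 * (ln 2)\<^sup>2 * (real M * real m)\<^sup>2 \<le> 1 * (real M * real m)\<^sup>2"
    by (rule mult_right_mono) simp
  moreover have "2 * (real M * ln (real M))\<^sup>2 = 2 * (ln 2)\<^sup>2 * (real M * real m)\<^sup>2"
    by (simp add: M_def ln_realpow power_mult_distrib)
  ultimately have "real p < (real M * real m)\<^sup>2" using p(3) by linarith
  hence "real p < real ((M * m)\<^sup>2)" by simp
  hence "k * M + 1 < (M * m)\<^sup>2" unfolding pk by (simp only: of_nat_less_iff)
  moreover have "(M * m)\<^sup>2 = M * m * m * M" by (simp add: power2_eq_square)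
  ultimately have "k * M < M * m * m * M" by linarith
  hence "k < M * m * m" by (simp only: mult_less_cancel2)
  thus ?thesis using p(1) \<open>1 \<le> k\<close> unfolding pk M_def by blast
qed

lemma dyadic_multiplier:
  assumes bach_sorenson_bound "2 \<le> m"
  defines "k \<equiv> dyadic_multiplier m"
  shows "1 \<le> k" "prime (k * 2 ^ m + 1)" "k < 2 ^ m * m * m"
    "1 \<le> i \<Longrightarrow> i < k \<Longrightarrow> \<not> prime (i * 2 ^ m + 1)"
proof -
  obtain l where l: "1 \<le> l" "l < 2 ^ m * m * m" "prime (l * 2 ^ m + 1)"
    using dyadic_prime_exists[OF assms(1,2)] by blast
  hence "1 \<le> k \<and> prime (k * 2 ^ m + 1)"
    unfolding k_def dyadic_multiplier_def
    by (intro LeastI[of "\<lambda>k. 1 \<le> k \<and> prime (k * 2 ^ m + 1)" l]) auto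
  thus "1 \<le> k" "prime (k * 2 ^ m + 1)" by auto
  have "k \<le> l" unfolding k_def dyadic_multiplier_def using l by (intro Least_le) auto
  thus "k < 2 ^ m * m * m" using l by simp
  show "\<not> prime (i * 2 ^ m + 1)" if "1 \<le> i" "i < k"
    using that not_less_Least[of i "\<lambda>k. 1 \<le> k \<and> prime (k * 2 ^ m + 1)"]
    unfolding k_def dyadic_multiplier_def by blast
qed

section \<open>The precomputation\<close>

definition mark_com :: "string \<Rightarrow> string \<Rightarrow> com" where
  "mark_com A b =
     While (Less (Var ''k'') (Var b))
       (Store A (Var ''k'') (Const 1) ;; Assign ''k'' (Var ''k'' +\<^sub>e Var ''l''))"

lemma wvars_mark_com [simp]: "wvars (mark_com A b) = {''k''}"
  and warrs_mark_com [simp]: "warrs (mark_com A b) = {A}"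
  by (auto simp: mark_com_def)

text \<open>At most \<open>B div l + 1\<close> entries are marked, at cost 11 including the loop
  test. Summed over the sieving primes, these quotients produce the sum of reciprocals.\<close>

lemma runs_mark_com:
  assumes vars: "var s ''k'' = int k" "var s ''l'' = int l" "var s b = int B" and "b \<noteq> ''k''" and l: "0 < l"
    and W: "int B + int l + int k + 1 \<le> W" and t: "11 * (B div l) + 15 \<le> t"
  shows "runs W (mark_com A b) s t (\<lambda>s'. \<forall>j. arr s' A j =
    (if j < B \<and> (\<exists>i. j = k + i * l) then 1 else arr s A j))"
proof -
  \<comment> \<open>The condition on \<open>i - 1\<close> says that the last marked index was below
    \<open>B\<close>. It limits the overshoot of the running index to \<open>l\<close>, which keeps
    it within a word, and at the exit it shows that nothing beyond \<open>B\<close> was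
    marked.\<close>
  define I where "I u s' \<longleftrightarrow> (\<exists>i. i \<le> B div l + 1 \<and> (0 < i \<longrightarrow> k + (i - 1) * l < B) \<and> u = (B div l + 1 - i) * 11 \<and>
      var s' ''k'' = int (k + i * l) \<and> var s' ''l'' = int l \<and> var s' b = int B \<and>
      (\<forall>j. arr s' A j = (if \<exists>h<i. j = k + h * l then 1 else arr s A j)))" for u and s' :: state
  let ?b = "Less (Var ''k'') (Var b)"
  let ?c = "Store A (Var ''k'') (Const 1) ;; Assign ''k'' (Var ''k'' +\<^sub>e Var ''l'')"
  show ?thesis
    unfolding mark_com_def
  proof (rule runs_While[where I = I])
    show "I ((B div l + 1) * 11) s"
      unfolding I_def using vars by (intro exI[of _ 0]) auto
  next
    fix u s' assume "I u s'"
    then obtain i where i: "0 < i \<longrightarrow> k + (i - 1) * l < B"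
      "var s' ''k'' = int (k + i * l)" "var s' b = int B"
      unfolding I_def by blast
    have "k + i * l \<le> B + l + k" using i(1) by (cases i) auto
    hence "int (k + i * l) \<le> W" using W by linarith
    thus "bsafe W ?b s'" using i W by simp
  next
    fix u s' assume "I u s'" "bval ?b s'"
    then obtain i where i: "i \<le> B div l + 1" "u = (B div l + 1 - i) * 11"
      "var s' ''k'' = int (k + i * l)" "var s' ''l'' = int l" "var s' b = int B"
      and A: "\<And>j. arr s' A j = (if \<exists>h<i. j = k + h * l then 1 else arr s A j)"
      unfolding I_def by blast
    have "int (k + i * l) < int B" using \<open>bval ?b s'\<close> i by simp
    hence lt: "k + i * l < B" by (simp only: of_nat_less_iff)
    have "i * l \<le> B" using lt by simp
    hence "i \<le> B div l" using l by (simp add: less_eq_div_iff_mult_less_eq)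
    hence "B div l + 1 - i = Suc (B div l + 1 - Suc i)" by simp
    hence u: "(B div l + 1 - Suc i) * 11 + 7 + 1 + bcost ?b \<le> u" using i by simp
    have le: "int (k + i * l) + int l \<le> W" "int (k + i * l) \<le> W" using lt W by linarith+
    have nat: "nat (int k + int i * int l) = k + i * l"
      by (metis nat_int of_nat_add of_nat_mult)
    have "runs W ?c s' 7 (\<lambda>s''. I ((B div l + 1 - Suc i) * 11) s'')"
    proof (intro runs_Store_Seq[where u = 4] runs_Assign, goal_cases)
      case 6
      show ?case unfolding I_def using i lt \<open>i \<le> B div l\<close> \<open>b \<noteq> ''k''\<close>
        by (intro exI[of _ "Suc i"]) (auto simp: A nat less_Suc_eq algebra_simps)
    qed (use i le W in auto)
    hence "runs W ?c s' 7 (\<lambda>s''. \<exists>u'. I u' s'' \<and> u' + 7 + 1 + bcost ?b \<le> u)"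
      by (rule runs_weaken) (use u in auto)
    thus "\<exists>v. runs W ?c s' v (\<lambda>s''. \<exists>u'. I u' s'' \<and> u' + v + 1 + bcost ?b \<le> u)" by blast
  next
    fix u s' assume "I u s'" "\<not> bval ?b s'"
    then obtain i where i: "0 < i \<longrightarrow> k + (i - 1) * l < B" "var s' ''k'' = int (k + i * l)" "var s' b = int B"
      and A: "\<And>j. arr s' A j = (if \<exists>h<i. j = k + h * l then 1 else arr s A j)"
      unfolding I_def by blast
    have "int B \<le> int (k + i * l)" using \<open>\<not> bval ?b s'\<close> i by simp
    hence ge: "B \<le> k + i * l" by (simp only: of_nat_le_iff)
    have "(\<exists>h<i. j = k + h * l) \<longleftrightarrow> j < B \<and> (\<exists>i. j = k + i * l)" for j
    proof
      assume "\<exists>h<i. j = k + h * l"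
      then obtain h where h: "h < i" "j = k + h * l" by blast
      hence "h * l \<le> (i - 1) * l" by (intro mult_right_mono) auto
      moreover have "k + (i - 1) * l < B" using h(1) i(1) by simp
      ultimately have "j < B" using h(2) by linarith
      thus "j < B \<and> (\<exists>i. j = k + i * l)" using h by blast
    next
      assume "j < B \<and> (\<exists>i. j = k + i * l)"
      then obtain h where h: "j = k + h * l" "j < B" by blast
      hence "h * l < i * l" using ge by linarith
      hence "h < i" by simp
      with h show "\<exists>h<i. j = k + h * l" by blast
    qed
    thus "\<forall>j. arr s' A j = (if j < B \<and> (\<exists>i. j = k + i * l) then 1 else arr s A j)"
      using A by simp
  qed (use t in simp)
qed

lemma runs_Cond_else_Skip:
  assumes "bsafe W b s" "bval b s \<Longrightarrow> runs W c s u Q" "\<not> bval b s \<Longrightarrow> Q s"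
    "2 + bcost b + (if bval b s then u else 0) \<le> t"
  shows "runs W (Cond b c Skip) s t Q"
  by (rule runs_Cond[of W b s c u Q Skip 1]) (use assms in \<open>auto intro: runs_Skip split: if_splits\<close>)

text \<open>
  The second loop starts at the least positive \<open>k\<close> for which \<open>l\<close> divides \<open>k * M + 1\<close>, or at the
  next one if this candidate is the prime \<open>l\<close> itself.
\<close>

definition sieve_step_com :: com where
  "sieve_step_com =
     Cond (Both (Equal (Elem ''v'' (Var ''l'')) (Const 0)) (Equal (Var ''l'' mod\<^sub>e Const 2) (Const 1)))
       (Assign ''k'' (Const 2 *\<^sub>e Var ''l'') ;;
        mark_com ''v'' ''L'' ;;
        inv2_com ''l'' ''m'' ;;
        Assign ''k'' (Var ''l'' -\<^sub>e Var ''z'') ;;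
        Cond (Equal (Var ''k'' *\<^sub>e Var ''M'' +\<^sub>e Const 1) (Var ''l'')) (Assign ''k'' (Var ''k'' +\<^sub>e Var ''l'')) Skip ;;
        mark_com ''w'' ''K'')
       Skip"

lemma wvars_sieve_step_com [simp]: "wvars sieve_step_com = {''k'', ''z'', ''i''}"
  and warrs_sieve_step_com [simp]: "warrs sieve_step_com = {''v'', ''w''}"
  by (auto simp: sieve_step_com_def)

text \<open>\<open>v\<close> is a sieve of Eratosthenes that supplies the primes \<open>l\<close>,
  and \<open>w\<close> is the sieve of the candidates \<open>k * 2 ^ m + 1\<close>. The conditions
  \<open>r < j\<close> and \<open>r \<noteq> k * 2 ^ m + 1\<close> keep a prime from striking itself
  out. The prime 2 is left out since the candidates are odd; even \<open>l\<close> are rejected by a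
  separate parity test.\<close>

definition sieve_inv :: "nat \<Rightarrow> nat \<Rightarrow> state \<Rightarrow> bool" where
  "sieve_inv m l s \<longleftrightarrow>
     var s ''M'' = int (2 ^ m) \<and> var s ''m'' = int m \<and>
     var s ''L'' = int (2 ^ m * m) \<and> var s ''K'' = int (2 ^ m * m * m) \<and>
     (\<forall>j < 2 ^ m * m. arr s ''v'' j = of_bool (\<exists>r. prime r \<and> odd r \<and> r < l \<and> r dvd j \<and> r < j)) \<and>
     (\<forall>k < 2 ^ m * m * m. 1 \<le> k \<longrightarrow>
        arr s ''w'' k = of_bool (\<exists>r. prime r \<and> odd r \<and> r < l \<and> r dvd k * 2 ^ m + 1 \<and> r \<noteq> k * 2 ^ m + 1))"

text \<open>Only a prime \<open>l\<close> pays for marking. Charging the quotients to all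
  \<open>l\<close> would give a harmonic sum of order \<open>m\<close> in place of
  \<open>ln m\<close>.\<close>

definition sieve_cost :: "nat \<Rightarrow> nat \<Rightarrow> nat" where
  "sieve_cost m l =
     (if prime l then 11 * (2 ^ m * m div l) + 11 * (2 ^ m * m * m div l) + 20 * m + 100 else 0) + 20"

lemma odd_prime_factor_exists:
  fixes l :: nat
  assumes "odd l" "1 < l" "\<not> prime l"
  shows "\<exists>r. prime r \<and> odd r \<and> r < l \<and> r dvd l"
proof -
  obtain r where r: "prime r" "r dvd l" using assms(2) prime_factor_nat[of l] by auto
  have "odd r" using r(2) assms(1) dvd_trans by blast
  moreover have "r \<le> l" using r(2) assms(2) by (intro dvd_imp_le) auto
  moreover have "r \<noteq> l" using r(1) assms(3) by blast
  ultimately show ?thesis using r by (metis le_neq_implies_less)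
qed

text \<open>As \<open>z\<close> inverts \<open>M\<close> modulo \<open>l\<close>, it is not 0, and
  \<open>l - z\<close> is the least positive representative of \<open>- 1 / M\<close>. Only this
  first term can produce \<open>l\<close> itself: every later \<open>k\<close> is at least
  \<open>l\<close>, so \<open>k * M + 1\<close> exceeds \<open>l\<close>. Shifting the start by one
  period therefore removes exactly the exception.\<close>

lemma sieved_progression:
  fixes l M z k :: nat
  assumes z: "[M * z = 1] (mod l)" "z < l" and l: "1 < l" and "0 < M" "1 \<le> k"
  defines "k0 \<equiv> (if (l - z) * M + 1 = l then l - z + l else l - z)"
  shows "(\<exists>i. k = k0 + i * l) \<longleftrightarrow> l dvd k * M + 1 \<and> l \<noteq> k * M + 1"
proof -
  have "z \<noteq> 0"
  proof
    assume "z = 0"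
    thus False using z(1) l by (simp add: cong_def)
  qed
  have zl: "(l - z) + z = l" using z(2) by simp
  have cop: "coprime M l"
    using z(1) by (metis coprime_1_left coprime_mult_left_iff cong_imp_coprime cong_sym)
  \<comment> \<open>Adding \<open>M * z\<close> instead of subtracting keeps the computation within
    the natural numbers; it is cancelled again below.\<close>
  have "[((l - z) * M + 1) + (M * z) = 1 + l * M] (mod l)"
  proof -
    have "((l - z) * M + 1) + (M * z) = ((l - z) + z) * M + 1" by (simp add: algebra_simps)
    thus ?thesis unfolding zl by simp
  qed
  moreover have "[1 + l * M = 1] (mod l)" unfolding cong_def by (rule mod_mult_self2)
  ultimately have "[((l - z) * M + 1) + (M * z) = 0 + M * z] (mod l)"
    unfolding add_0 using cong_sym[OF z(1)] cong_trans by blast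
  hence base: "l dvd (l - z) * M + 1"
    using cong_add_rcancel_nat cong_0_iff by blast
  have iff: "l dvd k * M + 1 \<longleftrightarrow> [k = l - z] (mod l)"
  proof -
    have "[(l - z) * M + 1 = 0] (mod l)" using base by (simp only: cong_0_iff)
    hence "[k * M + 1 = 0] (mod l) \<longleftrightarrow> [k * M + 1 = (l - z) * M + 1] (mod l)"
      using cong_trans cong_sym by blast
    also have "\<dots> \<longleftrightarrow> [k * M = (l - z) * M] (mod l)" by (rule cong_add_rcancel_nat)
    also have "\<dots> \<longleftrightarrow> [k = l - z] (mod l)" using cop by (simp add: cong_mult_rcancel_nat)
    finally show ?thesis by (simp only: cong_0_iff)
  qed
  have step: "[k = l - z] (mod l) \<longleftrightarrow> (\<exists>i. k = l - z + i * l)"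
  proof
    assume c: "[k = l - z] (mod l)"
    have "l - z < l" using \<open>z \<noteq> 0\<close> l by simp
    hence "k mod l = l - z" using c by (simp add: cong_def)
    hence "k = l - z + (k div l) * l" by (metis div_mult_mod_eq add.commute)
    thus "\<exists>i. k = l - z + i * l" by blast
  qed (auto simp: cong_def)
  show ?thesis
  proof (cases "(l - z) * M + 1 = l")
    case False
    have "l \<noteq> k * M + 1" if i: "k = l - z + i * l" for i
    proof (cases i)
      case 0
      thus ?thesis using False i by auto
    next
      case (Suc h)
      have "l \<le> k" using i Suc by simp
      hence "l \<le> k * M" using \<open>0 < M\<close> by (metis le_trans mult.commute mult_le_mono1 mult_1 Suc_leI One_nat_def)
      thus ?thesis by simp
    qed
    thus ?thesis using False iff step unfolding k0_def by auto
  next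
    case True
    have "(\<exists>i. k = l - z + l + i * l) \<longleftrightarrow> (\<exists>i. k = l - z + i * l) \<and> l \<noteq> k * M + 1"
    proof
      assume "\<exists>i. k = l - z + l + i * l"
      then obtain i where i: "k = l - z + l + i * l" by blast
      hence "k = l - z + Suc i * l" by simp
      moreover have "l \<le> k" using i by simp
      hence "l \<le> k * M" using \<open>0 < M\<close> by (metis le_trans mult.commute mult_le_mono1 mult_1 Suc_leI One_nat_def)
      ultimately show "(\<exists>i. k = l - z + i * l) \<and> l \<noteq> k * M + 1" by (intro conjI exI[of _ "Suc i"]) auto
    next
      assume "(\<exists>i. k = l - z + i * l) \<and> l \<noteq> k * M + 1"
      then obtain i where i: "k = l - z + i * l" "l \<noteq> k * M + 1" by blast
      hence "i \<noteq> 0" using True by (metis add.right_neutral mult_0)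
      then obtain h where "i = Suc h" by (cases i) auto
      thus "\<exists>i. k = l - z + l + i * l" using i by (intro exI[of _ h]) simp
    qed
    thus ?thesis using True iff step unfolding k0_def by simp
  qed
qed

lemma runs_sieve_step_com:
  assumes inv: "sieve_inv m l s" and l: "var s ''l'' = int l" "3 \<le> l" "l < 2 ^ m * m" and m: "2 \<le> m"
    and W: "4 * (int (2 ^ m * m * m) * 2 ^ m) + 4 \<le> W" and t: "sieve_cost m l \<le> t"
  shows "runs W sieve_step_com s t (sieve_inv m (Suc l))"
proof -
  define M where "M = (2::nat) ^ m"
  define L where "L = M * m"
  define K where "K = L * m"
  have M4: "4 \<le> M" unfolding M_def using power_increasing[OF m, of "2::nat"] by simp
  have MLK: "M \<le> L" "L \<le> K" "m \<le> L" unfolding L_def K_def using m M4 by simp_all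
  have KM: "4 * K \<le> K * M" "L * M \<le> K * M" using M4 MLK by simp_all
  have W': "4 * int (K * M) + 4 \<le> W" using W by (simp add: K_def L_def M_def)
  have lL: "l < L" using l(3) by (simp add: L_def M_def)
  have vars: "var s ''M'' = int M" "var s ''m'' = int m" "var s ''L'' = int L" "var s ''K'' = int K"
    "var s ''l'' = int l"
    and v: "\<And>j. j < L \<Longrightarrow> arr s ''v'' j = of_bool (\<exists>r. prime r \<and> odd r \<and> r < l \<and> r dvd j \<and> r < j)"
    and w: "\<And>k. k < K \<Longrightarrow> 1 \<le> k \<Longrightarrow>
        arr s ''w'' k = of_bool (\<exists>r. prime r \<and> odd r \<and> r < l \<and> r dvd k * M + 1 \<and> r \<noteq> k * M + 1)"
    using inv l(1) unfolding sieve_inv_def M_def L_def K_def by auto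
  have inv_eq: "sieve_inv m (Suc l) s' \<longleftrightarrow> var s' ''M'' = int M \<and> var s' ''m'' = int m \<and>
     var s' ''L'' = int L \<and> var s' ''K'' = int K \<and>
     (\<forall>j < L. arr s' ''v'' j = of_bool (\<exists>r. prime r \<and> odd r \<and> r < Suc l \<and> r dvd j \<and> r < j)) \<and>
     (\<forall>k < K. 1 \<le> k \<longrightarrow>
        arr s' ''w'' k = of_bool (\<exists>r. prime r \<and> odd r \<and> r < Suc l \<and> r dvd k * M + 1 \<and> r \<noteq> k * M + 1))" for s'
    unfolding sieve_inv_def M_def L_def K_def ..
  let ?b = "Both (Equal (Elem ''v'' (Var ''l'')) (Const 0)) (Equal (Var ''l'' mod\<^sub>e Const 2) (Const 1))"
  have vl: "arr s ''v'' l = 0 \<or> arr s ''v'' l = 1" using v[OF lL] by (auto simp: of_bool_def)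
  have "int l \<le> W" "1 \<le> W" "2 \<le> W" using lL MLK KM W' by linarith+
  hence bsafe: "bsafe W ?b s" using vl by (auto simp: vars)
  have "int l mod 2 = 1 \<longleftrightarrow> odd l" by presburger
  hence "bval ?b s \<longleftrightarrow> arr s ''v'' l = 0 \<and> odd l" by (simp add: vars)
  \<comment> \<open>An odd composite \<open>l\<close> has an odd prime factor below
    \<open>l\<close>, by which it was marked in an earlier round.\<close>
  also have "\<dots> \<longleftrightarrow> prime l \<and> odd l"
    using v[OF lL] odd_prime_factor_exists[of l] l(2) by (auto simp: prime_nat_iff)
  also have "\<dots> \<longleftrightarrow> prime l" using l(2) prime_odd_nat[of l] by auto
  finally have bval: "bval ?b s \<longleftrightarrow> prime l" .
  show ?thesis
    unfolding sieve_step_com_def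
  proof (rule runs_Cond_else_Skip[OF bsafe, where u = "sieve_cost m l - 15"])
    assume "\<not> bval ?b s"
    hence np: "\<not> prime l" using bval by blast
    have "r < Suc l \<longleftrightarrow> r < l" if "prime r" for r using that np by (metis less_Suc_eq)
    hence "(\<exists>r. prime r \<and> odd r \<and> r < Suc l \<and> P r) \<longleftrightarrow> (\<exists>r. prime r \<and> odd r \<and> r < l \<and> P r)" for P
      by blast
    thus "sieve_inv m (Suc l) s" unfolding inv_eq using vars v w by simp
  next
    assume "bval ?b s"
    hence pl: "prime l" using bval by blast
    hence ol: "odd l" using l(2) prime_odd_nat[of l] by simp
    have ex: "(\<exists>r. prime r \<and> odd r \<and> r < Suc l \<and> P r) \<longleftrightarrow> (\<exists>r. prime r \<and> odd r \<and> r < l \<and> P r) \<or> P l" for P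
      using pl ol by (auto simp: less_Suc_eq)
    have cost: "sieve_cost m l - 15 = 11 * (L div l) + 11 * (K div l) + 20 * m + 105"
      using pl by (simp add: sieve_cost_def L_def K_def M_def)
    let ?s1 = "s\<lparr>var := (var s)(''k'' := aval (Const 2 *\<^sub>e Var ''l'') s)\<rparr>"
    show "runs W (Assign ''k'' (Const 2 *\<^sub>e Var ''l'') ;;
        mark_com ''v'' ''L'' ;;
        inv2_com ''l'' ''m'' ;;
        Assign ''k'' (Var ''l'' -\<^sub>e Var ''z'') ;;
        Cond (Equal (Var ''k'' *\<^sub>e Var ''M'' +\<^sub>e Const 1) (Var ''l'')) (Assign ''k'' (Var ''k'' +\<^sub>e Var ''l'')) Skip ;;
        mark_com ''w'' ''K'') s (sieve_cost m l - 15) (sieve_inv m (Suc l))"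
      unfolding cost
    proof (rule runs_Assign_Seq[where u = "11 * (L div l) + 11 * (K div l) + 20 * m + 100"], goal_cases)
      case 1
      have "2 * int l \<le> W" using lL MLK KM W' by linarith
      thus ?case using \<open>2 \<le> W\<close> by (simp add: vars)
    next
      case 2
      have k1: "var ?s1 ''k'' = int (2 * l)" "var ?s1 ''l'' = int l" "var ?s1 ''L'' = int L"
        "var ?s1 ''m'' = int m" "var ?s1 ''M'' = int M" "var ?s1 ''K'' = int K" "arr ?s1 = arr s"
        using vars by simp_all
      show ?case
      proof (rule runs_SeqI[where u = "11 * (L div l) + 15" and v = "11 * (K div l) + 20 * m + 85"
            and R = "\<lambda>s'. \<forall>j. arr s' ''v'' j = (if j < L \<and> (\<exists>i. j = 2 * l + i * l) then 1 else arr s ''v'' j)"], goal_cases)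
        case 1
        have "int L + int l + int (2 * l) + 1 \<le> W" using lL MLK KM W' by linarith
        thus ?case
          by (intro runs_weaken[OF runs_mark_com[OF k1(1-3) _ _ _ order_refl]]) (use l(2) in auto)
      next
        case (2 s2)
        note u2 = unchanged_var[OF 2(2)] unchanged_arr[OF 2(2)]
        have k2: "var s2 ''l'' = int l" "var s2 ''m'' = int m" "var s2 ''M'' = int M" "var s2 ''K'' = int K"
          "var s2 ''L'' = int L" "arr s2 ''w'' = arr s ''w''"
          using u2 vars by simp_all
        have v2: "\<forall>j < L. arr s2 ''v'' j = of_bool (\<exists>r. prime r \<and> odd r \<and> r < Suc l \<and> r dvd j \<and> r < j)"
        proof (intro allI impI)
          fix j assume j: "j < L"
          \<comment> \<open>Starting at \<open>2 * l\<close> leaves the prime \<open>l\<close>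
            itself unmarked.\<close>
          have "(\<exists>i. j = 2 * l + i * l) \<longleftrightarrow> l dvd j \<and> l < j"
          proof
            assume "\<exists>i. j = 2 * l + i * l"
            thus "l dvd j \<and> l < j" using l(2) by auto
          next
            assume "l dvd j \<and> l < j"
            then obtain h where h: "j = l * h" "l < j" by blast
            hence "2 \<le> h" by (cases h; cases "h - 1") auto
            then obtain i where "h = 2 + i" using le_Suc_ex by blast
            thus "\<exists>i. j = 2 * l + i * l" using h by (auto simp: algebra_simps)
          qed
          thus "arr s2 ''v'' j = of_bool (\<exists>r. prime r \<and> odd r \<and> r < Suc l \<and> r dvd j \<and> r < j)"
            unfolding ex using 2(1) j v[OF j] by auto
        qed
        show ?case
        proof (rule runs_SeqI[where u = "20 * (m + 1)" and v = "11 * (K div l) + 65"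
              and R = "\<lambda>s'. [2 ^ m * var s' ''z'' = 1] (mod (int l)) \<and> 0 \<le> var s' ''z'' \<and> var s' ''z'' < int l"], goal_cases)
          case 1
          have "2 * int l \<le> W" "int m < W" using lL MLK KM W' by linarith+
          thus ?case using l(2) ol by (intro runs_inv2_com[where k = m, OF k2(1) _ _ k2(2)]) auto
        next
          case (2 s3)
          note u3 = unchanged_var[OF 2(2)] unchanged_arr[OF 2(2)]
          have k3: "var s3 ''l'' = int l" "var s3 ''m'' = int m" "var s3 ''M'' = int M" "var s3 ''K'' = int K"
            "var s3 ''L'' = int L" "arr s3 ''w'' = arr s ''w''" "arr s3 ''v'' = arr s2 ''v''"
            using u3 k2 by simp_all
          obtain z where z: "var s3 ''z'' = int z" "z < l"
            using 2(1) by (metis nonneg_int_cases of_nat_less_iff)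
          have "[int (M * z) = int 1] (mod (int l))" using 2(1) by (simp add: M_def z(1))
          hence mz: "[M * z = 1] (mod l)" by (simp only: cong_int_iff)
          define k0 where "k0 = (if (l - z) * M + 1 = l then l - z + l else l - z)"
          have k0: "k0 \<le> 2 * l" unfolding k0_def by simp linarith
          let ?s4 = "s3\<lparr>var := (var s3)(''k'' := aval (Var ''l'' -\<^sub>e Var ''z'') s3)\<rparr>"
          have k4: "var ?s4 ''k'' = int (l - z)" using k3 z by simp
          show ?case
          proof (rule runs_Assign_Seq[where u = "11 * (K div l) + 60"], goal_cases)
            case 1
            show ?case using k3 z \<open>int l \<le> W\<close> by simp
          next
            case 2
            show ?case
            proof (rule runs_SeqI[where u = 15 and v = "11 * (K div l) + 15" and R = "\<lambda>s'. var s' ''k'' = int k0"], goal_cases)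
              case 1
              have "(l - z) * M \<le> L * M" using lL by (intro mult_right_mono) auto
              hence b: "int ((l - z) * M) + 1 \<le> W" "2 * int l \<le> W" using lL MLK KM W' by linarith+
              have lz: "int l - int z = int (l - z)" using z by simp
              have e: "(int l - int z) * int M = int ((l - z) * M)" by (simp only: lz of_nat_mult)
              have b1: "\<bar>(int l - int z) * int M\<bar> \<le> W" "\<bar>(int l - int z) * int M + 1\<bar> \<le> W"
                unfolding e using b by linarith+
              have b2: "int M \<le> W" "int l - int z + int l \<le> W"
                using b MLK lL KM W' by linarith+
              have b3: "(int l - int z) * int M + 1 = int l \<longleftrightarrow> (l - z) * M + 1 = l"
                unfolding e by linarith
              show ?case
                by (rule runs_Cond_else_Skip[where u = 4])
                   (use k3 z b1 b2 b3 \<open>int l \<le> W\<close> \<open>1 \<le> W\<close> in \<open>auto intro!: runs_Assign simp: k0_def\<close>)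
            next
              case (2 s5)
              note u5 = unchanged_var[OF 2(2)] unchanged_arr[OF 2(2)]
              have k5: "var s5 ''k'' = int k0" "var s5 ''l'' = int l" "var s5 ''K'' = int K" "var s5 ''m'' = int m"
                "var s5 ''M'' = int M" "var s5 ''L'' = int L" "arr s5 ''w'' = arr s ''w''" "arr s5 ''v'' = arr s2 ''v''"
                using 2(1) u5 k3 by simp_all
              have "int K + int l + int k0 + 1 \<le> W" using k0 lL MLK KM W' by linarith
              hence "runs W (mark_com ''w'' ''K'') s5 (11 * (K div l) + 15)
                (\<lambda>s'. \<forall>j. arr s' ''w'' j = (if j < K \<and> (\<exists>i. j = k0 + i * l) then 1 else arr s5 ''w'' j))"
                using l(2) by (intro runs_mark_com[OF k5(1-3) _ _ _ order_refl]) auto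
              thus ?case
              proof (rule runs_frame)
                fix s' assume w': "\<forall>j. arr s' ''w'' j = (if j < K \<and> (\<exists>i. j = k0 + i * l) then 1 else arr s5 ''w'' j)"
                  and u: "unchanged (mark_com ''w'' ''K'') s5 s'"
                have "arr s' ''w'' k = of_bool (\<exists>r. prime r \<and> odd r \<and> r < Suc l \<and> r dvd k * M + 1 \<and> r \<noteq> k * M + 1)"
                  if k: "k < K" "1 \<le> k" for k
                proof -
                  have "(\<exists>i. k = k0 + i * l) \<longleftrightarrow> l dvd k * M + 1 \<and> l \<noteq> k * M + 1"
                    unfolding k0_def
                    by (rule sieved_progression[OF mz z(2)]) (use l(2) M4 k in auto)
                  thus ?thesis unfolding ex using w' k w[OF k] k5 by auto
                qed
                thus "sieve_inv m (Suc l) s'"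
                  unfolding inv_eq using v2 unchanged_var[OF u] unchanged_arr[OF u] k5 by simp
              qed
            qed simp
          qed simp
        qed simp
      qed simp
    qed simp
  next
    show "2 + bcost ?b + (if bval ?b s then sieve_cost m l - 15 else 0) \<le> t"
      using t by (auto simp: sieve_cost_def)
  qed
qed

definition sieve_com :: com where
  "sieve_com =
     Assign ''l'' (Const 3) ;;
     While (Less (Var ''l'') (Var ''L'')) (sieve_step_com ;; Assign ''l'' (Var ''l'' +\<^sub>e Const 1))"

lemma wvars_sieve_com [simp]: "wvars sieve_com = {''l'', ''k'', ''z'', ''i''}"
  and warrs_sieve_com [simp]: "warrs sieve_com = {''v'', ''w''}"
  by (auto simp: sieve_com_def)

lemma sieve_inv_frame:
  assumes "sieve_inv m l s" "\<And>x. x \<in> {''M'', ''m'', ''L'', ''K''} \<Longrightarrow> var s' x = var s x" "arr s' = arr s"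
  shows "sieve_inv m l s'"
  using assms unfolding sieve_inv_def by simp

lemma runs_sieve_com:
  assumes vars: "var s ''M'' = int (2 ^ m)" "var s ''m'' = int m" "var s ''L'' = int (2 ^ m * m)"
      "var s ''K'' = int (2 ^ m * m * m)"
    and zero: "arr s ''v'' = (\<lambda>_. 0)" "arr s ''w'' = (\<lambda>_. 0)" and m: "2 \<le> m"
    and W: "4 * (int (2 ^ m * m * m) * 2 ^ m) + 4 \<le> W"
    and t: "(\<Sum>l = 3..<2 ^ m * m. sieve_cost m l + 10) + 10 \<le> t"
  shows "runs W sieve_com s t (sieve_inv m (2 ^ m * m))"
proof -
  define L where "L = (2::nat) ^ m * m"
  have L: "8 \<le> L"
    using mult_mono[of 4 "(2::nat) ^ m" 2 m] power_increasing[OF m, of "2::nat"] m by (simp add: L_def)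
  have LW: "4 * int L + 4 \<le> W"
  proof -
    have "L \<le> L * m * 2 ^ m" using m by simp
    hence "int L \<le> int (L * m * 2 ^ m)" by (simp only: of_nat_le_iff)
    also have "int (L * m * 2 ^ m) = int (2 ^ m * m * m) * 2 ^ m" by (simp add: L_def)
    finally have "int L \<le> int (2 ^ m * m * m) * 2 ^ m" .
    thus ?thesis using W by linarith
  qed
  let ?b = "Less (Var ''l'') (Var ''L'')"
  let ?c = "sieve_step_com ;; Assign ''l'' (Var ''l'' +\<^sub>e Const 1)"
  define I where "I u s' \<longleftrightarrow> (\<exists>l. 3 \<le> l \<and> l \<le> L \<and> var s' ''l'' = int l \<and> sieve_inv m l s' \<and>
     u = (\<Sum>x = l..<L. sieve_cost m x + 10))" for u s'
  have Lvar: "var s' ''L'' = int L" if "sieve_inv m l s'" for l s'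
    using that by (simp add: sieve_inv_def L_def)
  let ?s = "s\<lparr>var := (var s)(''l'' := aval (Const 3) s)\<rparr>"
  have "runs W (While ?b ?c) ?s ((\<Sum>l = 3..<L. sieve_cost m l + 10) + 4) (sieve_inv m L)"
  proof (rule runs_While[where I = I])
    \<comment> \<open>No odd prime is below 3, so the arrays of zeros satisfy the invariant at the
      start.\<close>
    have "\<not> (prime r \<and> odd r \<and> r < 3)" for r :: nat
      using prime_ge_2_nat[of r] by (cases "r = 2") auto
    hence "sieve_inv m 3 ?s" unfolding sieve_inv_def using vars zero by auto
    thus "I (\<Sum>l = 3..<L. sieve_cost m l + 10) ?s"
      unfolding I_def using L by (intro exI[of _ 3]) auto
  next
    fix u s' assume "I u s'"
    then obtain l where "l \<le> L" "var s' ''l'' = int l" "sieve_inv m l s'"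
      unfolding I_def by blast
    thus "bsafe W ?b s'" using Lvar LW by simp
  next
    fix u s' assume "I u s'" "bval ?b s'"
    then obtain l where l: "3 \<le> l" "var s' ''l'' = int l" "sieve_inv m l s'"
       "u = (\<Sum>x = l..<L. sieve_cost m x + 10)" and "int l < int L"
      unfolding I_def using Lvar by auto
    hence lL: "l < L" by simp
    have "runs W ?c s' (sieve_cost m l + 4) (\<lambda>s''. I (\<Sum>x = Suc l..<L. sieve_cost m x + 10) s'')"
    proof (rule runs_SeqI)
      show "runs W sieve_step_com s' (sieve_cost m l) (sieve_inv m (Suc l))"
        by (rule runs_sieve_step_com[OF l(3,2,1) _ m W]) (use lL in \<open>simp_all add: L_def\<close>)
    next
      fix s1 assume inv: "sieve_inv m (Suc l) s1" and "unchanged sieve_step_com s' s1"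
      hence l1: "var s1 ''l'' = int l" using l(2) unchanged_var by simp
      show "runs W (Assign ''l'' (Var ''l'' +\<^sub>e Const 1)) s1 4 (\<lambda>s''. I (\<Sum>x = Suc l..<L. sieve_cost m x + 10) s'')"
      proof (rule runs_Assign)
        show "asafe W (Var ''l'' +\<^sub>e Const 1) s1" using l1 lL LW by simp
        let ?s2 = "s1\<lparr>var := (var s1)(''l'' := aval (Var ''l'' +\<^sub>e Const 1) s1)\<rparr>"
        have "sieve_inv m (Suc l) ?s2" by (rule sieve_inv_frame[OF inv]) auto
        moreover have "var ?s2 ''l'' = int (Suc l)" using l1 by simp
        ultimately show "I (\<Sum>x = Suc l..<L. sieve_cost m x + 10) ?s2"
          unfolding I_def using lL l(1) by (intro exI[of _ "Suc l"]) auto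
      qed simp
    qed simp
    moreover have "(\<Sum>x = Suc l..<L. sieve_cost m x + 10) + (sieve_cost m l + 4) + 1 + bcost ?b \<le> u"
      using lL l(4) by (simp add: sum.atLeast_Suc_lessThan)
    ultimately have "runs W ?c s' (sieve_cost m l + 4)
      (\<lambda>s''. \<exists>u'. I u' s'' \<and> u' + (sieve_cost m l + 4) + 1 + bcost ?b \<le> u)"
      by (elim runs_weaken) auto
    thus "\<exists>v. runs W ?c s' v (\<lambda>s''. \<exists>u'. I u' s'' \<and> u' + v + 1 + bcost ?b \<le> u)" by blast
  next
    fix u s' assume "I u s'" "\<not> bval ?b s'"
    then obtain l where "l \<le> L" "sieve_inv m l s'" "\<not> int l < int L"
      unfolding I_def using Lvar by auto
    thus "sieve_inv m L s'" by (simp add: order_antisym_conv)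
  qed simp
  thus ?thesis
    unfolding sieve_com_def L_def
    by (intro runs_Assign_Seq[where u = "(\<Sum>l = 3..<2 ^ m * m. sieve_cost m l + 10) + 4"])
       (use LW t in auto)
qed

text \<open>All candidates are bounded by \<open>2 ^ m * m * m * 2 ^ m\<close>, the square of
  \<open>L = 2 ^ m * m\<close>, so the primes below \<open>L\<close> decide them. The bound is
  strict since a candidate is odd and \<open>L * L\<close> is even.\<close>

lemma sieve_inv_final:
  assumes inv: "sieve_inv m (2 ^ m * m) s" and k: "1 \<le> k" "k < 2 ^ m * m * m" and m: "0 < m"
  shows "arr s ''w'' k = of_bool (\<not> prime (k * 2 ^ m + 1))"
proof -
  define n where "n = k * 2 ^ m + 1"
  define L where "L = (2::nat) ^ m * m"
  have n1: "1 < n" using k(1) by (simp add: n_def)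
  have on: "odd n" using m by (simp add: n_def)
  have "(k + 1) * 2 ^ m \<le> 2 ^ m * m * m * 2 ^ m" using k(2) by (intro mult_right_mono) auto
  moreover have "n \<le> (k + 1) * 2 ^ m" unfolding n_def by simp
  moreover have "2 ^ m * m * m * 2 ^ m = L * L" by (simp add: L_def)
  ultimately have "n \<le> L * L" by linarith
  moreover have "even (L * L)" using m by (simp add: L_def)
  ultimately have nL: "n < L * L" using on by (metis le_neq_implies_less)
  have "prime n \<longleftrightarrow> \<not> (\<exists>r. prime r \<and> odd r \<and> r < L \<and> r dvd n \<and> r \<noteq> n)"
  proof
    assume "prime n"
    thus "\<not> (\<exists>r. prime r \<and> odd r \<and> r < L \<and> r dvd n \<and> r \<noteq> n)"
      using primes_dvd_imp_eq by blast
  next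
    assume *: "\<not> (\<exists>r. prime r \<and> odd r \<and> r < L \<and> r dvd n \<and> r \<noteq> n)"
    show "prime n"
    proof (rule prime_if_no_small_factor[OF n1 nL])
      fix r assume r: "prime r" "r < L" "r dvd n"
      moreover have "odd r" using r(3) on dvd_trans by blast
      ultimately show "r = n" using * by blast
    qed
  qed
  thus ?thesis using inv k unfolding sieve_inv_def n_def L_def by auto
qed

text \<open>The loop needs no upper limit: by the Bach-Sorenson bound an unmarked entry occurs among
  the sieved ones. Starting from 1, the first such entry is the least multiplier.\<close>

definition search_com :: com where
  "search_com =
     Assign ''k'' (Const 1) ;;
     While (Negate (Equal (Elem ''w'' (Var ''k'')) (Const 0))) (Assign ''k'' (Var ''k'' +\<^sub>e Const 1)) ;;
     Assign ''p'' (Var ''k'' *\<^sub>e Var ''M'' +\<^sub>e Const 1)"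

lemma wvars_search_com [simp]: "wvars search_com = {''k'', ''p''}"
  and warrs_search_com [simp]: "warrs search_com = {}"
  by (auto simp: search_com_def)

lemma runs_search_com:
  assumes w: "\<And>i. 1 \<le> i \<Longrightarrow> i \<le> k \<Longrightarrow> arr s ''w'' i = of_bool (\<not> prime (i * M + 1))"
    and k: "1 \<le> k" "prime (k * M + 1)" "\<And>i. 1 \<le> i \<Longrightarrow> i < k \<Longrightarrow> \<not> prime (i * M + 1)"
    and M: "var s ''M'' = int M" "0 < M"
    and W: "int (k * M) + 1 \<le> W" and t: "10 * k + 20 \<le> t"
  shows "runs W search_com s t (\<lambda>s'. var s' ''k'' = int k \<and> var s' ''p'' = int (k * M + 1))"
proof -
  let ?b = "Negate (Equal (Elem ''w'' (Var ''k'')) (Const 0))"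
  let ?c = "Assign ''k'' (Var ''k'' +\<^sub>e Const 1)"
  have kM: "k \<le> k * M" "M \<le> k * M" using M(2) k(1) by simp_all
  hence kW: "int k + 1 \<le> W" "int M \<le> W" using W by linarith+
  define I where "I u s' \<longleftrightarrow> (\<exists>i. 1 \<le> i \<and> i \<le> k \<and> var s' ''k'' = int i \<and> var s' ''M'' = int M \<and>
      arr s' ''w'' = arr s ''w'' \<and> u = (k - i) * 10)" for u and s' :: state
  let ?s = "s\<lparr>var := (var s)(''k'' := aval (Const 1) s)\<rparr>"
  have loop: "runs W (While ?b ?c) ?s ((k - 1) * 10 + 6) (\<lambda>s'. var s' ''k'' = int k \<and> var s' ''M'' = int M)"
  proof (rule runs_While[where I = I])
    show "I ((k - 1) * 10) ?s" unfolding I_def using k(1) M by (intro exI[of _ 1]) auto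
  next
    fix u s' assume "I u s'"
    then obtain i where i: "1 \<le> i" "i \<le> k" "var s' ''k'' = int i" "arr s' ''w'' = arr s ''w''"
      unfolding I_def by blast
    have "arr s ''w'' i = 0 \<or> arr s ''w'' i = 1" unfolding w[OF i(1,2)] by auto
    thus "bsafe W ?b s'" using i kW by auto
  next
    fix u s' assume "I u s'" "bval ?b s'"
    then obtain i where i: "1 \<le> i" "i \<le> k" "var s' ''k'' = int i" "var s' ''M'' = int M"
      "arr s' ''w'' = arr s ''w''" "u = (k - i) * 10" "arr s ''w'' i \<noteq> 0"
      unfolding I_def by auto
    have "i \<noteq> k" using i(1,2,7) w[of i] k(2) by auto
    hence ik: "i < k" using i(2) by simp
    hence "k - i = Suc (k - Suc i)" by simp
    hence u: "(k - Suc i) * 10 + 4 + 1 + bcost ?b \<le> u" unfolding i(6) by simp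
    have "runs W ?c s' 4 (I ((k - Suc i) * 10))"
    proof (rule runs_Assign)
      show "I ((k - Suc i) * 10) (s'\<lparr>var := (var s')(''k'' := aval (Var ''k'' +\<^sub>e Const 1) s')\<rparr>)"
        unfolding I_def using i ik by (intro exI[of _ "Suc i"]) auto
    qed (use i kW in auto)
    hence "runs W ?c s' 4 (\<lambda>s''. \<exists>u'. I u' s'' \<and> u' + 4 + 1 + bcost ?b \<le> u)"
      by (rule runs_weaken) (use u in auto)
    thus "\<exists>v. runs W ?c s' v (\<lambda>s''. \<exists>u'. I u' s'' \<and> u' + v + 1 + bcost ?b \<le> u)" by blast
  next
    fix u s' assume "I u s'" "\<not> bval ?b s'"
    then obtain i where i: "1 \<le> i" "i \<le> k" "var s' ''k'' = int i" "var s' ''M'' = int M" "arr s ''w'' i = 0"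
      unfolding I_def by auto
    have "i = k" using w[of i] i(1,2,5) k(3)[of i] by (cases "i < k") auto
    thus "var s' ''k'' = int k \<and> var s' ''M'' = int M" using i by simp
  qed simp
  show ?thesis
    unfolding search_com_def
  proof (rule runs_Assign_Seq[where u = "10 * k + 15"], goal_cases)
    case 2
    show ?case
    proof (rule runs_SeqI[OF loop, where v = 6], goal_cases)
      case (1 s')
      have "int k * int M + 1 \<le> W" using W by simp
      thus ?case using 1(1) kW by (intro runs_Assign) (auto simp: abs_mult)
    qed (use k(1) in simp)
  qed (use kW t in auto)
qed

section \<open>Modular powers and the root of unity\<close>

definition pow_com :: "aexp \<Rightarrow> com" where
  "pow_com d =
     Assign ''e'' d ;; Assign ''z'' (Var ''g'') ;; Assign ''y'' (Const 1) ;;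
     While (Less (Const 0) (Var ''e''))
       (Assign ''y'' ((Var ''y'' *\<^sub>e (Const 1 +\<^sub>e (Var ''e'' mod\<^sub>e Const 2) *\<^sub>e (Var ''z'' -\<^sub>e Const 1))) mod\<^sub>e Var ''p'') ;;
        Assign ''z'' ((Var ''z'' *\<^sub>e Var ''z'') mod\<^sub>e Var ''p'') ;;
        Assign ''e'' (Var ''e'' div\<^sub>e Const 2))"

lemma wvars_pow_com [simp]: "wvars (pow_com d) = {''e'', ''z'', ''y''}"
  and warrs_pow_com [simp]: "warrs (pow_com d) = {}"
  by (auto simp: pow_com_def)

text \<open>Binary exponentiation, at 28 steps for each of the \<open>b\<close> bits. The factor
  \<open>1 + (e mod 2) * (z - 1)\<close> is \<open>z\<close> for odd \<open>e\<close> and 1 for even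
  \<open>e\<close>, which replaces a branch.\<close>

lemma runs_pow_com:
  fixes p x E b :: nat
  assumes d: "asafe W d s" "aval d s = int E" and vars: "var s ''g'' = int x" "var s ''p'' = int p"
    and "x < p" "1 < p" "E < 2 ^ b"
    and W: "int p * int p + int p \<le> W" "int E \<le> W"
    and t: "28 * b + acost d + 12 \<le> t"
  shows "runs W (pow_com d) s t (\<lambda>s'. var s' ''y'' = int (x ^ E mod p))"
proof -
  let ?P = "int p"
  let ?b = "Less (Const 0) (Var ''e'')"
  let ?y = "(Var ''y'' *\<^sub>e (Const 1 +\<^sub>e (Var ''e'' mod\<^sub>e Const 2) *\<^sub>e (Var ''z'' -\<^sub>e Const 1))) mod\<^sub>e Var ''p''"
  let ?z = "(Var ''z'' *\<^sub>e Var ''z'') mod\<^sub>e Var ''p''"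
  let ?c = "Assign ''y'' ?y ;; Assign ''z'' ?z ;; Assign ''e'' (Var ''e'' div\<^sub>e Const 2)"
  have P2: "2 * ?P \<le> ?P * ?P" using assms(6) by (intro mult_right_mono) auto
  \<comment> \<open>The value \<open>y * z ^ e\<close> is invariant modulo \<open>p\<close>, and
    \<open>i\<close> bounds the number of bits of \<open>e\<close> that are left.\<close>
  define I where "I u s' \<longleftrightarrow> (\<exists>i e y z. e < 2 ^ i \<and> u = 28 * i \<and> var s' ''e'' = int e \<and> e \<le> E \<and>
      var s' ''p'' = ?P \<and> var s' ''y'' = int y \<and> var s' ''z'' = int z \<and> y < p \<and> z < p \<and>
      [y * z ^ e = x ^ E] (mod p))" for u and s' :: state
  let ?s = "s\<lparr>var := (var s)(''e'' := int E, ''z'' := int x, ''y'' := 1)\<rparr>"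
  have loop: "runs W (While ?b ?c) ?s (28 * b + 4) (\<lambda>s'. var s' ''y'' = int (x ^ E mod p))"
  proof (rule runs_While[where I = I])
    show "I (28 * b) ?s"
      unfolding I_def using vars assms(5-7)
      by (intro exI[of _ b] exI[of _ E] exI[of _ 1] exI[of _ x]) auto
  next
    fix u s' assume "I u s'"
    thus "bsafe W ?b s'" unfolding I_def using W by auto
  next
    fix u s' assume "I u s'" "bval ?b s'"
    then obtain i e y z where e: "e < 2 ^ i" "u = 28 * i" "var s' ''e'' = int e" "e \<le> E" "0 < e"
      and v: "var s' ''p'' = ?P" "var s' ''y'' = int y" "var s' ''z'' = int z" "y < p" "z < p"
      and c: "[y * z ^ e = x ^ E] (mod p)"
      unfolding I_def by auto
    obtain j where j: "i = Suc j" using e(1,5) by (cases i) auto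
    define f where "f = (if odd e then z else 1)"
    have f: "1 + (int e mod 2) * (int z - 1) = int f"
    proof (cases "odd e")
      case True
      hence "int e mod 2 = 1" by presburger
      thus ?thesis using True by (simp add: f_def)
    next
      case False
      hence "int e mod 2 = 0" by presburger
      thus ?thesis using False by (simp add: f_def)
    qed
    have fp: "f < p" using v(5) assms(6) by (simp add: f_def)
    have b0: "0 \<le> int y * int f" "int y * int f \<le> ?P * ?P" "0 \<le> int z * int z" "int z * int z \<le> ?P * ?P"
      using v(4,5) fp residue_mult_bounds[of "int y" ?P "int f"] residue_mult_bounds[of "int z" ?P "int z"]
      by simp_all
    have em: "0 \<le> int e mod 2" "int e mod 2 \<le> 1" by simp_all
    have mid: "\<bar>(int e mod 2) * (int z - 1)\<bar> \<le> W"
      using f fp P2 W(1) by linarith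
    have rng: "0 \<le> (int y * int f) mod ?P" "(int y * int f) mod ?P < ?P"
       "0 \<le> (int z * int z) mod ?P" "(int z * int z) mod ?P < ?P" using assms(6) by simp_all
    have s1: "asafe W ?y s'"
    proof -
      have "\<bar>int y\<bar> \<le> W" "\<bar>int e\<bar> \<le> W" "\<bar>int z\<bar> \<le> W" "\<bar>int z - 1\<bar> \<le> W" "\<bar>int f\<bar> \<le> W" "2 \<le> W"
        "\<bar>int y * int f\<bar> \<le> W" "\<bar>(int y * int f) mod ?P\<bar> \<le> W" "?P \<le> W" "int e mod 2 \<le> W"
        using b0 rng em v(4,5) fp e(4) W P2 assms(6) by linarith+
      thus ?thesis using mid v e assms(6) by (simp add: f)
    qed
    have y': "aval ?y s' = int (y * f mod p)"
      using v e by (simp add: f zmod_int)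
    have "[y * f mod p * (z * z mod p) ^ (e div 2) = x ^ E] (mod p)"
    proof -
      have "y * f * (z * z) ^ (e div 2) = y * z ^ e"
      proof -
        have "f * (z * z) ^ (e div 2) = z ^ e"
        proof (cases "odd e")
          case True
          hence "e = Suc (2 * (e div 2))" by presburger
          hence "z ^ e = z * (z ^ 2) ^ (e div 2)" by (metis power_Suc power_mult)
          thus ?thesis using True by (simp add: f_def power2_eq_square)
        next
          case False
          hence "e = 2 * (e div 2)" by presburger
          hence "z ^ e = (z ^ 2) ^ (e div 2)" by (metis power_mult)
          thus ?thesis using False by (simp add: f_def power2_eq_square)
        qed
        thus ?thesis by (simp add: mult.assoc)
      qed
      moreover have "[y * f mod p * (z * z mod p) ^ (e div 2) = y * f * (z * z) ^ (e div 2)] (mod p)"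
        by (intro cong_mult cong_pow) (simp_all add: cong_def)
      ultimately show ?thesis using c cong_trans by metis
    qed
    moreover have "e div 2 < 2 ^ j" using e(1) j by simp
    ultimately have I': "I (28 * j) (s'\<lparr>var := (var s')(''y'' := int (y * f mod p), ''z'' := int (z * z mod p), ''e'' := int (e div 2))\<rparr>)"
      unfolding I_def using v e assms(6)
      by (intro exI[of _ j] exI[of _ "e div 2"] exI[of _ "y * f mod p"] exI[of _ "z * z mod p"]) auto
    have "(int z * int z) mod ?P = int (z * z mod p)" "int e div 2 = int (e div 2)"
      by (simp_all add: zmod_int zdiv_int)
    hence I'': "I (28 * j) (s'\<lparr>var := (var s')(''y'' := int (y * f mod p), ''z'' := (int z * int z) mod ?P, ''e'' := int e div 2)\<rparr>)"
      using I' by (simp only:)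
    have "runs W ?c s' 24 (I (28 * j))"
    proof (rule runs_Assign_Seq[OF s1, where u = 10], goal_cases)
      case 1
      show ?case unfolding y'
      proof (rule runs_Assign_Seq[where u = 4], goal_cases)
        case 1
        have "\<bar>int z\<bar> \<le> W" "\<bar>int z * int z\<bar> \<le> W" "\<bar>(int z * int z) mod ?P\<bar> \<le> W" "?P \<le> W"
          using b0 rng v(4,5) W P2 assms(6) by linarith+
        thus ?case using v assms(6) by simp
      next
        case 2
        have "0 \<le> int e div 2" "int e div 2 \<le> int e" by simp_all
        hence "\<bar>int e div 2\<bar> \<le> W" "\<bar>int e\<bar> \<le> W" "2 \<le> W" using e(4) W P2 assms(6) by linarith+
        thus ?case
          using v e I'' by (intro runs_Assign) simp_all
      qed simp
    qed simp
    hence "runs W ?c s' 24 (\<lambda>s''. \<exists>u'. I u' s'' \<and> u' + 24 + 1 + bcost ?b \<le> u)"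
      by (rule runs_weaken) (use e(2) j in auto)
    thus "\<exists>v. runs W ?c s' v (\<lambda>s''. \<exists>u'. I u' s'' \<and> u' + v + 1 + bcost ?b \<le> u)" by blast
  next
    fix u s' assume "I u s'" "\<not> bval ?b s'"
    thus "var s' ''y'' = int (x ^ E mod p)" unfolding I_def by (auto simp: cong_def)
  qed simp
  have "\<bar>int x\<bar> \<le> W" "1 \<le> W" using P2 W(1) assms(5,6) by linarith+
  thus ?thesis
    unfolding pow_com_def
    by (intro runs_Assign_Seq[OF d(1), where u = "28 * b + 8"] runs_Assign_Seq[where u = "28 * b + 6"]
          runs_Assign_Seq[where u = "28 * b + 4"])
       (use d vars t loop in auto)
qed

text \<open>At each loop test \<open>y\<close> is \<open>g ^ ((p - 1) div 2) mod p\<close>; for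
  \<open>g = 1\<close> this is 1 and needs no computation. The second \<open>pow_com\<close> raises
  the nonresidue found to the power \<open>k\<close>. As \<open>fill\<close> excludes its upper end,
  \<open>h = m + 1\<close> makes the table of repeated squares reach index \<open>m\<close>.\<close>

definition root_com :: com where
  "root_com =
     Assign ''g'' (Const 1) ;; Assign ''y'' (Const 1) ;;
     While (Negate (Equal (Var ''y'') (Var ''p'' -\<^sub>e Const 1)))
       (Assign ''g'' (Var ''g'' +\<^sub>e Const 1) ;; pow_com ((Var ''p'' -\<^sub>e Const 1) div\<^sub>e Const 2)) ;;
     pow_com (Var ''k'') ;;
     Assign ''q'' (Var ''y'') ;;
     Store ''r'' (Const 0) (Var ''q'') ;;
     Assign ''h'' (Var ''m'' +\<^sub>e Const 1) ;;
     fill ''r'' (Const 1) ''h''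
       ((Elem ''r'' (Var ''i'' -\<^sub>e Const 1) *\<^sub>e Elem ''r'' (Var ''i'' -\<^sub>e Const 1)) mod\<^sub>e Var ''p'')"

lemma wvars_root_com [simp]: "wvars root_com = {''g'', ''e'', ''z'', ''y'', ''q'', ''h'', ''i''}"
  and warrs_root_com [simp]: "warrs root_com = {''r''}"
  by (auto simp: root_com_def)

lemma runs_fill_squares:
  assumes vars: "var s ''h'' = int (m + 1)" "var s ''p'' = P" and r: "arr s ''r'' 0 = x" and x: "0 \<le> x" "x < P"
    and W: "P * P + P \<le> W" "int m + 2 \<le> W" and t: "35 * (m + 1) \<le> t"
  shows "runs W (fill ''r'' (Const 1) ''h''
       ((Elem ''r'' (Var ''i'' -\<^sub>e Const 1) *\<^sub>e Elem ''r'' (Var ''i'' -\<^sub>e Const 1)) mod\<^sub>e Var ''p'')) s t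
    (\<lambda>s'. \<forall>i \<le> m. arr s' ''r'' i = x ^ (2 ^ i) mod P)"
proof (rule runs_fill[where l = 1 and h = "m + 1" and g = "\<lambda>i. x ^ (2 ^ i) mod P"])
  fix j assume j: "1 \<le> j" "j < m + 1"
  let ?s = "fill_state s ''r'' 1 (\<lambda>i. x ^ (2 ^ i) mod P) j"
  define y where "y = x ^ (2 ^ (j - 1)) mod P"
  have r': "arr ?s ''r'' (j - 1) = y"
    using j r x by (cases "j = 1") (auto simp: y_def)
  have P0: "0 < P" using x by simp
  have y: "0 \<le> y" "y < P" unfolding y_def using P0 by simp_all
  have "0 \<le> y * y" "y * y \<le> P * P" by (rule residue_mult_bounds[OF y y])+
  moreover have "0 \<le> (y * y) mod P" "(y * y) mod P < P" using P0 by simp_all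
  moreover have "0 \<le> P * P" by simp
  ultimately have b: "\<bar>y\<bar> \<le> W" "\<bar>y * y\<bar> \<le> W" "\<bar>(y * y) mod P\<bar> \<le> W" "P \<le> W"
    using W y by linarith+
  have "x ^ (2 ^ j) = x ^ (2 ^ (j - 1)) * x ^ (2 ^ (j - 1))"
    using j by (cases j) (auto simp: mult_2 power_add)
  hence "y * y mod P = x ^ (2 ^ j) mod P"
    unfolding y_def by (simp add: mod_simps)
  moreover have "nat (int j - 1) = j - 1" using j by simp
  ultimately show "asafe W ((Elem ''r'' (Var ''i'' -\<^sub>e Const 1) *\<^sub>e Elem ''r'' (Var ''i'' -\<^sub>e Const 1)) mod\<^sub>e Var ''p'') ?s \<and>
      aval ((Elem ''r'' (Var ''i'' -\<^sub>e Const 1) *\<^sub>e Elem ''r'' (Var ''i'' -\<^sub>e Const 1)) mod\<^sub>e Var ''p'') ?s = x ^ (2 ^ j) mod P"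
    using b j r' vars W(2) P0 by (simp del: fill_state_simps(2))
next
  show "\<forall>i\<le>m. arr (fill_state s ''r'' 1 (\<lambda>i. x ^ (2 ^ i) mod P) (m + 1)) ''r'' i = x ^ (2 ^ i) mod P"
    using r x by (auto simp: not_le)
qed (use assms in auto)

lemma runs_root_com:
  fixes p :: nat
  assumes p: "prime p" "2 < p" "p = k * 2 ^ m + 1" "p \<le> 2 ^ b"
    and vars: "var s ''p'' = int p" "var s ''k'' = int k" "var s ''m'' = int m"
    and W: "int p * int p + int p \<le> W" "int m + 2 \<le> W"
    and t: "(least_nonresidue p + 1) * (28 * b + 28) + 35 * (m + 1) + 20 \<le> t"
  defines "q \<equiv> least_nonresidue p ^ k mod p"
  shows "runs W root_com s t (\<lambda>s'. var s' ''q'' = int q \<and>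
    (\<forall>i \<le> m. arr s' ''r'' i = int q ^ (2 ^ i) mod int p))"
proof -
  define a where "a = least_nonresidue p"
  have a: "1 < a" "a < p" "\<not> QuadRes (int p) (int a)" "\<And>g. g < a \<Longrightarrow> QuadRes (int p) (int g)"
    unfolding a_def using least_nonresidue[OF p(1,2)] by auto
  let ?d = "(Var ''p'' -\<^sub>e Const 1) div\<^sub>e Const 2"
  let ?b = "Negate (Equal (Var ''y'') (Var ''p'' -\<^sub>e Const 1))"
  let ?c = "Assign ''g'' (Var ''g'' +\<^sub>e Const 1) ;; pow_com ?d"
  let ?C = "28 * b + 28"
  have P2: "3 * int p \<le> int p * int p" using p(2) by (intro mult_right_mono) auto
  have pW: "2 * int p \<le> W" using P2 W(1) by linarith
  define I where "I u s' \<longleftrightarrow> (\<exists>g. 1 \<le> g \<and> g \<le> a \<and> u = (a - g) * ?C \<and> var s' ''g'' = int g \<and>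
      var s' ''y'' = int (g ^ ((p - 1) div 2) mod p) \<and> var s' ''p'' = int p \<and> var s' ''k'' = int k \<and> var s' ''m'' = int m)"
    for u and s' :: state
  \<comment> \<open>Euler's criterion makes the exit test exact, so the loop ends at the least
    nonresidue and that number controls its running time.\<close>
  have stop: "int (g ^ ((p - 1) div 2) mod p) = int p - 1 \<longleftrightarrow> \<not> QuadRes (int p) (int g)" for g
  proof -
    have "int p - 1 = int (p - 1)" using p(2) by simp
    thus ?thesis using nonresidue_power[OF p(1,2), of g] by (simp only: of_nat_eq_iff)
  qed
  let ?s = "s\<lparr>var := (var s)(''g'' := 1, ''y'' := 1)\<rparr>"
  have d: "asafe W ?d s'" "aval ?d s' = int ((p - 1) div 2)" if "var s' ''p'' = int p" for s'
  proof -
    have e: "int p - 1 = int (p - 1)" using p(2) by simp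
    have "0 \<le> (int p - 1) div 2" "(int p - 1) div 2 \<le> int p" using p(2) by simp_all
    thus "asafe W ?d s'" using that pW p(2) by simp
    show "aval ?d s' = int ((p - 1) div 2)" using that by (simp add: e zdiv_int del: of_nat_diff)
  qed
  have half: "(p - 1) div 2 \<le> p" by simp
  have hb: "(p - 1) div 2 < 2 ^ b" "k < 2 ^ b"
  proof -
    show "(p - 1) div 2 < 2 ^ b" using p(2,4) by linarith
    have "k \<le> k * 2 ^ m" by simp
    thus "k < 2 ^ b" using p(3,4) by linarith
  qed
  have loop: "runs W (While ?b ?c) ?s ((a - 1) * ?C + 7)
    (\<lambda>s'. var s' ''g'' = int a \<and> var s' ''p'' = int p \<and> var s' ''k'' = int k \<and> var s' ''m'' = int m)"
  proof (rule runs_While[where I = I])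
    show "I ((a - 1) * ?C) ?s" unfolding I_def using vars a p(2) by (intro exI[of _ 1]) auto
  next
    fix u s' assume "I u s'"
    then obtain g where g: "var s' ''y'' = int (g ^ ((p - 1) div 2) mod p)" "var s' ''p'' = int p"
      unfolding I_def by blast
    have "g ^ ((p - 1) div 2) mod p < p" using p(2) by simp
    hence "int (g ^ ((p - 1) div 2) mod p) < int p" by (simp only: of_nat_less_iff)
    hence "\<bar>var s' ''y''\<bar> \<le> W" unfolding g(1) using pW by linarith
    thus "bsafe W ?b s'" using g(2) pW p(2) by simp
  next
    fix u s' assume "I u s'" "bval ?b s'"
    then obtain g where g: "1 \<le> g" "g \<le> a" "u = (a - g) * ?C" "var s' ''g'' = int g"
      "var s' ''p'' = int p" "var s' ''k'' = int k" "var s' ''m'' = int m"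
      and "int (g ^ ((p - 1) div 2) mod p) \<noteq> int p - 1"
      unfolding I_def by (auto simp del: of_nat_mod of_nat_power)
    hence "QuadRes (int p) (int g)" using stop by blast
    hence ga: "g < a" using a(3) g(2) by (metis le_neq_implies_less)
    hence "a - g = Suc (a - Suc g)" by simp
    hence u: "(a - Suc g) * ?C + (28 * b + 21) + 1 + bcost ?b \<le> u" unfolding g(3) by simp
    let ?s1 = "s'\<lparr>var := (var s')(''g'' := aval (Var ''g'' +\<^sub>e Const 1) s')\<rparr>"
    have v1: "var ?s1 ''g'' = int (Suc g)" "var ?s1 ''p'' = int p" "var ?s1 ''k'' = int k" "var ?s1 ''m'' = int m"
      using g by simp_all
    have "runs W ?c s' (28 * b + 21) (I ((a - Suc g) * ?C))"
    proof (rule runs_Assign_Seq[where u = "28 * b + 17"], goal_cases)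
      case 1
      show ?case using g ga a(2) pW by simp
    next
      case 2
      have "runs W (pow_com ?d) ?s1 (28 * b + 17) (\<lambda>s''. var s'' ''y'' = int (Suc g ^ ((p - 1) div 2) mod p))"
        by (rule runs_pow_com[OF d[OF v1(2)] v1(1,2) _ _ hb(1)]) (use ga a(2) p(2) W pW in auto)
      thus ?case
      proof (rule runs_frame)
        fix s'' assume y: "var s'' ''y'' = int (Suc g ^ ((p - 1) div 2) mod p)" and un: "unchanged (pow_com ?d) ?s1 s''"
        have "var s'' ''g'' = int (Suc g)" "var s'' ''p'' = int p" "var s'' ''k'' = int k" "var s'' ''m'' = int m"
          using unchanged_var[OF un] v1 by simp_all
        thus "I ((a - Suc g) * ?C) s''" unfolding I_def using y ga by (intro exI[of _ "Suc g"]) auto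
      qed
    qed simp
    hence "runs W ?c s' (28 * b + 21) (\<lambda>s''. \<exists>u'. I u' s'' \<and> u' + (28 * b + 21) + 1 + bcost ?b \<le> u)"
      by (rule runs_weaken) (use u in auto)
    thus "\<exists>v. runs W ?c s' v (\<lambda>s''. \<exists>u'. I u' s'' \<and> u' + v + 1 + bcost ?b \<le> u)" by blast
  next
    fix u s' assume "I u s'" "\<not> bval ?b s'"
    then obtain g where g: "g \<le> a" "var s' ''g'' = int g"
      "var s' ''p'' = int p" "var s' ''k'' = int k" "var s' ''m'' = int m"
      and "int (g ^ ((p - 1) div 2) mod p) = int p - 1"
      unfolding I_def by (auto simp del: of_nat_mod of_nat_power)
    hence "\<not> QuadRes (int p) (int g)" using stop by blast
    hence "g = a" using a(4) g(1) by (metis le_neq_implies_less)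
    thus "var s' ''g'' = int a \<and> var s' ''p'' = int p \<and> var s' ''k'' = int k \<and> var s' ''m'' = int m" using g by simp
  qed simp
  have qp: "q < p" unfolding q_def using p(2) by simp
  let ?F = "35 * (m + 1)"
  show ?thesis
    unfolding root_com_def
  proof (rule runs_Assign_Seq[where u = "a * ?C + 28 * b + 32 + ?F"], goal_cases)
    case 2
    show ?case
    proof (rule runs_Assign_Seq[where u = "a * ?C + 28 * b + 30 + ?F"], goal_cases)
      case 2
      have s: "s\<lparr>var := (var s)(''g'' := aval (Const 1) s)\<rparr>\<lparr>var := (var (s\<lparr>var := (var s)(''g'' := aval (Const 1) s)\<rparr>))
        (''y'' := aval (Const 1) (s\<lparr>var := (var s)(''g'' := aval (Const 1) s)\<rparr>))\<rparr> = ?s" by simp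
      show ?case unfolding s
      proof (rule runs_SeqI[OF loop, where v = "28 * b + 23 + ?F"], goal_cases)
        case (1 s1)
        hence v1: "var s1 ''g'' = int a" "var s1 ''p'' = int p" "var s1 ''k'' = int k" "var s1 ''m'' = int m" by auto
        have "k \<le> k * 2 ^ m" by simp
        hence kp: "k \<le> p" using p(3) by linarith
        show ?case
        proof (rule runs_SeqI[where u = "28 * b + 13" and v = "10 + ?F" and R = "\<lambda>s'. var s' ''y'' = int q"], goal_cases)
          case 1
          show ?case unfolding q_def a_def[symmetric]
            by (rule runs_pow_com[OF _ _ v1(1,2) _ _ hb(2)]) (use v1 a(2) p(2) W pW kp in auto)
        next
          case (2 s2)
          note un = unchanged_var[OF 2(2)]
          have v2: "var s2 ''y'' = int q" "var s2 ''p'' = int p" "var s2 ''m'' = int m" using 2(1) un v1 by simp_all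
          let ?s3 = "s2\<lparr>var := (var s2)(''q'' := int q)\<rparr>"
          let ?s4 = "?s3\<lparr>arr := (arr ?s3)(''r'' := (arr ?s3 ''r'')(0 := int q))\<rparr>"
          let ?s5 = "?s4\<lparr>var := (var ?s4)(''h'' := int m + 1)\<rparr>"
          have fill: "runs W (fill ''r'' (Const 1) ''h''
              ((Elem ''r'' (Var ''i'' -\<^sub>e Const 1) *\<^sub>e Elem ''r'' (Var ''i'' -\<^sub>e Const 1)) mod\<^sub>e Var ''p'')) ?s5 ?F
            (\<lambda>s'. var s' ''q'' = int q \<and> (\<forall>i \<le> m. arr s' ''r'' i = int q ^ (2 ^ i) mod int p))"
          proof (rule runs_frame)
            show "runs W (fill ''r'' (Const 1) ''h''
              ((Elem ''r'' (Var ''i'' -\<^sub>e Const 1) *\<^sub>e Elem ''r'' (Var ''i'' -\<^sub>e Const 1)) mod\<^sub>e Var ''p'')) ?s5 ?F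
              (\<lambda>s'. \<forall>i \<le> m. arr s' ''r'' i = int q ^ (2 ^ i) mod int p)"
              by (rule runs_fill_squares[where m = m and P = "int p"]) (use v2 qp W in auto)
          qed (use unchanged_var in fastforce)
          show ?case
          proof (rule runs_Assign_Seq[where u = "8 + ?F"], goal_cases)
            case 2
            show ?case
            proof (rule runs_Store_Seq[where u = "4 + ?F"], goal_cases)
              case 4
              show ?case
              proof (rule runs_Assign_Seq[where u = ?F], goal_cases)
                case 2
                show ?case using fill v2 by simp
              qed (use v2 W in auto)
            qed (use v2 qp pW in auto)
          qed (use v2 qp pW in auto)
        qed simp
      qed (use a(1) in \<open>auto simp: algebra_simps\<close>)
    qed (use pW p(2) in auto)
  qed (use pW p(2) t in \<open>auto simp: a_def algebra_simps\<close>)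
qed

section \<open>The whole precomputation\<close>

definition pre_com :: com where
  "pre_com =
     pow2_com ''N'' ''m'' ;;
     Assign ''L'' (Var ''M'' *\<^sub>e Var ''m'') ;;
     Assign ''K'' (Var ''L'' *\<^sub>e Var ''m'') ;;
     sieve_com ;; search_com ;; root_com"

definition ntt_prime :: "nat \<Rightarrow> nat" where
  "ntt_prime N = dyadic_multiplier (level N) * 2 ^ level N + 1"

definition ntt_root :: "nat \<Rightarrow> nat" where
  "ntt_root N = least_nonresidue (ntt_prime N) ^ dyadic_multiplier (level N) mod ntt_prime N"

text \<open>The factor \<open>112 * m + 28\<close> is the price of one modular power, 28 steps for
  each of \<open>4 * m\<close> bits, including the loop around it. The search computes fewer powers
  than the least nonresidue, so the added 1 leaves room for the final power that yields the
  root.\<close>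

definition pre_time :: "nat \<Rightarrow> nat" where
  "pre_time N = (let m = level N in
     (\<Sum>l = 3..<2 ^ m * m. sieve_cost m l + 10) + 10 * (2 ^ m * m * m) +
     (least_nonresidue (ntt_prime N) + 1) * (112 * m + 28) + 100 * (m + 1) + 100)"

lemma level_ge_2: "2 \<le> N \<Longrightarrow> 2 \<le> level N"
  using level_ge[of N] by (cases "level N"; cases "level N - 1") auto

text \<open>The bound on the multiplier together with \<open>m < 2 ^ m\<close> shows that
  \<open>4 * m\<close> bits suffice. This bounds the length of the exponents in the modular powers,
  and \<open>ln p\<close> in Ankeny's estimate.\<close>

lemma ntt_prime_bounds:
  assumes "bach_sorenson_bound" "2 \<le> N"
  defines "m \<equiv> level N"
  shows "prime (ntt_prime N)" "2 < ntt_prime N" "ntt_prime N \<le> 2 ^ (4 * m)"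
    "ntt_prime N < 2 ^ m * m * m * 2 ^ m"
proof -
  have m: "2 \<le> m" unfolding m_def using assms(2) by (rule level_ge_2)
  note k = dyadic_multiplier[OF assms(1) m]
  have p: "ntt_prime N = dyadic_multiplier m * 2 ^ m + 1" by (simp add: ntt_prime_def m_def)
  show "prime (ntt_prime N)" unfolding p by (rule k(2))
  have M: "4 \<le> (2::nat) ^ m" using power_increasing[OF m, of "2::nat"] by simp
  moreover have "1 * 2 ^ m \<le> dyadic_multiplier m * 2 ^ m" by (rule mult_right_mono[OF k(1)]) simp
  ultimately show "2 < ntt_prime N" unfolding p by linarith
  have "(dyadic_multiplier m + 1) * 2 ^ m \<le> 2 ^ m * m * m * 2 ^ m"
    using k(3) by (intro mult_right_mono) auto
  thus less: "ntt_prime N < 2 ^ m * m * m * 2 ^ m" unfolding p using M by simp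
  have "2 ^ m * m * m * 2 ^ m \<le> 2 ^ m * 2 ^ m * 2 ^ m * (2::nat) ^ m"
    by (intro mult_mono less_imp_le[OF less_exp]) auto
  also have "\<dots> = 2 ^ (4 * m)" by (simp flip: power_add)
  finally show "ntt_prime N \<le> 2 ^ (4 * m)" using less by linarith
qed

lemma ntt_root:
  assumes "bach_sorenson_bound" "2 \<le> N"
  shows "ord (ntt_prime N) (ntt_root N) = 2 ^ level N" "ntt_root N < ntt_prime N"
proof -
  note p = ntt_prime_bounds[OF assms]
  show "ord (ntt_prime N) (ntt_root N) = 2 ^ level N"
    unfolding ntt_root_def
    by (rule ord_nonresidue_power[OF p(1,2) ntt_prime_def])
       (use level_ge_2[OF assms(2)] least_nonresidue[OF p(1,2)] in auto)
  show "ntt_root N < ntt_prime N"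
    unfolding ntt_root_def using p(2) by simp
qed

lemma suitable_ntt_root:
  assumes "bach_sorenson_bound" "2 \<le> N"
  shows "suitable_root N (ntt_prime N) (ntt_root N)"
  unfolding suitable_root_def using ntt_prime_bounds[OF assms] ntt_root[OF assms] level_ge by blast

lemma runs_pre_com:
  assumes bach: "bach_sorenson_bound" and N: "2 \<le> N"
  defines "m \<equiv> level N"
  defines "B \<equiv> 2 ^ m * m * m * 2 ^ m"
  assumes W: "4 * (int B * int B) + 4 \<le> W"
  shows "runs W pre_com (init_state N) (pre_time N) (\<lambda>s. var s ''p'' = int (ntt_prime N) \<and>
    var s ''q'' = int (ntt_root N) \<and> var s ''m'' = int m \<and>
    (\<forall>i \<le> m. arr s ''r'' i = int (ntt_root N) ^ (2 ^ i) mod int (ntt_prime N)))"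
proof -
  define M where "M = (2::nat) ^ m"
  define k where "k = dyadic_multiplier m"
  define p where "p = ntt_prime N"
  have m: "2 \<le> m" unfolding m_def using N by (rule level_ge_2)
  note k = dyadic_multiplier[OF bach m, folded k_def M_def]
  have pk: "p = k * M + 1" by (simp add: p_def ntt_prime_def k_def M_def m_def)
  note p = ntt_prime_bounds[OF bach N, folded m_def p_def]
  have M4: "4 \<le> M" unfolding M_def using power_increasing[OF m, of "2::nat"] by simp
  have B: "B = M * m * m * M" by (simp add: B_def M_def)
  have le: "M \<le> M * m" "M * m \<le> M * m * m" "m \<le> M * m" "M * m * m \<le> B" unfolding B using m M4 by simp_all
  have pB: "p < B" using p(4) by (simp add: B_def)
  \<comment> \<open>Since \<open>B\<close> is at least 4, the square absorbs all linear terms, and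
    one word bound serves the sieve as well as the products of residues.\<close>
  have BB: "4 * int B \<le> int B * int B"
  proof (intro mult_right_mono)
    have "4 \<le> B" using le M4 by linarith
    thus "4 \<le> int B" by simp
  qed simp
  have BW: "16 * int B + 4 \<le> W" using BB W by linarith
  have pW: "int p * int p + int p \<le> W"
  proof -
    have "int p * int p \<le> int B * int B" using pB by (intro mult_mono) auto
    thus ?thesis using pB BW W BB by linarith
  qed
  have NM: "2 * N \<le> M" unfolding M_def m_def by (rule level_ge)
  let ?S = "\<Sum>l = 3..<M * m. sieve_cost m l + 10"
  let ?R = "(least_nonresidue p + 1) * (28 * (4 * m) + 28) + 35 * (m + 1) + 20"
  have init: "var (init_state N) ''N'' = int N" "arr (init_state N) = (\<lambda>_ _. 0)"
    by (simp_all add: init_state_def)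
  show ?thesis
    unfolding pre_com_def p_def[symmetric]
  proof (rule runs_SeqI[where u = "20 * (m + 1)" and v = "?S + 10 * (M * m * m) + ?R + 40" and
        R = "\<lambda>s'. var s' ''M'' = int M \<and> var s' ''m'' = int m"], goal_cases)
    case 1
    have "4 * int N \<le> W" using NM le BW by linarith
    thus ?case by (intro runs_pow2_com[OF init(1)]) (use N in \<open>auto simp: M_def m_def\<close>)
  next
    case (2 s1)
    note v1 = 2(1) unchanged_arr[OF 2(2)]
    let ?s2 = "s1\<lparr>var := (var s1)(''L'' := int (M * m))\<rparr>"
    let ?s3 = "?s2\<lparr>var := (var ?s2)(''K'' := int (M * m * m))\<rparr>"
    have b: "int M \<le> W" "int m \<le> W" "int (M * m) \<le> W" "int (M * m * m) \<le> W"
      using le BW by linarith+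
    show ?case
    proof (rule runs_Assign_Seq[where u = "?S + 10 * (M * m * m) + ?R + 36"], goal_cases)
      case 1
      show ?case using v1 b by (simp add: abs_mult)
    next
      case 2
      have L: "aval (Var ''M'' *\<^sub>e Var ''m'') s1 = int (M * m)" using v1 by simp
      show ?case unfolding L
      proof (rule runs_Assign_Seq[where u = "?S + 10 * (M * m * m) + ?R + 32"], goal_cases)
        case 1
        show ?case using v1 b by (simp add: abs_mult)
      next
        case 2
        have K: "aval (Var ''L'' *\<^sub>e Var ''m'') ?s2 = int (M * m * m)" using v1 by simp
        have v3: "var ?s3 ''M'' = int M" "var ?s3 ''m'' = int m" "var ?s3 ''L'' = int (M * m)"
          "var ?s3 ''K'' = int (M * m * m)" "arr ?s3 ''v'' = (\<lambda>_. 0)" "arr ?s3 ''w'' = (\<lambda>_. 0)"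
          using v1 init(2) by simp_all
        show ?case unfolding K
        proof (rule runs_SeqI[where u = "?S + 10" and v = "10 * (M * m * m) + ?R + 20" and R = "sieve_inv m (M * m)"], goal_cases)
          case 1
          have "4 * (int (M * m * m) * int M) + 4 \<le> W"
          proof -
            have "int (M * m * m) * int M = int B" by (simp add: B)
            thus ?thesis using BW by simp
          qed
          thus ?case unfolding M_def
            by (intro runs_sieve_com) (use v3 m in \<open>simp_all add: M_def\<close>)
        next
          case (2 s4)
          note inv = 2(1)
          have v4: "var s4 ''M'' = int M" "var s4 ''m'' = int m"
            using inv unfolding sieve_inv_def M_def by simp_all
          show ?case
          proof (rule runs_SeqI[where u = "10 * (M * m * m) + 20" and v = ?R and
                R = "\<lambda>s'. var s' ''k'' = int k \<and> var s' ''p'' = int (k * M + 1)"], goal_cases)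
            case 1
            have t: "10 * k + 20 \<le> 10 * (M * m * m) + 20" using k(3) by simp
            have kW: "int (k * M) + 1 \<le> W" using pB pk BW by linarith
            show ?case
            proof (rule runs_search_com[OF _ k(1,2,4) v4(1) _ kW t])
              fix i assume i: "1 \<le> i" "i \<le> k"
              hence "i < M * m * m" using k(3) by linarith
              thus "arr s4 ''w'' i = of_bool (\<not> prime (i * M + 1))"
                unfolding M_def
                by (intro sieve_inv_final[OF inv[unfolded M_def] i(1)]) (use m in \<open>simp_all add: M_def\<close>)
            qed (use M4 in auto)
          next
            case (2 s5)
            have v5: "var s5 ''p'' = int p" "var s5 ''k'' = int k" "var s5 ''m'' = int m"
              using 2(1) unchanged_var[OF 2(2)] v4 by (simp_all add: pk)
            have q: "ntt_root N = least_nonresidue p ^ k mod p"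
              by (simp add: ntt_root_def p_def k_def m_def)
            have "int m + 2 \<le> W" using le BW M4 by linarith
            note root = runs_root_com[OF p(1,2) pk[unfolded M_def] p(3) v5 pW this order_refl]
            show ?case
              by (rule runs_frame[OF root]) (use unchanged_var v5 q in \<open>auto simp: p_def\<close>)
          qed simp
        qed simp
      qed simp
    qed simp
  qed (simp add: pre_time_def Let_def m_def M_def p_def)
qed

section \<open>Asymptotic bounds\<close>

lemma level_le_log: "0 < n \<Longrightarrow> real (level n) \<le> log 2 (4 * real n)"
proof -
  assume n: "0 < n"
  have "real (2 ^ level n) < real (4 * n)"
    using two_power_level_less[OF n] by (simp only: of_nat_less_iff)
  hence "(2::real) ^ level n \<le> 4 * real n" by simp
  thus ?thesis using n by (simp add: le_log_iff powr_realpow)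
qed

lemma two_power_level_le: "0 < n \<Longrightarrow> real (2 ^ level n) \<le> 4 * real n"
  using two_power_level_less[of n] by (metis less_imp_le of_nat_le_iff of_nat_mult of_nat_numeral)

lemma conv_time_bigo: "(\<lambda>n. real (conv_time n)) \<in> O(\<lambda>n. real n * ln (real n))"
proof -
  have "(\<lambda>n. real (conv_time n)) \<in> O(\<lambda>n. 1000 * (log 2 (4 * real n) + 1) * (4 * real n + 1))"
  proof (rule landau_o.big_mono, rule eventually_mono[OF eventually_gt_at_top[of 0]])
    fix n :: nat assume n: "0 < n"
    have "real (conv_time n) = 1000 * (real (level n) + 1) * (real (2 ^ level n) + 1)"
      by (simp add: conv_time_def algebra_simps)
    also have "\<dots> \<le> 1000 * (log 2 (4 * real n) + 1) * (4 * real n + 1)"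
      using level_le_log[OF n] two_power_level_le[OF n] by (intro mult_mono add_mono) auto
    finally show "norm (real (conv_time n)) \<le> norm (1000 * (log 2 (4 * real n) + 1) * (4 * real n + 1))"
      by simp
  qed
  also have "(\<lambda>n. 1000 * (log 2 (4 * real n) + 1) * (4 * real n + 1)) \<in> O(\<lambda>n::nat. real n * ln (real n))"
    by real_asymp
  finally show ?thesis .
qed

text \<open>The quotients are replaced by real fractions and summed over the primes; because
  \<open>2 ^ m * m \<le> 2 ^ (2 * m)\<close>, \<open>J = 2 * m\<close> dyadic blocks suffice, which
  gives a logarithm of \<open>m\<close>. The halving cost \<open>20 * m\<close> may be charged to
  every \<open>l < L\<close>, since \<open>L * m\<close> is only the number of candidates.\<close>

lemma sum_sieve_cost:
  assumes m: "2 \<le> m"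
  shows "real (\<Sum>l = 3..<2 ^ m * m. sieve_cost m l + 10) \<le>
    11 * (2 ^ m * real m + 2 ^ m * real m * real m) * (3 + 2 * ln (2 * real m)) + 2 ^ m * real m * (20 * real m + 130)"
proof -
  define L where "L = (2::nat) ^ m * m"
  define K where "K = L * m"
  let ?c = "20 * real m + 130" and ?P = "{l::nat. prime l \<and> l < L}"
  have fin: "finite ?P" by (rule finite_subset[of _ "{..<L}"]) auto
  have "real (sieve_cost m l + 10) \<le> (if prime l then 11 * (real L + real K) * (1 / real l) else 0) + ?c" for l
  proof (cases "prime l")
    case True
    have "real (L div l) \<le> real L / real l" "real (K div l) \<le> real K / real l"
      by (rule of_nat_div_le_of_nat)+
    moreover have "11 * (real L + real K) * (1 / real l) = 11 * (real L / real l) + 11 * (real K / real l)"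
      by (simp add: add_divide_distrib)
    ultimately have "11 * real (L div l) + 11 * real (K div l) \<le> 11 * (real L + real K) * (1 / real l)"
      by linarith
    thus ?thesis using True by (simp add: sieve_cost_def L_def K_def)
  qed (simp add: sieve_cost_def)
  hence "real (\<Sum>l = 3..<L. sieve_cost m l + 10) \<le>
      (\<Sum>l = 3..<L. (if prime l then 11 * (real L + real K) * (1 / real l) else 0) + ?c)"
    unfolding of_nat_sum by (intro sum_mono)
  also have "\<dots> \<le> (\<Sum>l<L. (if prime l then 11 * (real L + real K) * (1 / real l) else 0) + ?c)"
    by (intro sum_mono2) auto
  also have "\<dots> = (\<Sum>l<L. if prime l then 11 * (real L + real K) * (1 / real l) else 0) + real L * ?c"
    by (simp add: sum.distrib)
  also have "(\<Sum>l<L. if prime l then 11 * (real L + real K) * (1 / real l) else 0) =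
      11 * (real L + real K) * (\<Sum>l\<in>?P. 1 / real l)"
    unfolding sum_distrib_left by (rule sum.mono_neutral_cong_right) auto
  also have "(\<Sum>l\<in>?P. 1 / real l) \<le> 3 + 2 * ln (real (2 * m))"
  proof (rule sum_inverse_primes)
    have "L \<le> 2 ^ m * 2 ^ m" unfolding L_def using less_exp[of m] by simp
    also have "\<dots> \<le> 2 ^ Suc (2 * m)" by (simp add: mult_2 power_add)
    finally show "L \<le> 2 ^ Suc (2 * m)" .
  qed (use m in simp)
  finally show ?thesis by (simp add: L_def K_def mult_left_mono)
qed

lemma pre_time_bigo:
  assumes bach: "bach_sorenson_bound" and ankeny: "ankeny_bound"
  shows "(\<lambda>N. real (pre_time N)) \<in> O(\<lambda>N. real N * (ln (real N))\<^sup>2 * ln (ln (real N)))"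
proof -
  obtain C where C: "\<And>p. prime p \<Longrightarrow> p > 2 \<Longrightarrow> real (least_nonresidue p) \<le> C * (ln (real p))\<^sup>2"
    using ankeny unfolding ankeny_bound_def by blast
  \<comment> \<open>Nothing prevents the constant in Ankeny's bound from being negative; the
    monotonicity arguments below need a nonnegative one.\<close>
  define D where "D = max C 0"
  \<comment> \<open>Here \<open>y\<close> stands for \<open>2 ^ m\<close> and \<open>x\<close> for
    \<open>m\<close>; they are replaced by the upper bounds \<open>4 * N\<close> and
    \<open>log 2 (4 * N)\<close>. The term \<open>y * x * x * ln (2 * x)\<close> dominates, while
    the search for a nonresidue, \<open>D * g x\<close>, is only cubic in \<open>x\<close>. Keeping
    the unknown \<open>D\<close> outside \<open>g\<close> leaves explicit functions to be
    compared.\<close>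
  define f where "f y x = 11 * (y * x + y * x * x) * (3 + 2 * ln (2 * x)) + y * x * (20 * x + 130) +
     10 * (y * x * x) + 100 * (x + 1) + 100" for y x :: real
  define g where "g x = (16 * x\<^sup>2) * (112 * x + 28)" for x :: real
  define x where "x N = log 2 (4 * real N)" for N
  have le: "real (pre_time N) \<le> f (4 * real N) (x N) + (112 * x N + 28) + D * g (x N)" if N: "2 \<le> N" for N
  proof -
    define m where "m = level N"
    define p where "p = ntt_prime N"
    have m: "2 \<le> m" unfolding m_def using N by (rule level_ge_2)
    note p = ntt_prime_bounds[OF bach N, folded m_def p_def]
    have mx: "real m \<le> x N" unfolding m_def x_def using N by (intro level_le_log) simp
    have M: "2 ^ m \<le> 4 * real N" using two_power_level_le[of N] N by (simp add: m_def)
    have x2: "2 \<le> x N" using m mx by linarith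
    have S: "real (\<Sum>l = 3..<2 ^ m * m. sieve_cost m l + 10) \<le>
      11 * (4 * real N * x N + 4 * real N * x N * x N) * (3 + 2 * ln (2 * x N)) + 4 * real N * x N * (20 * x N + 130)"
      using mx M m by (intro order_trans[OF sum_sieve_cost[OF m]] add_mono mult_mono) auto
    have K: "real (10 * (2 ^ m * m * m)) \<le> 10 * (4 * real N * x N * x N)"
    proof -
      have "real (10 * (2 ^ m * m * m)) = 10 * (2 ^ m * real m * real m)" by simp
      also have "\<dots> \<le> 10 * (4 * real N * x N * x N)"
        using mx M by (intro mult_left_mono mult_mono) auto
      finally show ?thesis .
    qed
    have "ln (real p) \<le> 4 * real m"
    proof -
      have "real p \<le> real (2 ^ (4 * m))" using p(3) by (simp only: of_nat_le_iff)
      hence "ln (real p) \<le> ln (2 ^ (4 * m))" using p(2) by (intro ln_mono) auto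
      also have "\<dots> = 4 * real m * ln 2" by (simp add: ln_realpow)
      also have "\<dots> \<le> 4 * real m * 1" using ln_2_less_1 by (intro mult_left_mono) auto
      finally show ?thesis by simp
    qed
    hence lnp: "ln (real p) \<le> 4 * x N" "0 \<le> ln (real p)" using mx p(2) by auto
    have "real (least_nonresidue p) \<le> C * (ln (real p))\<^sup>2" by (rule C[OF p(1,2)])
    also have "\<dots> \<le> D * (4 * x N)\<^sup>2"
      using lnp by (intro mult_mono power_mono) (auto simp: D_def)
    finally have "real (least_nonresidue p) \<le> D * (16 * (x N)\<^sup>2)" by (simp add: power_mult_distrib)
    hence "real ((least_nonresidue p + 1) * (112 * m + 28)) \<le> (D * (16 * (x N)\<^sup>2) + 1) * (112 * x N + 28)"
    proof -
      assume "real (least_nonresidue p) \<le> D * (16 * (x N)\<^sup>2)"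
      hence "(real (least_nonresidue p) + 1) * (112 * real m + 28) \<le> (D * (16 * (x N)\<^sup>2) + 1) * (112 * x N + 28)"
        using mx x2 by (intro mult_mono) (auto simp: D_def)
      thus ?thesis by (simp add: algebra_simps)
    qed
    hence "real ((least_nonresidue p + 1) * (112 * m + 28)) \<le> (112 * x N + 28) + D * g (x N)"
      by (simp add: g_def algebra_simps)
    moreover have "real (100 * (m + 1) + 100) \<le> 100 * (x N + 1) + 100" using mx by simp
    moreover have "real (pre_time N) = real (\<Sum>l = 3..<2 ^ m * m. sieve_cost m l + 10) + real (10 * (2 ^ m * m * m)) +
        real ((least_nonresidue p + 1) * (112 * m + 28)) + real (100 * (m + 1) + 100)"
      unfolding pre_time_def Let_def m_def p_def by (simp only: of_nat_add add.assoc)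
    ultimately show ?thesis using S K unfolding f_def by linarith
  qed
  let ?h = "\<lambda>N::nat. real N * (ln (real N))\<^sup>2 * ln (ln (real N))"
  have "(\<lambda>N. real (pre_time N)) \<in> O(\<lambda>N. f (4 * real N) (x N) + (112 * x N + 28) + D * g (x N))"
  proof (rule landau_o.big_mono, rule eventually_mono[OF eventually_ge_at_top[of 2]])
    fix N :: nat assume "2 \<le> N"
    thus "norm (real (pre_time N)) \<le> norm (f (4 * real N) (x N) + (112 * x N + 28) + D * g (x N))"
      using le[of N] by simp
  qed
  also have "(\<lambda>N. f (4 * real N) (x N) + (112 * x N + 28) + D * g (x N)) \<in> O(?h)"
  proof (intro sum_in_bigo(1))
    show "(\<lambda>N. f (4 * real N) (x N)) \<in> O(?h)" unfolding f_def x_def by real_asymp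
    show "(\<lambda>N. 112 * x N) \<in> O(?h)" "(\<lambda>N. 28) \<in> O(?h)" unfolding x_def by real_asymp+
    have "(\<lambda>N. g (x N)) \<in> O(?h)" unfolding g_def x_def by real_asymp
    thus "(\<lambda>N. D * g (x N)) \<in> O(?h)" by (cases "D = 0") simp_all
  qed
  finally show ?thesis .
qed

section \<open>Convolutions after the precomputation\<close>

lemma conv_coeff_cong:
  assumes "\<And>i. i < n \<Longrightarrow> a i = a' i" "\<And>i. i < n \<Longrightarrow> b i = b' i"
  shows "conv_coeff n a b s = conv_coeff n a' b' s"
  unfolding conv_coeff_def by (intro sum.cong refl) (auto simp: assms)

text \<open>The data handed from the precomputation to the convolutions. Neither loading an input
  nor \<open>conv_com\<close> writes to any of it, so one precomputation serves any number of
  convolutions.\<close>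

definition ntt_ready :: "nat \<Rightarrow> state \<Rightarrow> bool" where
  "ntt_ready N s \<longleftrightarrow> var s ''p'' = int (ntt_prime N) \<and> var s ''m'' = int (level N) \<and>
     (\<forall>i \<le> level N. arr s ''r'' i = int (ntt_root N) ^ (2 ^ i) mod int (ntt_prime N))"

lemma runs_conv_com_ready:
  assumes bach: "bach_sorenson_bound" and N: "2 \<le> N" and ready: "ntt_ready N s" and n: "1 \<le> n" "n \<le> N"
    and W: "int (ntt_prime N) * int (ntt_prime N) + int (ntt_prime N) \<le> W" "8 * int N + 2 \<le> W" "int (level N) < W"
    and ab: "\<And>i. i < n \<Longrightarrow> \<bar>a i\<bar> \<le> W \<and> \<bar>b i\<bar> \<le> W"
  shows "runs W conv_com (load_input n a b s) (conv_time n)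
    (\<lambda>s'. is_acyclic_conv_mod (ntt_prime N) n a b (arr s' ''c'') \<and> ntt_ready N s')"
proof -
  let ?s = "load_input n a b s" and ?p = "ntt_prime N"
  note p = ntt_prime_bounds[OF bach N]
  have in_arr: "arr ?s ''a'' i = a i" "arr ?s ''b'' i = b i" if "i < n" for i
    using that by (simp_all add: load_input_def)
  have ready': "ntt_ready N ?s" using ready by (simp add: ntt_ready_def load_input_def)
  have root: "root_mod (int ?p) (2 ^ level N) (int (ntt_root N))"
    by (rule root_mod_ord[OF ntt_root(1)[OF bach N]]) simp
  have "odd ?p" using p(1,2) by (simp add: prime_odd_nat)
  hence odd: "odd (int ?p)" by simp
  have "2 * n \<le> 2 ^ level N" using level_ge[of N] n(2) by linarith
  hence "runs W conv_com ?s (conv_time n) (\<lambda>s'. unchanged conv_com ?s s' \<and>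
      (\<forall>k < 2 * n. [arr s' ''c'' k = conv_coeff n (arr ?s ''a'') (arr ?s ''b'') k] (mod int ?p)))"
    using n W ab in_arr ready' odd root p(1)
    by (intro runs_conv_com[where m = "level N" and q = "int (ntt_root N)"])
       (auto simp: ntt_ready_def load_input_def)
  thus ?thesis
  proof (rule runs_weaken[OF _ order_refl])
    fix s' assume s': "unchanged conv_com ?s s' \<and>
      (\<forall>k < 2 * n. [arr s' ''c'' k = conv_coeff n (arr ?s ''a'') (arr ?s ''b'') k] (mod int ?p))"
    have "conv_coeff n (arr ?s ''a'') (arr ?s ''b'') k = conv_coeff n a b k" for k
      by (rule conv_coeff_cong) (simp_all add: in_arr)
    hence "is_acyclic_conv_mod ?p n a b (arr s' ''c'')"
      unfolding is_acyclic_conv_mod_def using s' n(1) by auto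
    moreover have "ntt_ready N s'"
      using ready' unchanged_var[of conv_com ?s s'] unchanged_arr[of conv_com ?s s'] s'
      by (simp add: ntt_ready_def wvars_conv_com warrs_conv_com)
    ultimately show "is_acyclic_conv_mod ?p n a b (arr s' ''c'') \<and> ntt_ready N s'" ..
  qed
qed

text \<open>For \<open>N \<ge> 2\<close> we have \<open>M < 4 * N \<le> N ^ 3\<close>, hence
  \<open>B \<le> M ^ 4 \<le> N ^ 12\<close> and
  \<open>4 * B * B + 4 \<le> 8 * B * B \<le> N ^ 3 * N ^ 24\<close>; this is the exponent 27. The
  summand \<open>d\<close> makes room for the entries of the input sequences.\<close>

lemma word_bounds:
  fixes d :: nat
  assumes bach: "bach_sorenson_bound" and N: "2 \<le> N"
  defines "m \<equiv> level N" and "W \<equiv> int N ^ (27 + d)"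
  defines "B \<equiv> 2 ^ m * m * m * 2 ^ m"
  shows "4 * (int B * int B) + 4 \<le> W"
    "int (ntt_prime N) * int (ntt_prime N) + int (ntt_prime N) \<le> W" "8 * int N + 2 \<le> W" "int m < W"
    "int N ^ d \<le> W"
proof -
  define M where "M = (2::nat) ^ m"
  have m: "2 \<le> m" unfolding m_def using N by (rule level_ge_2)
  have M4: "4 \<le> M" unfolding M_def using power_increasing[OF m, of "2::nat"] by simp
  have mM: "m \<le> M" unfolding M_def by (rule less_imp_le[OF less_exp])
  have N2: "4 \<le> N ^ 2" using power_mono[OF N, of 2] by simp
  have "M < 4 * N" unfolding M_def m_def using N by (intro two_power_level_less) simp
  also have "4 * N \<le> N ^ 2 * N" using N2 by (rule mult_right_mono) simp
  finally have MN: "M \<le> N ^ 3" by (simp add: power3_eq_cube power2_eq_square)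
  have "B = M * m * m * M" by (simp add: B_def M_def)
  also have "\<dots> \<le> M * M * M * M" using mM by (intro mult_mono) auto
  also have "\<dots> \<le> N ^ 3 * N ^ 3 * N ^ 3 * N ^ 3" using MN by (intro mult_mono) auto
  also have "\<dots> = N ^ 12" by (simp flip: power_add)
  finally have BN: "B \<le> N ^ 12" .
  have Bm: "M * m \<le> B" "M \<le> M * m" "m \<le> M * m" "4 * M \<le> B"
  proof -
    show "M * m \<le> B" "M \<le> M * m" "m \<le> M * m" unfolding B_def M_def[symmetric] using m M4 by simp_all
    have "M * m * m * 4 \<le> M * m * m * M" using M4 by (intro mult_left_mono) auto
    moreover have "M \<le> M * m * m" using m by simp
    ultimately show "4 * M \<le> B" unfolding B_def M_def[symmetric] by linarith
  qed
  have "4 * (B * B) + 4 \<le> 8 * (B * B)" using Bm M4 mult_le_mono[of 1 B 1 B] by simp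
  also have "8 * (B * B) \<le> N ^ 3 * (N ^ 12 * N ^ 12)"
    using BN power_mono[OF N, of 3] by (intro mult_mono) auto
  also have "\<dots> = N ^ 27" by (simp flip: power_add)
  also have "\<dots> \<le> N ^ (27 + d)" using N by (intro power_increasing) auto
  finally have "int (4 * (B * B) + 4) \<le> int (N ^ (27 + d))" by (simp only: of_nat_le_iff)
  thus B: "4 * (int B * int B) + 4 \<le> W" by (simp add: W_def)
  have "4 * int B \<le> int B * int B" using Bm M4 by (intro mult_right_mono) auto
  hence BW: "16 * int B + 4 \<le> W" using B by linarith
  have pB: "ntt_prime N < B" using ntt_prime_bounds(4)[OF bach N] by (simp add: B_def m_def)
  hence "int (ntt_prime N) * int (ntt_prime N) \<le> int B * int B" by (intro mult_mono) auto
  thus "int (ntt_prime N) * int (ntt_prime N) + int (ntt_prime N) \<le> W" using B BW pB \<open>4 * int B \<le> int B * int B\<close> by linarith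
  have "2 * N \<le> M" unfolding M_def m_def by (rule level_ge)
  thus "8 * int N + 2 \<le> W" using Bm BW by linarith
  show "int m < W" using Bm BW by linarith
  show "int N ^ d \<le> W" unfolding W_def using N by (intro power_increasing) auto
qed

text \<open>Programs and running times are independent of \<open>d\<close>, because the entries are
  reduced modulo the prime before anything else is done with them; only the word length has to grow,
  and \<open>c = 27 + d\<close> works. The predicate \<open>Ready\<close> is instantiated with
  \<open>ntt_ready\<close>.\<close>

theorem theorem12:
  assumes bach_sorenson: "generalized_riemann_hypothesis \<longrightarrow> bach_sorenson_bound"
    and ankeny: "generalized_riemann_hypothesis \<longrightarrow> ankeny_bound"
    and grh: "generalized_riemann_hypothesis"
  shows "\<exists>(pre :: com) (conv :: com) (p :: nat \<Rightarrow> nat) (q :: nat \<Rightarrow> nat)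
           (Tpre :: nat \<Rightarrow> nat) (Tconv :: nat \<Rightarrow> nat) (Ready :: nat \<Rightarrow> state \<Rightarrow> bool).
     (\<lambda>N. real (Tpre N)) \<in> O(\<lambda>N. real N * (ln (real N))\<^sup>2 * ln (ln (real N))) \<and>
     (\<lambda>n. real (Tconv n)) \<in> O(\<lambda>n. real n * ln (real n)) \<and>
     (\<forall>N \<ge> 2. suitable_root N (p N) (q N)) \<and>
     (\<forall>d :: nat. \<exists>c :: nat. \<forall>N \<ge> 2.
        (\<exists>t s. exec (int N ^ c) pre (init_state N) t s \<and> t \<le> Tpre N \<and>
               var s ''p'' = int (p N) \<and> var s ''q'' = int (q N) \<and> Ready N s) \<and>
        (\<forall>s n a b. Ready N s \<and> 1 \<le> n \<and> n \<le> N \<and>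
                   (\<forall>i < n. \<bar>a i\<bar> \<le> int N ^ d \<and> \<bar>b i\<bar> \<le> int N ^ d) \<longrightarrow>
           (\<exists>t s'. exec (int N ^ c) conv (load_input n a b s) t s' \<and> t \<le> Tconv n \<and>
                   is_acyclic_conv_mod (p N) n a b (arr s' ''c'') \<and> Ready N s')))"
proof -
  have bach: bach_sorenson_bound and ank: ankeny_bound
    using bach_sorenson ankeny grh by blast+
  have pre: "\<exists>t s. exec (int N ^ (27 + d)) pre_com (init_state N) t s \<and> t \<le> pre_time N \<and>
      var s ''p'' = int (ntt_prime N) \<and> var s ''q'' = int (ntt_root N) \<and> ntt_ready N s"
    if N: "2 \<le> N" for N d
    using runs_pre_com[OF bach N word_bounds(1)[OF bach N, of d]]
    unfolding runs_def ntt_ready_def by blast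
  have conv: "\<exists>t s'. exec (int N ^ (27 + d)) conv_com (load_input n a b s) t s' \<and> t \<le> conv_time n \<and>
      is_acyclic_conv_mod (ntt_prime N) n a b (arr s' ''c'') \<and> ntt_ready N s'"
    if N: "2 \<le> N" and r: "ntt_ready N s" and n: "1 \<le> n" "n \<le> N"
      and ab: "\<forall>i < n. \<bar>a i\<bar> \<le> int N ^ d \<and> \<bar>b i\<bar> \<le> int N ^ d" for N d s n a b
  proof -
    have "\<bar>a i\<bar> \<le> int N ^ (27 + d) \<and> \<bar>b i\<bar> \<le> int N ^ (27 + d)" if "i < n" for i
      using ab that word_bounds(5)[OF bach N, of d] by force
    from runs_conv_com_ready[where a = a and b = b, OF bach N r n word_bounds(2-4)[OF bach N, of d] this]
    show ?thesis unfolding runs_def by blast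
  qed
  show ?thesis
    by (rule exI[of _ pre_com], rule exI[of _ conv_com], rule exI[of _ ntt_prime], rule exI[of _ ntt_root],
        rule exI[of _ pre_time], rule exI[of _ conv_time], rule exI[of _ ntt_ready], intro conjI allI)
       (use pre_time_bigo[OF bach ank] conv_time_bigo suitable_ntt_root[OF bach] pre conv in blast)+
qed

end
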